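(* Let $n\ge0$ and consider any $n$-qubit Clifford circuit expressed in terms of the generators $H$, $S$ and controlled-$Z$ gates $Z_c$ on adjacent qubits. Then this circuit can be converted to its equivalent normal form (a normal circuit denoting the same operator) by finitely many uses of the rewrite equations (R0)–(R19) listed in the context, together with the two equations $$\text{(ACE)}\quad (\text{identity on one wire})=A_1\,C_1\,E_1,\qquad \text{(BCD)}\quad C_1^{2}=B_1^{12}\,C_1^{1}\,D_1^{12}\ \ (\text{on two wires}).$$
   Context: Matrices: $\omega=e^{i\pi/4}$ (a $0$-qubit scalar), $H=\frac1{\sqrt2}\begin{pmatrix}1&1\\1&-1\end{pmatrix}$, $S=\mathrm{diag}(1,i)$, $Z_c=\mathrm{diag}(1,1,1,-1)$, $X=\begin{pmatrix}0&1\\1&0\end{pmatrix}$. Circuits. Formal circuits are built by composition and tensor product (and identities) from the gate symbols $\omega$ (0 wires), $H,S,X$ (1 wire), $Z_c$ (2 wires), $A_i$ ($i\in\{1,2,3\}$), $C_k$ ($k\in\{1,2\}$), $E_h$ ($h\in\{1,2,3,4\}$) on 1 wire, and $B_j,D_\ell$ ($j,\ell\in\{1,2,3,4\}$) on 2 adjacent wires. Circuits are taken modulo the laws of strict spatial monoidal categories: associativity and units for composition and tensor, gates on disjoint wires commute, and scalars ($\omega$) may be moved anywhere. All the gate symbols are distinct formal symbols. A use of an equation means replacing, inside a circuit (on consecutive wires, with arbitrary surrounding gates and further wires), a subcircuit matching one side by the other side. Notation. Circuits are written in order of application (leftmost gate first). Wires are numbered $1,2,\dots$ from top to bottom. $h_q,s_q,x_q$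 denote $H,S,X$ on wire $q$; $z_{q,q+1}$ (written $z_{12}$, $z_{23}$) denotes $Z_c$ on wires $q,q+1$; $A_i^q, C_k^q, E_h^q$ denote these gates on wire $q$; $B_j^{12}$, $D_\ell^{23}$, etc. denote these gates on the indicated wires. In one-wire equations indices are omitted; in equations with two wires, $z=z_{12}$, $B_j=B_j^{12}$, $D_\ell=D_\ell^{12}$. Meaning of the gate symbols as operators: $X=HSSH$; $A_1=\mathrm{id}$, $A_2=H$, $A_3=HSH$; $C_1=\mathrm{id}$, $C_2=HSSH$; $E_1=\mathrm{id}$, $E_2=S$, $E_3=S^2$, $E_4=S^3$; $B_1=h_2zh_1h_2zh_1h_2z$, $B_2=zh_1h_2z$, $B_3=h_1s_1zh_1h_2z$, $B_4=h_1zh_1h_2z$; $D_1=zh_1h_2zh_1h_2zh_2$, $D_2=h_1zh_1h_2zh_2$, $D_3=h_1h_2s_2zh_1h_2zh_2$, $D_4=h_1h_2zh_1h_2zh_2$. Normal forms. An $n$-wire circuit ($n\ge1$) is $Z$-normal if, for some $1\le m\le n$, it is $A_i^{m}\,B_{j_1}^{m-1,m}\,B_{j_2}^{m-2,m-1}\cdots B_{j_{m-1}}^{1,2}\,C_k^{1}$; it is $X$-normal if it is $D_{\ell_1}^{1,2}D_{\ell_2}^{2,3}\cdots D_{\ell_{n-1}}^{n-1,n}E_h^{n}$. An $n$-wire circuit is normal if it is $L^{(n)}M^{(n)}L^{(n-1)}M^{(n-1)}\cdots L^{(1)}M^{(1)}\cdot\omega^p$ with $p\in\{0,\dots,7\}$,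 $L^{(r)}$ a $Z$-normal and $M^{(r)}$ an $X$-normal $r$-wire circuit acting on wires $1,\dots,r$. Rewrite equations. (R0) $\omega^8=1$. (R1) $hA_1=A_2$; $hA_2=A_1$; $hA_3=A_3\,x\,s^3\cdot\omega$. (R2) $sA_1=A_1s$; $sA_2=A_3\,x\,s^3\cdot\omega$; $sA_3=A_2\,s^3\cdot\omega$. (R3) $zA_1^1=A_1^1z$; $zA_2^1=A_1^2B_2\,z\,h_2$; $zA_3^1=A_1^2B_3\,h_2s_2h_2\,z\,s_1^3h_2$. (R4) $zA_1^2B_1=A_1^2B_1\,h_2\,z\,h_2$; $zA_1^2B_2=A_2^1\,h_2\,z$; $zA_1^2B_3=A_3^1\,h_2\,z\,s_1\,s_2h_2s_2\cdot\omega^7$; $zA_1^2B_4=A_1^2B_4\,h_2\,z\,s_2^2h_2$; $zA_2^2B_1=A_2^2B_4$; $zA_2^2B_2=A_3^2B_3\,h_2\,z\,s_1\,s_2^2h_2s_2\cdot\omega^6$; $zA_2^2B_3=A_3^2B_2\,x_1h_2\,z\,s_1^3\cdot\omega$; $zA_2^2B_4=A_2^2B_1$; $zA_3^2B_1=A_3^2B_4\,h_2\,z\,s_2h_2$; $zA_3^2B_2=A_2^2B_3\,x_1\,z\,s_1^3\,s_2^2h_2\cdot\omega$; $zA_3^2B_3=A_2^2B_2\,h_2s_2h_2\,z\,s_1^3\,s_2^3h_2\cdot\omega$; $zA_3^2B_4=A_3^2B_1\,h_2\,z\,s_2^3h_2$. (R5) $h_1B_1=B_1h_2$; $h_1B_2=B_4$;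 $h_1B_3=B_3\,x_1\,s_2^3h_2s_2$; $h_1B_4=B_2$. (R6) $s_1B_1=B_1\,h_2s_2h_2$; $s_1B_2=B_3\,x_1\,s_2^3h_2s_2$; $s_1B_3=B_2\,s_2h_2s_2$; $s_1B_4=B_4\,h_2s_2h_2$. (R7) $s_2B_1=B_1s_1$; $s_2B_j=B_j\,h_2\,z\,s_1\,s_2h_2$ for $j=2,3,4$. (R8) $x_2B_j=B_jx_1$ for $j=1,2,3,4$. (R9) (three wires) $z_{23}B_1^{12}=B_1^{12}\,z_{12}h_2z_{23}h_2z_{12}h_2z_{23}h_2$; $z_{23}B_j^{12}=B_j^{12}\,z_{12}h_2z_{23}h_2z_{12}$ for $j=2,3,4$. (R10) $xC_1=C_2$; $xC_2=C_1$. (R11) $sC_1=C_1s$; $sC_2=C_2\,s^3\cdot\omega^2$. (R12) $zC_1^1=C_1^1z$; $zC_2^1=C_2^1\,z\,s_2^2$. (R13) (three wires) Each of the following has left-hand side $z_{12}B_a^{23}B_b^{12}$; the pair $(a,b)$ and the right-hand side are: $(1,1)$: $B_1^{23}B_1^{12}\,h_2h_3\,z_{23}\,h_2h_3$; $(1,2)$: $B_4^{23}B_2^{12}\,h_3\,z_{23}\,h_3$; $(1,3)$: $B_4^{23}B_3^{12}\,h_3\,h_2s_2h_2\,z_{23}\,s_2h_2s_2\,h_3\cdot\omega^7$; $(1,4)$: $B_1^{23}B_4^{12}\,h_2h_3\,z_{23}\,h_2h_3$; $(2,1)$: $B_2^{23}B_4^{12}\,h_2\,z_{23}\,h_2$;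 $(2,2)$: $B_3^{23}B_3^{12}\,h_2s_2h_2\,h_3s_3h_3\,z_{23}\,s_2s_3\cdot\omega^6$; $(2,3)$: $B_3^{23}B_2^{12}\,x_1\,h_3s_3h_3\,z_{23}\,h_2s_2\,s_3\cdot\omega^7$; $(2,4)$: $B_2^{23}B_1^{12}\,h_2\,z_{23}\,h_2$; $(3,1)$: $B_3^{23}B_4^{12}\,h_2\,h_3s_3h_3\,z_{23}\,h_2\,s_3h_3s_3\cdot\omega^7$; $(3,2)$: $B_2^{23}B_3^{12}\,x_1\,h_2s_2h_2\,z_{23}\,s_2\,h_3s_3\cdot\omega^7$; $(3,3)$: $B_2^{23}B_2^{12}\,z_{23}\,h_2s_2\,h_3s_3$; $(3,4)$: $B_3^{23}B_1^{12}\,h_2\,h_3s_3h_3\,z_{23}\,h_2\,s_3h_3s_3\cdot\omega^7$; $(4,1)$: $B_4^{23}B_1^{12}\,h_2h_3\,z_{23}\,h_2h_3$; $(4,2)$: $B_1^{23}B_2^{12}\,h_3\,z_{23}\,h_3$; $(4,3)$: $B_1^{23}B_3^{12}\,h_3\,h_2s_2h_2\,z_{23}\,s_2h_2s_2\,h_3\cdot\omega^7$; $(4,4)$: $B_4^{23}B_4^{12}\,h_2h_3\,z_{23}\,h_2h_3$. (R14) $h_2D_1=D_1h_1$; $h_2D_2=D_4$; $h_2D_3=D_3\,s_1^3h_1s_1\,s_2^2$; $h_2D_4=D_2$. (R15) $s_2D_1=D_1\,h_1s_1h_1$; $s_2D_2=D_3\,s_1^3h_1s_1\,s_2^2$; $s_2D_3=D_2\,s_1h_1s_1$;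 $s_2D_4=D_4\,h_1s_1h_1$. (R16) $s_1D_\ell=D_\ell s_2$ for $\ell=1,2,3,4$. (R17) $zD_1=D_4$; $zD_2=D_3\,s_1^3h_1\,s_2^3$; $zD_3=D_2\,h_1s_1\,s_2$; $zD_4=D_1$. (R18) $sE_1=E_2$; $sE_2=E_3$; $sE_3=E_4$; $sE_4=E_1$. (R19) (three wires) Each of the following has left-hand side $z_{23}D_a^{12}D_b^{23}$; the pair $(a,b)$ and the right-hand side are: $(1,1)$: $D_1^{12}D_1^{23}\,h_1h_2\,z_{12}\,h_1h_2$; $(1,2)$: $D_4^{12}D_2^{23}\,h_1\,z_{12}\,h_1$; $(1,3)$: $D_4^{12}D_3^{23}\,h_1\,h_2s_2h_2\,z_{12}\,h_1\,s_2h_2s_2\cdot\omega^7$; $(1,4)$: $D_1^{12}D_4^{23}\,h_1h_2\,z_{12}\,h_1h_2$; $(2,1)$: $D_2^{12}D_4^{23}\,h_2\,z_{12}\,h_2$; $(2,2)$: $D_3^{12}D_3^{23}\,h_1s_1h_1\,h_2s_2h_2\,z_{12}\,s_1s_2\cdot\omega^6$; $(2,3)$: $D_3^{12}D_2^{23}\,h_1s_1h_1\,z_{12}\,s_1\,h_2s_2\,s_3^2\cdot\omega^7$; $(2,4)$: $D_2^{12}D_1^{23}\,h_2\,z_{12}\,h_2$; $(3,1)$: $D_3^{12}D_4^{23}\,h_2\,h_1s_1h_1\,z_{12}\,s_1h_1s_1\,h_2\cdot\omega^7$; $(3,2)$: $D_2^{12}D_3^{23}\,h_2s_2h_2\,z_{12}\,h_1s_1\,s_2\,s_3^2\cdot\omega^7$;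 $(3,3)$: $D_2^{12}D_2^{23}\,z_{12}\,h_1s_1\,h_2s_2$; $(3,4)$: $D_3^{12}D_1^{23}\,h_2\,h_1s_1h_1\,z_{12}\,s_1h_1s_1\,h_2\cdot\omega^7$; $(4,1)$: $D_4^{12}D_1^{23}\,h_1h_2\,z_{12}\,h_1h_2$; $(4,2)$: $D_1^{12}D_2^{23}\,h_1\,z_{12}\,h_1$; $(4,3)$: $D_1^{12}D_3^{23}\,h_1\,h_2s_2h_2\,z_{12}\,h_1\,s_2h_2s_2\cdot\omega^7$; $(4,4)$: $D_4^{12}D_4^{23}\,h_1h_2\,z_{12}\,h_1h_2$. *)

theory Defs
  imports Complex_Main "Jordan_Normal_Form.Matrix"
begin

section \<open>Formal circuits\<close>

datatype gate =
    Omega | H | S | X | Zc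
  | A1 | A2 | A3
  | B1 | B2 | B3 | B4
  | C1 | C2
  | D1 | D2 | D3 | D4
  | E1 | E2 | E3 | E4

primrec arity :: "gate \<Rightarrow> nat" where
  "arity Omega = 0"
| "arity H = 1" | "arity S = 1" | "arity X = 1"
| "arity Zc = 2"
| "arity A1 = 1" | "arity A2 = 1" | "arity A3 = 1"
| "arity B1 = 2" | "arity B2 = 2" | "arity B3 = 2" | "arity B4 = 2"
| "arity C1 = 1" | "arity C2 = 1"
| "arity D1 = 2" | "arity D2 = 2" | "arity D3 = 2" | "arity D4 = 2"
| "arity E1 = 1" | "arity E2 = 1" | "arity E3 = 1" | "arity E4 = 1"

text \<open>\<open>Seq c d\<close> applies \<open>c\<close> first; in \<open>Tensor c d\<close> the wires of \<open>c\<close> lie above those of \<open>d\<close>.\<close>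

datatype circuit =
    Ident nat
  | Gate gate
  | Seq circuit circuit
  | Tensor circuit circuit

primrec width :: "circuit \<Rightarrow> nat" where
  "width (Ident n) = n"
| "width (Gate g) = arity g"
| "width (Seq c d) = width c"
| "width (Tensor c d) = width c + width d"

primrec well_typed :: "circuit \<Rightarrow> bool" where
  "well_typed (Ident n) \<longleftrightarrow> True"
| "well_typed (Gate g) \<longleftrightarrow> True"
| "well_typed (Seq c d) \<longleftrightarrow> well_typed c \<and> well_typed d \<and> width c = width d"
| "well_typed (Tensor c d) \<longleftrightarrow> well_typed c \<and> well_typed d"

primrec gates :: "circuit \<Rightarrow> gate set" where
  "gates (Ident n) = {}"
| "gates (Gate g) = {g}"
| "gates (Seq c d) = gates c \<union> gates d"
| "gates (Tensor c d) = gates c \<union> gates d"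

definition is_circuit :: "nat \<Rightarrow> circuit \<Rightarrow> bool" where
  "is_circuit n c \<longleftrightarrow> well_typed c \<and> width c = n"

text \<open>The scalar \<open>Omega\<close> is admitted besides the generators \<open>H\<close>, \<open>S\<close>, \<open>Zc\<close>.
  Two-wire gates can only be placed on adjacent wires.\<close>

definition clifford_circuit :: "nat \<Rightarrow> circuit \<Rightarrow> bool" where
  "clifford_circuit n c \<longleftrightarrow> is_circuit n c \<and> gates c \<subseteq> {Omega, H, S, Zc}"

text \<open>The laws of strict spatial monoidal categories. The relation is stated on all terms,
  but the two sides of each law have the same width, and one is well-typed if and only if the
  other is; so no ill-typed term is ever related to a circuit.\<close>

inductive spatial_eq :: "circuit \<Rightarrow> circuit \<Rightarrow> bool" (infix \<open>\<simeq>\<close> 50) where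
  refl: "c \<simeq> c"
| sym: "c \<simeq> d \<Longrightarrow> d \<simeq> c"
| trans: "c \<simeq> d \<Longrightarrow> d \<simeq> e \<Longrightarrow> c \<simeq> e"
| seq_cong: "c \<simeq> c' \<Longrightarrow> d \<simeq> d' \<Longrightarrow> Seq c d \<simeq> Seq c' d'"
| tensor_cong: "c \<simeq> c' \<Longrightarrow> d \<simeq> d' \<Longrightarrow> Tensor c d \<simeq> Tensor c' d'"
| seq_assoc: "Seq (Seq c d) e \<simeq> Seq c (Seq d e)"
| seq_ident_left: "Seq (Ident (width c)) c \<simeq> c"
| seq_ident_right: "Seq c (Ident (width c)) \<simeq> c"
| tensor_assoc: "Tensor (Tensor c d) e \<simeq> Tensor c (Tensor d e)"
| tensor_unit_left: "Tensor (Ident 0) c \<simeq> c"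
| tensor_unit_right: "Tensor c (Ident 0) \<simeq> c"
| tensor_ident: "Tensor (Ident m) (Ident n) \<simeq> Ident (m + n)"
| interchange: "width c = width d \<Longrightarrow> width c' = width d' \<Longrightarrow>
    Seq (Tensor c c') (Tensor d d') \<simeq> Tensor (Seq c d) (Seq c' d')"
| spatial: "width c = 0 \<Longrightarrow> Tensor c (Ident n) \<simeq> Tensor (Ident n) c"

section \<open>Operators\<close>

definition kron :: "complex mat \<Rightarrow> complex mat \<Rightarrow> complex mat" where
  "kron M N = mat (dim_row M * dim_row N) (dim_col M * dim_col N)
     (\<lambda>(i, j). M $$ (i div dim_row N, j div dim_col N) * N $$ (i mod dim_row N, j mod dim_col N))"

definition mat_omega :: "complex mat" where
  "mat_omega = mat_of_rows_list 1 [[cis (pi / 4)]]"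

definition mat_H :: "complex mat" where
  "mat_H = complex_of_real (1 / sqrt 2) \<cdot>\<^sub>m mat_of_rows_list 2 [[1, 1], [1, -1]]"

definition mat_S :: "complex mat" where
  "mat_S = mat_of_rows_list 2 [[1, 0], [0, \<i>]]"

definition mat_Zc :: "complex mat" where
  "mat_Zc = mat_of_rows_list 4 [[1, 0, 0, 0], [0, 1, 0, 0], [0, 0, 1, 0], [0, 0, 0, -1]]"

text \<open>The list is in order of application, so the matrices are multiplied in reverse order.\<close>

definition in_order :: "nat \<Rightarrow> complex mat list \<Rightarrow> complex mat" where
  "in_order n Ms = foldl (\<lambda>M N. N * M) (1\<^sub>m (2 ^ n)) Ms"

context
begin

private abbreviation "H\<^sub>1 \<equiv> kron mat_H (1\<^sub>m 2)"
private abbreviation "H\<^sub>2 \<equiv> kron (1\<^sub>m 2) mat_H"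
private abbreviation "S\<^sub>1 \<equiv> kron mat_S (1\<^sub>m 2)"
private abbreviation "S\<^sub>2 \<equiv> kron (1\<^sub>m 2) mat_S"
private abbreviation "Z \<equiv> mat_Zc"

primrec gate_op :: "gate \<Rightarrow> complex mat" where
  "gate_op Omega = mat_omega"
| "gate_op H = mat_H"
| "gate_op S = mat_S"
| "gate_op X = in_order 1 [mat_H, mat_S, mat_S, mat_H]"
| "gate_op Zc = mat_Zc"
| "gate_op A1 = 1\<^sub>m 2"
| "gate_op A2 = mat_H"
| "gate_op A3 = in_order 1 [mat_H, mat_S, mat_H]"
| "gate_op B1 = in_order 2 [H\<^sub>2, Z, H\<^sub>1, H\<^sub>2, Z, H\<^sub>1, H\<^sub>2, Z]"
| "gate_op B2 = in_order 2 [Z, H\<^sub>1, H\<^sub>2, Z]"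
| "gate_op B3 = in_order 2 [H\<^sub>1, S\<^sub>1, Z, H\<^sub>1, H\<^sub>2, Z]"
| "gate_op B4 = in_order 2 [H\<^sub>1, Z, H\<^sub>1, H\<^sub>2, Z]"
| "gate_op C1 = 1\<^sub>m 2"
| "gate_op C2 = in_order 1 [mat_H, mat_S, mat_S, mat_H]"
| "gate_op D1 = in_order 2 [Z, H\<^sub>1, H\<^sub>2, Z, H\<^sub>1, H\<^sub>2, Z, H\<^sub>2]"
| "gate_op D2 = in_order 2 [H\<^sub>1, Z, H\<^sub>1, H\<^sub>2, Z, H\<^sub>2]"
| "gate_op D3 = in_order 2 [H\<^sub>1, H\<^sub>2, S\<^sub>2, Z, H\<^sub>1, H\<^sub>2, Z, H\<^sub>2]"
| "gate_op D4 = in_order 2 [H\<^sub>1, H\<^sub>2, Z, H\<^sub>1, H\<^sub>2, Z, H\<^sub>2]"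
| "gate_op E1 = 1\<^sub>m 2"
| "gate_op E2 = mat_S"
| "gate_op E3 = in_order 1 [mat_S, mat_S]"
| "gate_op E4 = in_order 1 [mat_S, mat_S, mat_S]"

end

primrec circuit_op :: "circuit \<Rightarrow> complex mat" where
  "circuit_op (Ident n) = 1\<^sub>m (2 ^ n)"
| "circuit_op (Gate g) = gate_op g"
| "circuit_op (Seq c d) = circuit_op d * circuit_op c"
| "circuit_op (Tensor c d) = kron (circuit_op c) (circuit_op d)"

section \<open>Gates on specified wires\<close>

text \<open>\<open>g\<langle>q\<rangle>\<close> is the gate \<open>g\<close> with topmost wire \<open>q\<close>, where wires are numbered from 1.
  A list of such gates, in order of application, represents a circuit on any sufficiently large
  number \<open>n\<close> of wires; see \<open>on_wires\<close>.\<close>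

type_synonym located_gate = "gate \<times> nat"

abbreviation located :: "gate \<Rightarrow> nat \<Rightarrow> located_gate" (\<open>_\<langle>_\<rangle>\<close> [1000, 0] 1000) where
  "g\<langle>q\<rangle> \<equiv> (g, q)"

definition place :: "nat \<Rightarrow> located_gate \<Rightarrow> circuit" where
  "place n = (\<lambda>(g, q).
     Tensor (Tensor (Ident (q - 1)) (Gate g)) (Ident (n - (q - 1 + arity g))))"

definition on_wires :: "nat \<Rightarrow> located_gate list \<Rightarrow> circuit" where
  "on_wires n gs = foldr Seq (map (place n) gs) (Ident n)"

definition phase :: "nat \<Rightarrow> located_gate list" where
  "phase p = replicate p Omega\<langle>1\<rangle>"

section \<open>Normal forms\<close>

definition Z_normal :: "nat \<Rightarrow> located_gate list set" where
  "Z_normal n =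
     {a\<langle>m\<rangle> # map (\<lambda>r. (b r)\<langle>m - r\<rangle>) [1..<m] @ [c\<langle>1\<rangle>] | m a b c.
        1 \<le> m \<and> m \<le> n \<and> a \<in> {A1, A2, A3} \<and> range b \<subseteq> {B1, B2, B3, B4} \<and> c \<in> {C1, C2}}"

definition X_normal :: "nat \<Rightarrow> located_gate list set" where
  "X_normal n =
     {map (\<lambda>r. (d r)\<langle>r\<rangle>) [1..<n] @ [e\<langle>n\<rangle>] | d e.
        range d \<subseteq> {D1, D2, D3, D4} \<and> e \<in> {E1, E2, E3, E4}}"

primrec ZX_normal :: "nat \<Rightarrow> located_gate list set" where
  "ZX_normal 0 = {[]}"
| "ZX_normal (Suc r) =
     {L @ M @ w | L M w. L \<in> Z_normal (Suc r) \<and> M \<in> X_normal (Suc r) \<and> w \<in> ZX_normal r}"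

definition normal :: "nat \<Rightarrow> circuit \<Rightarrow> bool" where
  "normal n c \<longleftrightarrow> (\<exists>w p. w \<in> ZX_normal n \<and> p \<le> 7 \<and> c = on_wires n (w @ phase p))"

section \<open>Rewrite equations\<close>

type_synonym equation = "located_gate list \<times> located_gate list"

context
begin

private abbreviation (input) equate :: "located_gate list \<Rightarrow> located_gate list \<Rightarrow> equation"
  (infix \<open>\<doteq>\<close> 50) where "l \<doteq> r \<equiv> (l, r)"
private abbreviation "h\<^sub>1 \<equiv> H\<langle>1\<rangle>"
private abbreviation "h\<^sub>2 \<equiv> H\<langle>2\<rangle>"
private abbreviation "h\<^sub>3 \<equiv> H\<langle>3\<rangle>"
private abbreviation "s\<^sub>1 \<equiv> S\<langle>1\<rangle>"
private abbreviation "s\<^sub>2 \<equiv> S\<langle>2\<rangle>"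
private abbreviation "s\<^sub>3 \<equiv> S\<langle>3\<rangle>"
private abbreviation "x\<^sub>1 \<equiv> X\<langle>1\<rangle>"
private abbreviation "x\<^sub>2 \<equiv> X\<langle>2\<rangle>"
private abbreviation "z\<^sub>1\<^sub>2 \<equiv> Zc\<langle>1\<rangle>"
private abbreviation "z\<^sub>2\<^sub>3 \<equiv> Zc\<langle>2\<rangle>"

definition R0 :: "equation set" where
  "R0 =
   {phase 8 \<doteq> []}"

definition R1 :: "equation set" where
  "R1 =
   {[h\<^sub>1, A1\<langle>1\<rangle>] \<doteq> [A2\<langle>1\<rangle>],
    [h\<^sub>1, A2\<langle>1\<rangle>] \<doteq> [A1\<langle>1\<rangle>],
    [h\<^sub>1, A3\<langle>1\<rangle>] \<doteq> [A3\<langle>1\<rangle>, x\<^sub>1, s\<^sub>1, s\<^sub>1, s\<^sub>1] @ phase 1}"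

definition R2 :: "equation set" where
  "R2 =
   {[s\<^sub>1, A1\<langle>1\<rangle>] \<doteq> [A1\<langle>1\<rangle>, s\<^sub>1],
    [s\<^sub>1, A2\<langle>1\<rangle>] \<doteq> [A3\<langle>1\<rangle>, x\<^sub>1, s\<^sub>1, s\<^sub>1, s\<^sub>1] @ phase 1,
    [s\<^sub>1, A3\<langle>1\<rangle>] \<doteq> [A2\<langle>1\<rangle>, s\<^sub>1, s\<^sub>1, s\<^sub>1] @ phase 1}"

definition R3 :: "equation set" where
  "R3 =
   {[z\<^sub>1\<^sub>2, A1\<langle>1\<rangle>] \<doteq> [A1\<langle>1\<rangle>, z\<^sub>1\<^sub>2],
    [z\<^sub>1\<^sub>2, A2\<langle>1\<rangle>] \<doteq> [A1\<langle>2\<rangle>, B2\<langle>1\<rangle>, z\<^sub>1\<^sub>2, h\<^sub>2],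
    [z\<^sub>1\<^sub>2, A3\<langle>1\<rangle>] \<doteq> [A1\<langle>2\<rangle>, B3\<langle>1\<rangle>, h\<^sub>2, s\<^sub>2, h\<^sub>2, z\<^sub>1\<^sub>2, s\<^sub>1, s\<^sub>1, s\<^sub>1, h\<^sub>2]}"

definition R4 :: "equation set" where
  "R4 =
   {[z\<^sub>1\<^sub>2, A1\<langle>2\<rangle>, B1\<langle>1\<rangle>] \<doteq> [A1\<langle>2\<rangle>, B1\<langle>1\<rangle>, h\<^sub>2, z\<^sub>1\<^sub>2, h\<^sub>2],
    [z\<^sub>1\<^sub>2, A1\<langle>2\<rangle>, B2\<langle>1\<rangle>] \<doteq> [A2\<langle>1\<rangle>, h\<^sub>2, z\<^sub>1\<^sub>2],
    [z\<^sub>1\<^sub>2, A1\<langle>2\<rangle>, B3\<langle>1\<rangle>] \<doteq> [A3\<langle>1\<rangle>, h\<^sub>2, z\<^sub>1\<^sub>2, s\<^sub>1, s\<^sub>2, h\<^sub>2, s\<^sub>2] @ phase 7,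
    [z\<^sub>1\<^sub>2, A1\<langle>2\<rangle>, B4\<langle>1\<rangle>] \<doteq> [A1\<langle>2\<rangle>, B4\<langle>1\<rangle>, h\<^sub>2, z\<^sub>1\<^sub>2, s\<^sub>2, s\<^sub>2, h\<^sub>2],
    [z\<^sub>1\<^sub>2, A2\<langle>2\<rangle>, B1\<langle>1\<rangle>] \<doteq> [A2\<langle>2\<rangle>, B4\<langle>1\<rangle>],
    [z\<^sub>1\<^sub>2, A2\<langle>2\<rangle>, B2\<langle>1\<rangle>] \<doteq> [A3\<langle>2\<rangle>, B3\<langle>1\<rangle>, h\<^sub>2, z\<^sub>1\<^sub>2, s\<^sub>1, s\<^sub>2, s\<^sub>2, h\<^sub>2, s\<^sub>2] @ phase 6,
    [z\<^sub>1\<^sub>2, A2\<langle>2\<rangle>, B3\<langle>1\<rangle>] \<doteq> [A3\<langle>2\<rangle>, B2\<langle>1\<rangle>, x\<^sub>1, h\<^sub>2, z\<^sub>1\<^sub>2, s\<^sub>1, s\<^sub>1, s\<^sub>1] @ phase 1,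
    [z\<^sub>1\<^sub>2, A2\<langle>2\<rangle>, B4\<langle>1\<rangle>] \<doteq> [A2\<langle>2\<rangle>, B1\<langle>1\<rangle>],
    [z\<^sub>1\<^sub>2, A3\<langle>2\<rangle>, B1\<langle>1\<rangle>] \<doteq> [A3\<langle>2\<rangle>, B4\<langle>1\<rangle>, h\<^sub>2, z\<^sub>1\<^sub>2, s\<^sub>2, h\<^sub>2],
    [z\<^sub>1\<^sub>2, A3\<langle>2\<rangle>, B2\<langle>1\<rangle>] \<doteq> [A2\<langle>2\<rangle>, B3\<langle>1\<rangle>, x\<^sub>1, z\<^sub>1\<^sub>2, s\<^sub>1, s\<^sub>1, s\<^sub>1, s\<^sub>2, s\<^sub>2, h\<^sub>2] @ phase 1,
    [z\<^sub>1\<^sub>2, A3\<langle>2\<rangle>, B3\<langle>1\<rangle>] \<doteq> [A2\<langle>2\<rangle>, B2\<langle>1\<rangle>, h\<^sub>2, s\<^sub>2, h\<^sub>2, z\<^sub>1\<^sub>2, s\<^sub>1, s\<^sub>1, s\<^sub>1, s\<^sub>2, s\<^sub>2, s\<^sub>2, h\<^sub>2] @ phase 1,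
    [z\<^sub>1\<^sub>2, A3\<langle>2\<rangle>, B4\<langle>1\<rangle>] \<doteq> [A3\<langle>2\<rangle>, B1\<langle>1\<rangle>, h\<^sub>2, z\<^sub>1\<^sub>2, s\<^sub>2, s\<^sub>2, s\<^sub>2, h\<^sub>2]}"

definition R5 :: "equation set" where
  "R5 =
   {[h\<^sub>1, B1\<langle>1\<rangle>] \<doteq> [B1\<langle>1\<rangle>, h\<^sub>2],
    [h\<^sub>1, B2\<langle>1\<rangle>] \<doteq> [B4\<langle>1\<rangle>],
    [h\<^sub>1, B3\<langle>1\<rangle>] \<doteq> [B3\<langle>1\<rangle>, x\<^sub>1, s\<^sub>2, s\<^sub>2, s\<^sub>2, h\<^sub>2, s\<^sub>2],
    [h\<^sub>1, B4\<langle>1\<rangle>] \<doteq> [B2\<langle>1\<rangle>]}"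

definition R6 :: "equation set" where
  "R6 =
   {[s\<^sub>1, B1\<langle>1\<rangle>] \<doteq> [B1\<langle>1\<rangle>, h\<^sub>2, s\<^sub>2, h\<^sub>2],
    [s\<^sub>1, B2\<langle>1\<rangle>] \<doteq> [B3\<langle>1\<rangle>, x\<^sub>1, s\<^sub>2, s\<^sub>2, s\<^sub>2, h\<^sub>2, s\<^sub>2],
    [s\<^sub>1, B3\<langle>1\<rangle>] \<doteq> [B2\<langle>1\<rangle>, s\<^sub>2, h\<^sub>2, s\<^sub>2],
    [s\<^sub>1, B4\<langle>1\<rangle>] \<doteq> [B4\<langle>1\<rangle>, h\<^sub>2, s\<^sub>2, h\<^sub>2]}"

definition R7 :: "equation set" where
  "R7 =
   {[s\<^sub>2, B1\<langle>1\<rangle>] \<doteq> [B1\<langle>1\<rangle>, s\<^sub>1]} \<union>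
   {[s\<^sub>2, b\<langle>1\<rangle>] \<doteq> [b\<langle>1\<rangle>, h\<^sub>2, z\<^sub>1\<^sub>2, s\<^sub>1, s\<^sub>2, h\<^sub>2] | b. b \<in> {B2, B3, B4}}"

definition R8 :: "equation set" where
  "R8 =
   {[x\<^sub>2, b\<langle>1\<rangle>] \<doteq> [b\<langle>1\<rangle>, x\<^sub>1] | b. b \<in> {B1, B2, B3, B4}}"

definition R9 :: "equation set" where
  "R9 =
   {[z\<^sub>2\<^sub>3, B1\<langle>1\<rangle>] \<doteq> [B1\<langle>1\<rangle>, z\<^sub>1\<^sub>2, h\<^sub>2, z\<^sub>2\<^sub>3, h\<^sub>2, z\<^sub>1\<^sub>2, h\<^sub>2, z\<^sub>2\<^sub>3, h\<^sub>2]} \<union>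
   {[z\<^sub>2\<^sub>3, b\<langle>1\<rangle>] \<doteq> [b\<langle>1\<rangle>, z\<^sub>1\<^sub>2, h\<^sub>2, z\<^sub>2\<^sub>3, h\<^sub>2, z\<^sub>1\<^sub>2] | b. b \<in> {B2, B3, B4}}"

definition R10 :: "equation set" where
  "R10 =
   {[x\<^sub>1, C1\<langle>1\<rangle>] \<doteq> [C2\<langle>1\<rangle>],
    [x\<^sub>1, C2\<langle>1\<rangle>] \<doteq> [C1\<langle>1\<rangle>]}"

definition R11 :: "equation set" where
  "R11 =
   {[s\<^sub>1, C1\<langle>1\<rangle>] \<doteq> [C1\<langle>1\<rangle>, s\<^sub>1],
    [s\<^sub>1, C2\<langle>1\<rangle>] \<doteq> [C2\<langle>1\<rangle>, s\<^sub>1, s\<^sub>1, s\<^sub>1] @ phase 2}"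

definition R12 :: "equation set" where
  "R12 =
   {[z\<^sub>1\<^sub>2, C1\<langle>1\<rangle>] \<doteq> [C1\<langle>1\<rangle>, z\<^sub>1\<^sub>2],
    [z\<^sub>1\<^sub>2, C2\<langle>1\<rangle>] \<doteq> [C2\<langle>1\<rangle>, z\<^sub>1\<^sub>2, s\<^sub>2, s\<^sub>2]}"

definition R13 :: "equation set" where
  "R13 =
   {[z\<^sub>1\<^sub>2, B1\<langle>2\<rangle>, B1\<langle>1\<rangle>] \<doteq> [B1\<langle>2\<rangle>, B1\<langle>1\<rangle>, h\<^sub>2, h\<^sub>3, z\<^sub>2\<^sub>3, h\<^sub>2, h\<^sub>3],
    [z\<^sub>1\<^sub>2, B1\<langle>2\<rangle>, B2\<langle>1\<rangle>] \<doteq> [B4\<langle>2\<rangle>, B2\<langle>1\<rangle>, h\<^sub>3, z\<^sub>2\<^sub>3, h\<^sub>3],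
    [z\<^sub>1\<^sub>2, B1\<langle>2\<rangle>, B3\<langle>1\<rangle>] \<doteq> [B4\<langle>2\<rangle>, B3\<langle>1\<rangle>, h\<^sub>3, h\<^sub>2, s\<^sub>2, h\<^sub>2, z\<^sub>2\<^sub>3, s\<^sub>2, h\<^sub>2, s\<^sub>2, h\<^sub>3] @ phase 7,
    [z\<^sub>1\<^sub>2, B1\<langle>2\<rangle>, B4\<langle>1\<rangle>] \<doteq> [B1\<langle>2\<rangle>, B4\<langle>1\<rangle>, h\<^sub>2, h\<^sub>3, z\<^sub>2\<^sub>3, h\<^sub>2, h\<^sub>3],
    [z\<^sub>1\<^sub>2, B2\<langle>2\<rangle>, B1\<langle>1\<rangle>] \<doteq> [B2\<langle>2\<rangle>, B4\<langle>1\<rangle>, h\<^sub>2, z\<^sub>2\<^sub>3, h\<^sub>2],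
    [z\<^sub>1\<^sub>2, B2\<langle>2\<rangle>, B2\<langle>1\<rangle>] \<doteq> [B3\<langle>2\<rangle>, B3\<langle>1\<rangle>, h\<^sub>2, s\<^sub>2, h\<^sub>2, h\<^sub>3, s\<^sub>3, h\<^sub>3, z\<^sub>2\<^sub>3, s\<^sub>2, s\<^sub>3] @ phase 6,
    [z\<^sub>1\<^sub>2, B2\<langle>2\<rangle>, B3\<langle>1\<rangle>] \<doteq> [B3\<langle>2\<rangle>, B2\<langle>1\<rangle>, x\<^sub>1, h\<^sub>3, s\<^sub>3, h\<^sub>3, z\<^sub>2\<^sub>3, h\<^sub>2, s\<^sub>2, s\<^sub>3] @ phase 7,
    [z\<^sub>1\<^sub>2, B2\<langle>2\<rangle>, B4\<langle>1\<rangle>] \<doteq> [B2\<langle>2\<rangle>, B1\<langle>1\<rangle>, h\<^sub>2, z\<^sub>2\<^sub>3, h\<^sub>2],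
    [z\<^sub>1\<^sub>2, B3\<langle>2\<rangle>, B1\<langle>1\<rangle>] \<doteq> [B3\<langle>2\<rangle>, B4\<langle>1\<rangle>, h\<^sub>2, h\<^sub>3, s\<^sub>3, h\<^sub>3, z\<^sub>2\<^sub>3, h\<^sub>2, s\<^sub>3, h\<^sub>3, s\<^sub>3] @ phase 7,
    [z\<^sub>1\<^sub>2, B3\<langle>2\<rangle>, B2\<langle>1\<rangle>] \<doteq> [B2\<langle>2\<rangle>, B3\<langle>1\<rangle>, x\<^sub>1, h\<^sub>2, s\<^sub>2, h\<^sub>2, z\<^sub>2\<^sub>3, s\<^sub>2, h\<^sub>3, s\<^sub>3] @ phase 7,
    [z\<^sub>1\<^sub>2, B3\<langle>2\<rangle>, B3\<langle>1\<rangle>] \<doteq> [B2\<langle>2\<rangle>, B2\<langle>1\<rangle>, z\<^sub>2\<^sub>3, h\<^sub>2, s\<^sub>2, h\<^sub>3, s\<^sub>3],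
    [z\<^sub>1\<^sub>2, B3\<langle>2\<rangle>, B4\<langle>1\<rangle>] \<doteq> [B3\<langle>2\<rangle>, B1\<langle>1\<rangle>, h\<^sub>2, h\<^sub>3, s\<^sub>3, h\<^sub>3, z\<^sub>2\<^sub>3, h\<^sub>2, s\<^sub>3, h\<^sub>3, s\<^sub>3] @ phase 7,
    [z\<^sub>1\<^sub>2, B4\<langle>2\<rangle>, B1\<langle>1\<rangle>] \<doteq> [B4\<langle>2\<rangle>, B1\<langle>1\<rangle>, h\<^sub>2, h\<^sub>3, z\<^sub>2\<^sub>3, h\<^sub>2, h\<^sub>3],
    [z\<^sub>1\<^sub>2, B4\<langle>2\<rangle>, B2\<langle>1\<rangle>] \<doteq> [B1\<langle>2\<rangle>, B2\<langle>1\<rangle>, h\<^sub>3, z\<^sub>2\<^sub>3, h\<^sub>3],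
    [z\<^sub>1\<^sub>2, B4\<langle>2\<rangle>, B3\<langle>1\<rangle>] \<doteq> [B1\<langle>2\<rangle>, B3\<langle>1\<rangle>, h\<^sub>3, h\<^sub>2, s\<^sub>2, h\<^sub>2, z\<^sub>2\<^sub>3, s\<^sub>2, h\<^sub>2, s\<^sub>2, h\<^sub>3] @ phase 7,
    [z\<^sub>1\<^sub>2, B4\<langle>2\<rangle>, B4\<langle>1\<rangle>] \<doteq> [B4\<langle>2\<rangle>, B4\<langle>1\<rangle>, h\<^sub>2, h\<^sub>3, z\<^sub>2\<^sub>3, h\<^sub>2, h\<^sub>3]}"

definition R14 :: "equation set" where
  "R14 =
   {[h\<^sub>2, D1\<langle>1\<rangle>] \<doteq> [D1\<langle>1\<rangle>, h\<^sub>1],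
    [h\<^sub>2, D2\<langle>1\<rangle>] \<doteq> [D4\<langle>1\<rangle>],
    [h\<^sub>2, D3\<langle>1\<rangle>] \<doteq> [D3\<langle>1\<rangle>, s\<^sub>1, s\<^sub>1, s\<^sub>1, h\<^sub>1, s\<^sub>1, s\<^sub>2, s\<^sub>2],
    [h\<^sub>2, D4\<langle>1\<rangle>] \<doteq> [D2\<langle>1\<rangle>]}"

definition R15 :: "equation set" where
  "R15 =
   {[s\<^sub>2, D1\<langle>1\<rangle>] \<doteq> [D1\<langle>1\<rangle>, h\<^sub>1, s\<^sub>1, h\<^sub>1],
    [s\<^sub>2, D2\<langle>1\<rangle>] \<doteq> [D3\<langle>1\<rangle>, s\<^sub>1, s\<^sub>1, s\<^sub>1, h\<^sub>1, s\<^sub>1, s\<^sub>2, s\<^sub>2],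
    [s\<^sub>2, D3\<langle>1\<rangle>] \<doteq> [D2\<langle>1\<rangle>, s\<^sub>1, h\<^sub>1, s\<^sub>1],
    [s\<^sub>2, D4\<langle>1\<rangle>] \<doteq> [D4\<langle>1\<rangle>, h\<^sub>1, s\<^sub>1, h\<^sub>1]}"

definition R16 :: "equation set" where
  "R16 =
   {[s\<^sub>1, d\<langle>1\<rangle>] \<doteq> [d\<langle>1\<rangle>, s\<^sub>2] | d. d \<in> {D1, D2, D3, D4}}"

definition R17 :: "equation set" where
  "R17 =
   {[z\<^sub>1\<^sub>2, D1\<langle>1\<rangle>] \<doteq> [D4\<langle>1\<rangle>],
    [z\<^sub>1\<^sub>2, D2\<langle>1\<rangle>] \<doteq> [D3\<langle>1\<rangle>, s\<^sub>1, s\<^sub>1, s\<^sub>1, h\<^sub>1, s\<^sub>2, s\<^sub>2, s\<^sub>2],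
    [z\<^sub>1\<^sub>2, D3\<langle>1\<rangle>] \<doteq> [D2\<langle>1\<rangle>, h\<^sub>1, s\<^sub>1, s\<^sub>2],
    [z\<^sub>1\<^sub>2, D4\<langle>1\<rangle>] \<doteq> [D1\<langle>1\<rangle>]}"

definition R18 :: "equation set" where
  "R18 =
   {[s\<^sub>1, E1\<langle>1\<rangle>] \<doteq> [E2\<langle>1\<rangle>],
    [s\<^sub>1, E2\<langle>1\<rangle>] \<doteq> [E3\<langle>1\<rangle>],
    [s\<^sub>1, E3\<langle>1\<rangle>] \<doteq> [E4\<langle>1\<rangle>],
    [s\<^sub>1, E4\<langle>1\<rangle>] \<doteq> [E1\<langle>1\<rangle>]}"

definition R19 :: "equation set" where
  "R19 =
   {[z\<^sub>2\<^sub>3, D1\<langle>1\<rangle>, D1\<langle>2\<rangle>] \<doteq> [D1\<langle>1\<rangle>, D1\<langle>2\<rangle>, h\<^sub>1, h\<^sub>2, z\<^sub>1\<^sub>2, h\<^sub>1, h\<^sub>2],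
    [z\<^sub>2\<^sub>3, D1\<langle>1\<rangle>, D2\<langle>2\<rangle>] \<doteq> [D4\<langle>1\<rangle>, D2\<langle>2\<rangle>, h\<^sub>1, z\<^sub>1\<^sub>2, h\<^sub>1],
    [z\<^sub>2\<^sub>3, D1\<langle>1\<rangle>, D3\<langle>2\<rangle>] \<doteq> [D4\<langle>1\<rangle>, D3\<langle>2\<rangle>, h\<^sub>1, h\<^sub>2, s\<^sub>2, h\<^sub>2, z\<^sub>1\<^sub>2, h\<^sub>1, s\<^sub>2, h\<^sub>2, s\<^sub>2] @ phase 7,
    [z\<^sub>2\<^sub>3, D1\<langle>1\<rangle>, D4\<langle>2\<rangle>] \<doteq> [D1\<langle>1\<rangle>, D4\<langle>2\<rangle>, h\<^sub>1, h\<^sub>2, z\<^sub>1\<^sub>2, h\<^sub>1, h\<^sub>2],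
    [z\<^sub>2\<^sub>3, D2\<langle>1\<rangle>, D1\<langle>2\<rangle>] \<doteq> [D2\<langle>1\<rangle>, D4\<langle>2\<rangle>, h\<^sub>2, z\<^sub>1\<^sub>2, h\<^sub>2],
    [z\<^sub>2\<^sub>3, D2\<langle>1\<rangle>, D2\<langle>2\<rangle>] \<doteq> [D3\<langle>1\<rangle>, D3\<langle>2\<rangle>, h\<^sub>1, s\<^sub>1, h\<^sub>1, h\<^sub>2, s\<^sub>2, h\<^sub>2, z\<^sub>1\<^sub>2, s\<^sub>1, s\<^sub>2] @ phase 6,
    [z\<^sub>2\<^sub>3, D2\<langle>1\<rangle>, D3\<langle>2\<rangle>] \<doteq> [D3\<langle>1\<rangle>, D2\<langle>2\<rangle>, h\<^sub>1, s\<^sub>1, h\<^sub>1, z\<^sub>1\<^sub>2, s\<^sub>1, h\<^sub>2, s\<^sub>2, s\<^sub>3, s\<^sub>3] @ phase 7,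
    [z\<^sub>2\<^sub>3, D2\<langle>1\<rangle>, D4\<langle>2\<rangle>] \<doteq> [D2\<langle>1\<rangle>, D1\<langle>2\<rangle>, h\<^sub>2, z\<^sub>1\<^sub>2, h\<^sub>2],
    [z\<^sub>2\<^sub>3, D3\<langle>1\<rangle>, D1\<langle>2\<rangle>] \<doteq> [D3\<langle>1\<rangle>, D4\<langle>2\<rangle>, h\<^sub>2, h\<^sub>1, s\<^sub>1, h\<^sub>1, z\<^sub>1\<^sub>2, s\<^sub>1, h\<^sub>1, s\<^sub>1, h\<^sub>2] @ phase 7,
    [z\<^sub>2\<^sub>3, D3\<langle>1\<rangle>, D2\<langle>2\<rangle>] \<doteq> [D2\<langle>1\<rangle>, D3\<langle>2\<rangle>, h\<^sub>2, s\<^sub>2, h\<^sub>2, z\<^sub>1\<^sub>2, h\<^sub>1, s\<^sub>1, s\<^sub>2, s\<^sub>3, s\<^sub>3] @ phase 7,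
    [z\<^sub>2\<^sub>3, D3\<langle>1\<rangle>, D3\<langle>2\<rangle>] \<doteq> [D2\<langle>1\<rangle>, D2\<langle>2\<rangle>, z\<^sub>1\<^sub>2, h\<^sub>1, s\<^sub>1, h\<^sub>2, s\<^sub>2],
    [z\<^sub>2\<^sub>3, D3\<langle>1\<rangle>, D4\<langle>2\<rangle>] \<doteq> [D3\<langle>1\<rangle>, D1\<langle>2\<rangle>, h\<^sub>2, h\<^sub>1, s\<^sub>1, h\<^sub>1, z\<^sub>1\<^sub>2, s\<^sub>1, h\<^sub>1, s\<^sub>1, h\<^sub>2] @ phase 7,
    [z\<^sub>2\<^sub>3, D4\<langle>1\<rangle>, D1\<langle>2\<rangle>] \<doteq> [D4\<langle>1\<rangle>, D1\<langle>2\<rangle>, h\<^sub>1, h\<^sub>2, z\<^sub>1\<^sub>2, h\<^sub>1, h\<^sub>2],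
    [z\<^sub>2\<^sub>3, D4\<langle>1\<rangle>, D2\<langle>2\<rangle>] \<doteq> [D1\<langle>1\<rangle>, D2\<langle>2\<rangle>, h\<^sub>1, z\<^sub>1\<^sub>2, h\<^sub>1],
    [z\<^sub>2\<^sub>3, D4\<langle>1\<rangle>, D3\<langle>2\<rangle>] \<doteq> [D1\<langle>1\<rangle>, D3\<langle>2\<rangle>, h\<^sub>1, h\<^sub>2, s\<^sub>2, h\<^sub>2, z\<^sub>1\<^sub>2, h\<^sub>1, s\<^sub>2, h\<^sub>2, s\<^sub>2] @ phase 7,
    [z\<^sub>2\<^sub>3, D4\<langle>1\<rangle>, D4\<langle>2\<rangle>] \<doteq> [D4\<langle>1\<rangle>, D4\<langle>2\<rangle>, h\<^sub>1, h\<^sub>2, z\<^sub>1\<^sub>2, h\<^sub>1, h\<^sub>2]}"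

definition ACE :: "equation set" where
  "ACE =
   {[] \<doteq> [A1\<langle>1\<rangle>, C1\<langle>1\<rangle>, E1\<langle>1\<rangle>]}"

definition BCD :: "equation set" where
  "BCD =
   {[C1\<langle>2\<rangle>] \<doteq> [B1\<langle>1\<rangle>, C1\<langle>1\<rangle>, D1\<langle>1\<rangle>]}"

end

text \<open>The first component is the number of wires of the equation.\<close>

definition equations :: "(nat \<times> equation) set" where
  "equations =
     {0} \<times> R0 \<union>
     {1} \<times> (R1 \<union> R2 \<union> R10 \<union> R11 \<union> R18 \<union> ACE) \<union>
     {2} \<times> (R3 \<union> R4 \<union> R5 \<union> R6 \<union> R7 \<union> R8 \<union> R12 \<union> R14 \<union> R15 \<union> R16 \<union> R17 \<union> BCD) \<union>
     {3} \<times> (R9 \<union> R13 \<union> R19)"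

text \<open>A use of an equation, in either direction, on \<open>n\<close> consecutive wires with \<open>i\<close> further wires
  above and \<open>j\<close> below, between arbitrary circuits \<open>c\<close> and \<open>d\<close>.\<close>

inductive rewrite_use :: "circuit \<Rightarrow> circuit \<Rightarrow> bool" where
  "(n, l, r) \<in> equations \<or> (n, r, l) \<in> equations \<Longrightarrow>
   is_circuit (i + n + j) c \<Longrightarrow> is_circuit (i + n + j) d \<Longrightarrow>
   rewrite_use
     (Seq c (Seq (Tensor (Tensor (Ident i) (on_wires n l)) (Ident j)) d))
     (Seq c (Seq (Tensor (Tensor (Ident i) (on_wires n r)) (Ident j)) d))"

text \<open>Finitely many uses of the equations, circuits being taken modulo \<open>\<simeq>\<close>.\<close>

definition convertible :: "circuit \<Rightarrow> circuit \<Rightarrow> bool" where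
  "convertible = (\<lambda>c d. c \<simeq> d \<or> rewrite_use c d)\<^sup>*\<^sup>*"

end

theory Submission
  imports Defs
begin

text \<open>Circuits are handled as words of located gates, and conversion to normal form is a rewriting
  of words. A one-level normal form of the identity, a \<open>Z\<close>-normal followed by an \<open>X\<close>-normal word, is
  obtained from (ACE) by expanding \<open>C1\<close> repeatedly with (BCD). The gates of the circuit are then pushed
  into it from the left, the last gate first. Each equation moves a gate to the right past one or two
  gates of the normal form; what comes out behind a gate \<open>B\<close> on wires \<open>q, q + 1\<close> is never an \<open>H\<close> on the
  wire \<open>q\<close>, nor a gate acting above it, so the remaining \<open>B\<close>s and the \<open>C\<close> can absorb it again. Symmetrically,
  what comes out behind the \<open>X\<close>-normal word acts on one wire less, and induction on the number of wires
  applies. The operator is preserved because every equation is sound, which is checked on basis states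
  with amplitudes in \<open>\<int>[\<omega>]\<close>, up to a power of \<open>\<surd>2\<close>.\<close>

section \<open>Words and spatial equality\<close>

text \<open>The gate sets of the proof come from conjugation of Pauli operators, although no Pauli
  operator is ever formed. Up to sign, \<open>A1\<close>, \<open>A2\<close>, \<open>A3\<close> carry
  Z, X, Y on their wire to Z; \<open>B1\<close>, \<open>B2\<close>, \<open>B3\<close>,
  \<open>B4\<close> carry Z on the lower wire times I, X, Y, Z on the upper one to Z on the upper
  wire alone; \<open>C2\<close> flips the sign. A \<open>Z\<close>-normal word thus stands for the
  signed Pauli operator that it carries to Z on wire 1, and \<open>m\<close> is the last wire where
  that operator is not the identity. A gate in front replaces this operator by another one, hence
  the word by another one, and the remainder must fix Z on the wire reached so far: up to sign
  before the \<open>C\<close> (\<open>front\<close>), exactly after it (\<open>past_Z\<close>). This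
  is why \<open>H\<close> on that wire cannot come out. Likewise each \<open>D\<close> carries Z one
  wire down, together with an operator anticommuting with it, and \<open>E\<close> turns the latter
  into X; what is left fixes both Z and X on the last wire, so it acts above it.\<close>

definition fits :: "nat \<Rightarrow> located_gate \<Rightarrow> bool" where
  "fits n g \<longleftrightarrow> 1 \<le> snd g \<and> snd g - 1 + arity (fst g) \<le> n"

text \<open>Scalars stay at location 1, so that a word has a unique place for \<open>Omega\<close>.\<close>

definition shift :: "nat \<Rightarrow> located_gate \<Rightarrow> located_gate" where
  "shift i g = (fst g, if fst g = Omega then 1 else snd g + i)"

lemma fits_shift: "fits k g \<Longrightarrow> i + k \<le> n \<Longrightarrow> fits n (shift i g)"
  by (auto simp: fits_def shift_def)

lemma fst_shift [simp]: "fst (shift i g) = fst g"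
  by (simp add: shift_def)

declare spatial_eq.trans [trans]

lemma spatial_width: "c \<simeq> d \<Longrightarrow> width c = width d"
  by (induction rule: spatial_eq.induct) auto

lemma spatial_well_typed: "c \<simeq> d \<Longrightarrow> well_typed c = well_typed d"
  by (induction rule: spatial_eq.induct) (auto dest!: spatial_width)

lemma spatial_ident_left: "width c = n \<Longrightarrow> Seq (Ident n) c \<simeq> c"
  using spatial_eq.seq_ident_left by blast

lemma spatial_ident_right: "width c = n \<Longrightarrow> Seq c (Ident n) \<simeq> c"
  using spatial_eq.seq_ident_right by blast

lemma tensor_cong_left: "c \<simeq> c' \<Longrightarrow> Tensor c d \<simeq> Tensor c' d"
  by (intro spatial_eq.tensor_cong spatial_eq.refl)

lemma tensor_cong_right: "d \<simeq> d' \<Longrightarrow> Tensor c d \<simeq> Tensor c d'"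
  by (intro spatial_eq.tensor_cong spatial_eq.refl)

lemma seq_cong_left: "c \<simeq> c' \<Longrightarrow> Seq c d \<simeq> Seq c' d"
  by (intro spatial_eq.seq_cong spatial_eq.refl)

lemma seq_cong_right: "d \<simeq> d' \<Longrightarrow> Seq c d \<simeq> Seq c d'"
  by (intro spatial_eq.seq_cong spatial_eq.refl)

lemma tensor_idents: "m + n = k \<Longrightarrow> Tensor (Ident m) (Ident n) \<simeq> Ident k"
  using spatial_eq.tensor_ident by blast

text \<open>Both this lemma and its mirror image collapse to \<open>Tensor c d\<close>; two gates on
  disjoint wires commute by passing through that common form.\<close>

lemma parallel_left_first:
  assumes "width c = a" "width d = b"
  shows "Seq (Tensor c (Ident b)) (Tensor (Ident a) d) \<simeq> Tensor c d"
proof -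
  have "Seq (Tensor c (Ident b)) (Tensor (Ident a) d)
      \<simeq> Tensor (Seq c (Ident a)) (Seq (Ident b) d)"
    by (rule spatial_eq.interchange) (simp_all add: assms)
  also have "\<dots> \<simeq> Tensor c d"
    by (intro spatial_eq.tensor_cong spatial_ident_left spatial_ident_right assms)
  finally show ?thesis .
qed

lemma parallel_right_first:
  assumes "width c = a" "width d = b"
  shows "Seq (Tensor (Ident a) d) (Tensor c (Ident b)) \<simeq> Tensor c d"
proof -
  have "Seq (Tensor (Ident a) d) (Tensor c (Ident b))
      \<simeq> Tensor (Seq (Ident a) c) (Seq d (Ident b))"
    by (rule spatial_eq.interchange) (simp_all add: assms)
  also have "\<dots> \<simeq> Tensor c d"
    by (intro spatial_eq.tensor_cong spatial_ident_left spatial_ident_right assms)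
  finally show ?thesis .
qed

abbreviation framed :: "nat \<Rightarrow> circuit \<Rightarrow> nat \<Rightarrow> circuit" where
  "framed i c j \<equiv> Tensor (Tensor (Ident i) c) (Ident j)"

lemma framed_ident: "framed i (Ident k) j \<simeq> Ident (i + k + j)"
  by (rule spatial_eq.trans[OF tensor_cong_left[OF spatial_eq.tensor_ident] spatial_eq.tensor_ident])

lemma framed_seq:
  assumes "width c = width d"
  shows "framed i (Seq c d) j \<simeq> Seq (framed i c j) (framed i d j)"
proof (rule spatial_eq.sym)
  have "Seq (framed i c j) (framed i d j)
      \<simeq> Tensor (Seq (Tensor (Ident i) c) (Tensor (Ident i) d)) (Seq (Ident j) (Ident j))"
    by (rule spatial_eq.interchange) (simp_all add: assms)
  also have "\<dots> \<simeq> Tensor (Tensor (Seq (Ident i) (Ident i)) (Seq c d)) (Seq (Ident j) (Ident j))"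
    by (rule tensor_cong_left, rule spatial_eq.interchange) (simp_all add: assms)
  also have "\<dots> \<simeq> framed i (Seq c d) j"
    by (intro spatial_eq.tensor_cong spatial_eq.refl spatial_ident_left) simp_all
  finally show "Seq (framed i c j) (framed i d j) \<simeq> framed i (Seq c d) j" .
qed

lemma framed_framed: "framed i (framed a c b) j \<simeq> framed (i + a) c (b + j)"
proof -
  have "framed i (framed a c b) j
      \<simeq> Tensor (Tensor (Tensor (Ident i) (Tensor (Ident a) c)) (Ident b)) (Ident j)"
    by (intro tensor_cong_left spatial_eq.sym[OF spatial_eq.tensor_assoc])
  also have "\<dots> \<simeq> Tensor (Tensor (Ident i) (Tensor (Ident a) c)) (Tensor (Ident b) (Ident j))"
    by (rule spatial_eq.tensor_assoc)
  also have "\<dots> \<simeq> Tensor (Tensor (Tensor (Ident i) (Ident a)) c) (Ident (b + j))"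
    by (intro spatial_eq.tensor_cong spatial_eq.sym[OF spatial_eq.tensor_assoc] spatial_eq.tensor_ident)
  also have "\<dots> \<simeq> framed (i + a) c (b + j)"
    by (intro tensor_cong_left spatial_eq.tensor_ident)
  finally show ?thesis .
qed

section \<open>Located gates and words placed on \<open>n\<close> wires\<close>

lemma width_place: "fits n g \<Longrightarrow> width (place n g) = n"
  by (cases g) (auto simp: fits_def place_def)

lemma well_typed_place: "well_typed (place n g)"
  by (cases g) (auto simp: place_def)

lemma width_on_wires: "\<forall>g\<in>set w. fits n g \<Longrightarrow> width (on_wires n w) = n"
  by (cases w) (auto simp: on_wires_def width_place)

lemma well_typed_on_wires: "\<forall>g\<in>set w. fits n g \<Longrightarrow> well_typed (on_wires n w)"
  by (induction w) (auto simp: on_wires_def width_place well_typed_place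
      width_on_wires[unfolded on_wires_def])

lemma is_circuit_on_wires: "\<forall>g\<in>set w. fits n g \<Longrightarrow> is_circuit n (on_wires n w)"
  by (simp add: is_circuit_def width_on_wires well_typed_on_wires)

lemma on_wires_Nil: "on_wires n [] = Ident n"
  and on_wires_Cons: "on_wires n (g # w) = Seq (place n g) (on_wires n w)"
  by (simp_all add: on_wires_def)

text \<open>Fitting is asked of \<open>v\<close>: the trailing \<open>Ident n\<close> of
  \<open>u\<close> is absorbed by the circuit of \<open>v\<close>, which must therefore have width
  \<open>n\<close>.\<close>

lemma on_wires_append:
  "\<forall>g\<in>set v. fits n g \<Longrightarrow> on_wires n (u @ v) \<simeq> Seq (on_wires n u) (on_wires n v)"
proof (induction u)
  case Nil
  then show ?case
    by (simp add: on_wires_Nil spatial_eq.sym[OF spatial_ident_left] width_on_wires)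
next
  case (Cons g u)
  have "on_wires n ((g # u) @ v) \<simeq> Seq (place n g) (Seq (on_wires n u) (on_wires n v))"
    using Cons by (simp add: on_wires_Cons seq_cong_right)
  also have "\<dots> \<simeq> Seq (on_wires n (g # u)) (on_wires n v)"
    by (simp add: on_wires_Cons spatial_eq.sym[OF spatial_eq.seq_assoc])
  finally show ?case .
qed

text \<open>The law \<open>spatial\<close> slides the scalar over the \<open>q - 1\<close> wires
  above it; the identity wires on its two sides then merge into \<open>Ident n\<close>.\<close>

lemma place_Omega:
  assumes "fits n (Omega, q)"
  shows "place n (Omega, q) \<simeq> place n (Omega, 1)"
proof -
  have q: "q - 1 + (n - (q - 1)) = n"
    using assms by (auto simp: fits_def)
  have "place n (Omega, q) \<simeq> Tensor (Tensor (Gate Omega) (Ident (q - 1))) (Ident (n - (q - 1)))"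
    by (auto simp: place_def intro!: tensor_cong_left spatial_eq.sym[OF spatial_eq.spatial])
  also have "\<dots> \<simeq> Tensor (Gate Omega) (Tensor (Ident (q - 1)) (Ident (n - (q - 1))))"
    by (rule spatial_eq.tensor_assoc)
  also have "\<dots> \<simeq> Tensor (Gate Omega) (Ident n)"
    by (intro tensor_cong_right tensor_idents q)
  also have "\<dots> \<simeq> place n (Omega, 1)"
    by (simp add: place_def tensor_cong_left spatial_eq.sym[OF spatial_eq.tensor_unit_left])
  finally show ?thesis .
qed

text \<open>A framed placed gate is again a placed gate, with larger identities on both sides. For
  \<open>Omega\<close>, \<open>shift\<close> does not add \<open>i\<close>, and
  \<open>place_Omega\<close> closes the gap.\<close>

lemma framed_place:
  assumes "fits k g"
  shows "framed i (place k g) j \<simeq> place (i + k + j) (shift i g)"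
proof -
  obtain a q where g: "g = (a, q)"
    by (cases g)
  have "framed i (place k g) j \<simeq> framed (i + (q - 1)) (Gate a) (k - (q - 1 + arity a) + j)"
    by (simp add: g place_def framed_framed)
  also have "\<dots> = place (i + k + j) (a, q + i)"
    using assms by (auto simp: g place_def fits_def)
  also have "\<dots> \<simeq> place (i + k + j) (shift i g)"
  proof (cases "a = Omega")
    case True
    have "fits (i + k + j) (Omega, q + i)"
      using assms by (auto simp: g True fits_def)
    then show ?thesis
      by (simp add: g True shift_def place_Omega[simplified])
  qed (simp add: g shift_def spatial_eq.refl)
  finally show ?thesis .
qed

lemma framed_on_wires:
  "\<forall>g\<in>set w. fits k g \<Longrightarrow> framed i (on_wires k w) j \<simeq> on_wires (i + k + j) (map (shift i) w)"
proof (induction w)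
  case Nil
  then show ?case
    by (simp add: on_wires_Nil framed_ident)
next
  case (Cons g w)
  have "framed i (on_wires k (g # w)) j \<simeq> Seq (framed i (place k g) j) (framed i (on_wires k w) j)"
    using Cons.prems by (simp add: on_wires_Cons framed_seq width_place width_on_wires)
  also have "\<dots> \<simeq> on_wires (i + k + j) (map (shift i) (g # w))"
    using Cons by (simp add: on_wires_Cons spatial_eq.seq_cong framed_place)
  finally show ?case .
qed

text \<open>The wires are cut at \<open>m\<close>, just below the first gate: the first gate lies in
  the left factor, the second one in the right factor, and the two parallel laws apply.\<close>

lemma place_commute_aux:
  assumes "fits n (a, p)" "fits n (b, q)" "p + arity a \<le> q"
  shows "Seq (place n (a, p)) (place n (b, q)) \<simeq> Seq (place n (b, q)) (place n (a, p))"
proof -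
  define m where "m = p - 1 + arity a"
  define c where "c = Tensor (Ident (p - 1)) (Gate a)"
  define d where "d = framed (q - 1 - m) (Gate b) (n - (q - 1 + arity b))"
  have c: "place n (a, p) = Tensor c (Ident (n - m))" "width c = m"
    by (simp_all add: c_def m_def place_def)
  have m: "m + (q - 1 - m) = q - 1"
    using assms by (auto simp: m_def fits_def)
  have wd: "width d = n - m"
    using assms by (auto simp: d_def m_def fits_def)
  have "Tensor (Ident m) d \<simeq> framed m d 0"
    by (rule spatial_eq.sym[OF spatial_eq.tensor_unit_right])
  also have "\<dots> \<simeq> framed (m + (q - 1 - m)) (Gate b) (n - (q - 1 + arity b) + 0)"
    unfolding d_def by (rule framed_framed)
  finally have d: "place n (b, q) \<simeq> Tensor (Ident m) d"
    unfolding m by (auto simp: place_def intro: spatial_eq.sym)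
  have "Seq (place n (a, p)) (place n (b, q)) \<simeq> Seq (Tensor c (Ident (n - m))) (Tensor (Ident m) d)"
    unfolding c(1) by (intro seq_cong_right d)
  also have "\<dots> \<simeq> Tensor c d"
    by (rule parallel_left_first[OF c(2) wd])
  also have "\<dots> \<simeq> Seq (Tensor (Ident m) d) (Tensor c (Ident (n - m)))"
    by (rule spatial_eq.sym[OF parallel_right_first[OF c(2) wd]])
  also have "\<dots> \<simeq> Seq (place n (b, q)) (place n (a, p))"
    unfolding c(1) by (intro seq_cong_left spatial_eq.sym[OF d])
  finally show ?thesis .
qed

definition disjoint_gates :: "located_gate \<Rightarrow> located_gate \<Rightarrow> bool" where
  "disjoint_gates g g' \<longleftrightarrow>
     fst g = Omega \<or> snd g + arity (fst g) \<le> snd g' \<or>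
     fst g' = Omega \<or> snd g' + arity (fst g') \<le> snd g"

lemma place_commute_Omega:
  assumes "fits n (Omega, p)" "fits n g"
  shows "Seq (place n (Omega, p)) (place n g) \<simeq> Seq (place n g) (place n (Omega, p))"
proof -
  obtain b q where g: "g = (b, q)"
    by (cases g)
  \<comment> \<open>Locations do not order a scalar against a two-wire gate around it; at location
    1, with arity 0, it precedes every gate.\<close>
  have "Seq (place n (Omega, p)) (place n g) \<simeq> Seq (place n (Omega, 1)) (place n g)"
    by (intro seq_cong_left place_Omega assms)
  also have "\<dots> \<simeq> Seq (place n g) (place n (Omega, 1))"
    unfolding g using assms by (intro place_commute_aux) (auto simp: fits_def g)
  also have "\<dots> \<simeq> Seq (place n g) (place n (Omega, p))"
    by (intro seq_cong_right spatial_eq.sym[OF place_Omega] assms)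
  finally show ?thesis .
qed

lemma place_commute:
  assumes "fits n g" "fits n g'" "disjoint_gates g g'"
  shows "Seq (place n g) (place n g') \<simeq> Seq (place n g') (place n g)"
  using assms(3) unfolding disjoint_gates_def
proof (elim disjE)
  assume "fst g = Omega"
  then show ?thesis
    using place_commute_Omega assms by (metis prod.collapse)
next
  assume "fst g' = Omega"
  then show ?thesis
    using place_commute_Omega assms by (metis prod.collapse spatial_eq.sym)
next
  assume "snd g + arity (fst g) \<le> snd g'"
  then show ?thesis
    using place_commute_aux assms by (metis prod.collapse)
next
  assume "snd g' + arity (fst g') \<le> snd g"
  then show ?thesis
    using place_commute_aux assms by (metis prod.collapse spatial_eq.sym)
qed

text \<open>The parameter \<open>G\<close> remembers the gate symbols, so that a Clifford circuit
  becomes a word of \<open>Omega\<close>, \<open>H\<close>, \<open>S\<close>, \<open>Zc\<close>. For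
  a tensor product the upper factor is run first and then the lower one, each padded with identity
  wires.\<close>

lemma circuit_as_word:
  assumes "well_typed c" "gates c \<subseteq> G"
  shows "\<exists>w. (\<forall>g\<in>set w. fits (width c) g \<and> fst g \<in> G) \<and> c \<simeq> on_wires (width c) w"
  using assms
proof (induction c)
  case (Ident n)
  then show ?case
    by (intro exI[of _ "[]"]) (simp add: on_wires_Nil spatial_eq.refl)
next
  case (Gate a)
  have "Gate a \<simeq> place (arity a) (a, 1)"
    by (simp add: place_def)
      (meson spatial_eq.sym spatial_eq.trans spatial_eq.tensor_unit_left spatial_eq.tensor_unit_right)
  also have "\<dots> \<simeq> on_wires (arity a) [(a, 1)]"
    by (simp add: on_wires_Nil on_wires_Cons spatial_eq.sym spatial_ident_right width_place fits_def)
  finally show ?case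
    using Gate by (intro exI[of _ "[(a, 1)]"]) (auto simp: fits_def)
next
  case (Seq c d)
  obtain u v where
    u: "\<forall>g\<in>set u. fits (width c) g \<and> fst g \<in> G" "c \<simeq> on_wires (width c) u" and
    v: "\<forall>g\<in>set v. fits (width c) g \<and> fst g \<in> G" "d \<simeq> on_wires (width c) v"
    using Seq by auto
  have "Seq c d \<simeq> Seq (on_wires (width c) u) (on_wires (width c) v)"
    by (intro spatial_eq.seq_cong u v)
  also have "\<dots> \<simeq> on_wires (width c) (u @ v)"
    using v by (intro spatial_eq.sym[OF on_wires_append]) auto
  finally show ?case
    using u v by (intro exI[of _ "u @ v"]) auto
next
  case (Tensor c d)
  let ?m = "width c" and ?n = "width d"
  obtain u v where
    u: "\<forall>g\<in>set u. fits ?m g \<and> fst g \<in> G" "c \<simeq> on_wires ?m u" and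
    v: "\<forall>g\<in>set v. fits ?n g \<and> fst g \<in> G" "d \<simeq> on_wires ?n v"
    using Tensor by auto
  have c: "Tensor c (Ident ?n) \<simeq> on_wires (?m + ?n) (map (shift 0) u)"
  proof -
    have "Tensor c (Ident ?n) \<simeq> framed 0 (on_wires ?m u) ?n"
      by (meson u(2) spatial_eq.sym spatial_eq.trans spatial_eq.tensor_unit_left tensor_cong_left)
    also have "\<dots> \<simeq> on_wires (0 + ?m + ?n) (map (shift 0) u)"
      using u by (intro framed_on_wires) auto
    finally show ?thesis
      by simp
  qed
  have d: "Tensor (Ident ?m) d \<simeq> on_wires (?m + ?n) (map (shift ?m) v)"
  proof -
    have "Tensor (Ident ?m) d \<simeq> framed ?m (on_wires ?n v) 0"
      by (meson v(2) spatial_eq.sym spatial_eq.trans spatial_eq.tensor_unit_right tensor_cong_right)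
    also have "\<dots> \<simeq> on_wires (?m + ?n + 0) (map (shift ?m) v)"
      using v by (intro framed_on_wires) auto
    finally show ?thesis
      by simp
  qed
  have fits: "\<forall>g\<in>set (map (shift 0) u @ map (shift ?m) v). fits (?m + ?n) g \<and> fst g \<in> G"
    using u v fits_shift[of ?m _ 0 "?m + ?n"] fits_shift[of ?n _ ?m "?m + ?n"] by auto
  have "Tensor c d \<simeq> Seq (Tensor c (Ident ?n)) (Tensor (Ident ?m) d)"
    by (rule spatial_eq.sym[OF parallel_left_first]) simp_all
  also have "\<dots> \<simeq> Seq (on_wires (?m + ?n) (map (shift 0) u)) (on_wires (?m + ?n) (map (shift ?m) v))"
    by (intro spatial_eq.seq_cong c d)
  also have "\<dots> \<simeq> on_wires (?m + ?n) (map (shift 0) u @ map (shift ?m) v)"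
    using fits by (intro spatial_eq.sym[OF on_wires_append]) auto
  finally show ?case
    using fits by (intro exI[of _ "map (shift 0) u @ map (shift ?m) v"] conjI) simp_all
qed

section \<open>Operators of circuits\<close>

lemma kron_carrier:
  "A \<in> carrier_mat a b \<Longrightarrow> B \<in> carrier_mat c d \<Longrightarrow> kron A B \<in> carrier_mat (a * c) (b * d)"
  by (auto simp: kron_def)

lemma dim_row_kron [simp]: "dim_row (kron A B) = dim_row A * dim_row B"
  and dim_col_kron [simp]: "dim_col (kron A B) = dim_col A * dim_col B"
  by (simp_all add: kron_def)

lemma index_kron:
  "i < dim_row A * dim_row B \<Longrightarrow> j < dim_col A * dim_col B \<Longrightarrow>
    kron A B $$ (i, j) = A $$ (i div dim_row B, j div dim_col B) * B $$ (i mod dim_row B, j mod dim_col B)"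
  by (simp add: kron_def)

lemma div_less_product: "i < a * b \<Longrightarrow> i div b < (a :: nat)"
  by (metis less_mult_imp_div_less)

lemma mod_less_product: "i < a * b \<Longrightarrow> i mod b < (b :: nat)"
  by (cases "b = 0") auto

lemma kron_one: "kron (1\<^sub>m a) (1\<^sub>m b) = 1\<^sub>m (a * b)"
proof (intro eq_matI)
  fix i j assume ij: "i < dim_row (1\<^sub>m (a * b) :: complex mat)" "j < dim_col (1\<^sub>m (a * b) :: complex mat)"
  have "(i = j) = (i div b = j div b \<and> i mod b = j mod b)"
    by (metis div_mult_mod_eq)
  then show "kron (1\<^sub>m a) (1\<^sub>m b) $$ (i, j) = 1\<^sub>m (a * b) $$ (i, j)"
    using ij by (simp add: index_kron div_less_product mod_less_product)
qed simp_all

lemma kron_one_left [simp]: "kron (1\<^sub>m (Suc 0)) M = M"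
  by (intro eq_matI) (auto simp: index_kron)

lemma kron_one_right [simp]: "kron M (1\<^sub>m (Suc 0)) = M"
  by (intro eq_matI) (auto simp: index_kron)

lemma kron_assoc: "kron (kron A B) C = kron A (kron B C)"
proof (intro eq_matI)
  have m: "(i div c) mod b = (i mod (b * c)) div c" "i mod c = i mod (b * c) mod c"
    "i div c div b = i div (b * c)" if "i < a * (b * c)" for i a b c :: nat
  proof -
    have c: "c > 0"
      using that by (auto intro: Nat.gr0I)
    show "(i div c) mod b = (i mod (b * c)) div c" 
      using c by (simp add: mod_mult2_eq mult.commute[of b])
    show "i mod c = i mod (b * c) mod c"
      by (simp add: mod_mult2_eq mult.commute[of b])
    show "i div c div b = i div (b * c)"
      by (simp add: div_mult2_eq mult.commute[of b])
  qed
  fix i j assume "i < dim_row (kron A (kron B C))" "j < dim_col (kron A (kron B C))"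
  then have i: "i < dim_row A * (dim_row B * dim_row C)" and j: "j < dim_col A * (dim_col B * dim_col C)"
    by simp_all
  have i': "i div dim_row C < dim_row A * dim_row B" and j': "j div dim_col C < dim_col A * dim_col B"
    using i j by (simp_all add: div_less_product flip: mult.assoc)
  have i'': "i mod (dim_row B * dim_row C) < dim_row B * dim_row C"
    and j'': "j mod (dim_col B * dim_col C) < dim_col B * dim_col C"
    using mod_less_product[OF i] mod_less_product[OF j] by simp_all
  show "kron (kron A B) C $$ (i, j) = kron A (kron B C) $$ (i, j)"
    using i j i' j' i'' j''
    by (simp add: index_kron m[OF i] m[OF j] mult.assoc)
qed (simp_all add: mult.assoc)

text \<open>The inner index of a product of Kronecker products is a pair
  \<open>(k div b, k mod b)\<close>; \<open>sum.nat_group\<close> cuts its range into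
  \<open>a\<close> blocks of length \<open>b\<close>.\<close>

lemma sum_div_mod:
  fixes f :: "nat \<Rightarrow> nat \<Rightarrow> complex"
  shows "(\<Sum>k<a * b. f (k div b) (k mod b)) = (\<Sum>k<a. \<Sum>l<b. f k l)"
proof -
  have "(\<Sum>k<a * b. f (k div b) (k mod b)) = (\<Sum>k<a. \<Sum>m = k * b..<k * b + b. f (m div b) (m mod b))"
    by (simp add: sum.nat_group)
  also have "\<dots> = (\<Sum>k<a. \<Sum>l<b. f k l)"
  proof (rule sum.cong[OF HOL.refl])
    fix k
    have "(\<Sum>m = k * b..<k * b + b. f (m div b) (m mod b)) = (\<Sum>l = 0..<b. f ((l + k * b) div b) ((l + k * b) mod b))"
      using sum.shift_bounds_nat_ivl[of "\<lambda>m. f (m div b) (m mod b)" 0 "k * b" b] by (simp add: add.commute)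
    also have "\<dots> = (\<Sum>l<b. f k l)"
      by (simp add: lessThan_atLeast0)
    finally show "(\<Sum>m = k * b..<k * b + b. f (m div b) (m mod b)) = (\<Sum>l<b. f k l)" .
  qed
  finally show ?thesis .
qed

lemma kron_mult:
  assumes "dim_col A = dim_row C" "dim_col B = dim_row D"
  shows "kron A B * kron C D = kron (A * C) (B * D)"
proof (intro eq_matI)
  fix i j assume "i < dim_row (kron (A * C) (B * D))" "j < dim_col (kron (A * C) (B * D))"
  then have i: "i < dim_row A * dim_row B" and j: "j < dim_col C * dim_col D"
    by simp_all
  let ?i = "i div dim_row B" and ?i' = "i mod dim_row B"
  let ?j = "j div dim_col D" and ?j' = "j mod dim_col D"
  have "(kron A B * kron C D) $$ (i, j)
      = (\<Sum>k<dim_row C * dim_row D. kron A B $$ (i, k) * kron C D $$ (k, j))"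
    using i j assms by (simp add: scalar_prod_def lessThan_atLeast0)
  also have "\<dots> = (\<Sum>k<dim_row C * dim_row D. (A $$ (?i, k div dim_row D) * C $$ (k div dim_row D, ?j))
      * (B $$ (?i', k mod dim_row D) * D $$ (k mod dim_row D, ?j')))"
    using i j assms by (intro sum.cong) (simp_all add: index_kron)
  also have "\<dots> = (\<Sum>k<dim_row C. \<Sum>l<dim_row D. (A $$ (?i, k) * C $$ (k, ?j)) * (B $$ (?i', l) * D $$ (l, ?j')))"
    by (rule sum_div_mod)
  also have "\<dots> = (\<Sum>k<dim_row C. A $$ (?i, k) * C $$ (k, ?j)) * (\<Sum>l<dim_row D. B $$ (?i', l) * D $$ (l, ?j'))"
    by (simp add: sum_product)
  also have "\<dots> = kron (A * C) (B * D) $$ (i, j)"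
    using i j assms
    by (simp add: index_kron scalar_prod_def lessThan_atLeast0 div_less_product mod_less_product)
  finally show "(kron A B * kron C D) $$ (i, j) = kron (A * C) (B * D) $$ (i, j)" .
qed simp_all

text \<open>The matrix form of the law \<open>spatial\<close>.\<close>

lemma kron_scalar:
  assumes "A \<in> carrier_mat 1 1"
  shows "kron A (1\<^sub>m n) = kron (1\<^sub>m n) A"
  using assms by (intro eq_matI) (auto simp: index_kron)

lemma gate_op_carrier: "gate_op g \<in> carrier_mat (2 ^ arity g) (2 ^ arity g)"
proof -
  have dims: "mat_omega \<in> carrier_mat 1 1" "mat_H \<in> carrier_mat 2 2" "mat_S \<in> carrier_mat 2 2"
    "mat_Zc \<in> carrier_mat 4 4"
    unfolding mat_omega_def mat_H_def mat_S_def mat_Zc_def mat_of_rows_list_def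
    by (intro smult_carrier_mat carrier_matI; simp)+
  have in_order: "in_order n Ms \<in> carrier_mat k k"
    if "k = 2 ^ n" "\<forall>N\<in>set Ms. N \<in> carrier_mat k k" for n k Ms
  proof -
    have "foldl (\<lambda>M N. N * M) M Ms \<in> carrier_mat k k" if "M \<in> carrier_mat k k" for M
      using that \<open>\<forall>N\<in>set Ms. N \<in> carrier_mat k k\<close> by (induction Ms arbitrary: M) (simp_all add: mult_carrier_mat[of _ k k])
    then show ?thesis
      using that(1) by (simp add: in_order_def)
  qed
  have kron: "kron (1\<^sub>m 2) M \<in> carrier_mat 4 4" "kron M (1\<^sub>m 2) \<in> carrier_mat 4 4" if "M \<in> carrier_mat 2 2" for M
    using kron_carrier[OF that one_carrier_mat, of 2] kron_carrier[OF one_carrier_mat that, of 2] by simp_all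
  show ?thesis
    by (cases g) (simp_all add: dims dims(1)[simplified] in_order kron)
qed

lemma circuit_op_carrier: "well_typed c \<Longrightarrow> circuit_op c \<in> carrier_mat (2 ^ width c) (2 ^ width c)"
  by (induction c) (auto simp: gate_op_carrier power_add intro: kron_carrier)

text \<open>Well-typedness supplies the dimensions that matrix associativity, units and the
  mixed-product rule ask for; \<open>spatial_well_typed\<close> carries it through symmetry and
  transitivity.\<close>

lemma spatial_circuit_op: "c \<simeq> d \<Longrightarrow> well_typed c \<Longrightarrow> circuit_op c = circuit_op d"
proof (induction rule: spatial_eq.induct)
  case (sym c d)
  then show ?case
    using spatial_well_typed by metis
next
  case (trans c d e)
  then show ?case
    using spatial_well_typed by metis
next
  case (seq_assoc c d e)
  then have "circuit_op c \<in> carrier_mat (2 ^ width c) (2 ^ width c)"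
    "circuit_op d \<in> carrier_mat (2 ^ width c) (2 ^ width c)"
    "circuit_op e \<in> carrier_mat (2 ^ width c) (2 ^ width c)"
    using circuit_op_carrier[of c] circuit_op_carrier[of d] circuit_op_carrier[of e] by auto
  then show ?case
    by (simp add: assoc_mult_mat)
next
  case (seq_ident_left c)
  then show ?case
    using circuit_op_carrier[of c] by simp
next
  case (seq_ident_right c)
  then show ?case
    using circuit_op_carrier[of c] by simp
next
  case (interchange c d c' d')
  then have "circuit_op c \<in> carrier_mat (2 ^ width c) (2 ^ width c)"
    "circuit_op d \<in> carrier_mat (2 ^ width c) (2 ^ width c)"
    "circuit_op c' \<in> carrier_mat (2 ^ width c') (2 ^ width c')"
    "circuit_op d' \<in> carrier_mat (2 ^ width c') (2 ^ width c')"
    using circuit_op_carrier[of c] circuit_op_carrier[of d] circuit_op_carrier[of c'] circuit_op_carrier[of d']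
    by auto
  then show ?case
    by (auto intro: kron_mult)
next
  case (spatial c n)
  then have "circuit_op c \<in> carrier_mat 1 1"
    using circuit_op_carrier[of c] by simp
  then show ?case
    by (simp add: kron_scalar)
qed (simp_all add: kron_assoc kron_one power_add)

section \<open>Exact simulation on basis states\<close>

text \<open>\<open>Cyc a b c d\<close> stands for \<open>a + b\<omega> + c\<omega>\<^sup>2 + d\<omega>\<^sup>3\<close>.\<close>

datatype cyc = Cyc int int int int

definition omega :: complex where "omega = cis (pi / 4)"

fun cyc_val :: "cyc \<Rightarrow> complex" where
  "cyc_val (Cyc a b c d) = of_int a + of_int b * omega + of_int c * \<i> + of_int d * (\<i> * omega)"

fun cyc_add :: "cyc \<Rightarrow> cyc \<Rightarrow> cyc" where
  "cyc_add (Cyc a b c d) (Cyc a' b' c' d') = Cyc (a + a') (b + b') (c + c') (d + d')"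

fun cyc_neg :: "cyc \<Rightarrow> cyc" where
  "cyc_neg (Cyc a b c d) = Cyc (- a) (- b) (- c) (- d)"

fun cyc_omega :: "cyc \<Rightarrow> cyc" where
  "cyc_omega (Cyc a b c d) = Cyc (- d) a b c"

fun cyc_i :: "cyc \<Rightarrow> cyc" where
  "cyc_i (Cyc a b c d) = Cyc (- c) (- d) a b"

text \<open>The square root of 2 equals omega - omega^3 (\<open>sqrt2_omega\<close>), so the
  coefficients are those of \<open>cyc_omega x\<close> minus those of
  \<open>cyc_i (cyc_omega x)\<close>.\<close>

fun cyc_sqrt2 :: "cyc \<Rightarrow> cyc" where
  "cyc_sqrt2 (Cyc a b c d) = Cyc (b - d) (a + c) (b + d) (c - a)"

lemma omega_squared: "omega * omega = \<i>"
  by (simp add: omega_def cis_mult)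

lemma i_squared_mult: "\<i> * (\<i> * z) = - z"
  by (simp flip: mult.assoc)

lemma sqrt2_omega: "complex_of_real (sqrt 2) = omega - \<i> * omega"
  by (simp add: omega_def complex_eq_iff cos_45 sin_45)

lemma cyc_val_add: "cyc_val (cyc_add x y) = cyc_val x + cyc_val y"
  by (cases x; cases y) (simp add: distrib_right)

lemma cyc_val_neg: "cyc_val (cyc_neg x) = - cyc_val x"
  by (cases x) simp

lemma cyc_val_omega: "cyc_val (cyc_omega x) = omega * cyc_val x"
  by (cases x) (simp add: distrib_left mult.left_commute[of omega "of_int k" for k] mult.left_commute[of omega \<i>] omega_squared i_squared_mult)

lemma cyc_val_i: "cyc_val (cyc_i x) = \<i> * cyc_val x"
  by (cases x) (simp add: distrib_left mult.left_commute[of \<i> "of_int k" for k] i_squared_mult)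

lemma cyc_val_sqrt2: "cyc_val (cyc_sqrt2 x) = complex_of_real (sqrt 2) * cyc_val x"
proof (cases x)
  case (Cyc a b c d)
  have "complex_of_real (sqrt 2) * cyc_val x = omega * cyc_val x - \<i> * (omega * cyc_val x)"
    by (simp add: sqrt2_omega left_diff_distrib)
  also have "\<dots> = cyc_val (cyc_omega x) - cyc_val (cyc_i (cyc_omega x))"
    by (simp only: cyc_val_i cyc_val_omega)
  also have "\<dots> = cyc_val (cyc_sqrt2 x)"
    by (simp add: Cyc left_diff_distrib distrib_right)
  finally show ?thesis
    by simp
qed

lemmas cyc_val_simps = cyc_val_add cyc_val_neg cyc_val_omega cyc_val_i cyc_val_sqrt2

section \<open>States as binary trees, and their vectors\<close>

text \<open>The two branches of a \<open>Fork\<close> are the halves of the state where the topmost qubit is 0 and 1.\<close>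

datatype state = Amp cyc | Fork state state

primrec is_state :: "nat \<Rightarrow> state \<Rightarrow> bool" where
  "is_state 0 s \<longleftrightarrow> (\<exists>a. s = Amp a)"
| "is_state (Suc n) s \<longleftrightarrow> (\<exists>t u. s = Fork t u \<and> is_state n t \<and> is_state n u)"

primrec state_map :: "(cyc \<Rightarrow> cyc) \<Rightarrow> state \<Rightarrow> state" where
  "state_map f (Amp a) = Amp (f a)"
| "state_map f (Fork s t) = Fork (state_map f s) (state_map f t)"

fun state_add :: "state \<Rightarrow> state \<Rightarrow> state" where
  "state_add (Amp a) (Amp b) = Amp (cyc_add a b)"
| "state_add (Fork s t) (Fork s' t') = Fork (state_add s s') (state_add t t')"
| "state_add s t = s"

primrec state_vec :: "state \<Rightarrow> complex vec" where
  "state_vec (Amp a) = vec 1 (\<lambda>_. cyc_val a)"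
| "state_vec (Fork s t) = state_vec s @\<^sub>v state_vec t"

lemma dim_state_vec: "is_state n s \<Longrightarrow> dim_vec (state_vec s) = 2 ^ n"
  by (induction n arbitrary: s) auto

lemma state_vec_carrier: "is_state n s \<Longrightarrow> state_vec s \<in> carrier_vec (2 ^ n)"
  by (simp add: carrier_vecI dim_state_vec)

lemma is_state_map: "is_state n s \<Longrightarrow> is_state n (state_map f s)"
  by (induction n arbitrary: s) auto

lemma is_state_add: "is_state n s \<Longrightarrow> is_state n t \<Longrightarrow> is_state n (state_add s t)"
proof (induction n arbitrary: s t)
  case (Suc n)
  then show ?case
    by (cases s; cases t) auto
qed auto

lemma smult_append_vec: "c \<cdot>\<^sub>v (u @\<^sub>v v) = (c \<cdot>\<^sub>v u) @\<^sub>v (c \<cdot>\<^sub>v v)"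
  by (intro eq_vecI) auto

lemma state_vec_map:
  assumes "\<And>a. cyc_val (f a) = c * cyc_val a"
  shows "state_vec (state_map f s) = c \<cdot>\<^sub>v state_vec s"
  by (induction s) (auto simp: assms smult_append_vec)

lemma state_vec_add:
  "is_state n s \<Longrightarrow> is_state n t \<Longrightarrow> state_vec (state_add s t) = state_vec s + state_vec t"
proof (induction n arbitrary: s t)
  case 0
  then show ?case
    by (auto simp: cyc_val_simps)
next
  case (Suc n)
  then show ?case
    by (auto simp: append_vec_add[of _ "2 ^ n" _ _ "2 ^ n"] state_vec_carrier)
qed

text \<open>Block form: \<open>i div k\<close> selects the half of the vector and
  \<open>i mod k\<close> the entry inside it. It serves with \<open>M\<close> the identity for
  \<open>H\<close> and \<open>S\<close> on wire 1, and with \<open>U\<close> the identity for every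
  gate further down.\<close>

lemma kron_mult_append_vec:
  assumes U: "U \<in> carrier_mat 2 2" and M: "M \<in> carrier_mat k k"
    and u: "u \<in> carrier_vec k" and v: "v \<in> carrier_vec k"
  shows "kron U M *\<^sub>v (u @\<^sub>v v)
    = (U $$ (0, 0) \<cdot>\<^sub>v (M *\<^sub>v u) + U $$ (0, 1) \<cdot>\<^sub>v (M *\<^sub>v v)) @\<^sub>v
      (U $$ (1, 0) \<cdot>\<^sub>v (M *\<^sub>v u) + U $$ (1, 1) \<cdot>\<^sub>v (M *\<^sub>v v))" (is "_ = ?r")
proof (intro eq_vecI)
  fix i assume "i < dim_vec ?r"
  then have i: "i < 2 * k"
    using M by simp
  then have k: "k > 0"
    by auto
  have "(kron U M *\<^sub>v (u @\<^sub>v v)) $ i = (\<Sum>j<2 * k. kron U M $$ (i, j) * (u @\<^sub>v v) $ j)"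
    using i U M u v by (simp add: scalar_prod_def lessThan_atLeast0 mult_2)
  also have "\<dots> = (\<Sum>j<2 * k. U $$ (i div k, j div k) * M $$ (i mod k, j mod k)
      * (if j div k = 0 then u $ (j mod k) else v $ (j mod k)))"
  proof (rule sum.cong[OF HOL.refl])
    fix j assume "j \<in> {..<2 * k}"
    moreover have "j mod k = j - k" if "k \<le> j" "j < 2 * k"
      using that by (simp add: le_mod_geq)
    moreover have "j div k = 0 \<longleftrightarrow> j < k"
      using k by (simp add: div_eq_0_iff)
    ultimately show "kron U M $$ (i, j) * (u @\<^sub>v v) $ j = U $$ (i div k, j div k) * M $$ (i mod k, j mod k)
      * (if j div k = 0 then u $ (j mod k) else v $ (j mod k))"
      using i U M u v by (auto simp: index_kron not_less)
  qed
  also have "\<dots> = (\<Sum>a<2. \<Sum>b<k. U $$ (i div k, a) * M $$ (i mod k, b) * (if a = 0 then u $ b else v $ b))"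
    by (rule sum_div_mod)
  also have "\<dots> = U $$ (i div k, 0) * (\<Sum>b<k. M $$ (i mod k, b) * u $ b)
      + U $$ (i div k, 1) * (\<Sum>b<k. M $$ (i mod k, b) * v $ b)"
    by (simp add: numeral_2_eq_2 sum_distrib_left mult.assoc)
  also have "\<dots> = U $$ (i div k, 0) * (M *\<^sub>v u) $ (i mod k) + U $$ (i div k, 1) * (M *\<^sub>v v) $ (i mod k)"
    using M u v k by (simp add: scalar_prod_def lessThan_atLeast0)
  also have "\<dots> = ?r $ i"
  proof (cases "i < k")
    case True
    then show ?thesis
      using M u v by simp
  next
    case False
    then have "i div k = 1" "i mod k = i - k"
      using i k by (simp_all add: le_div_geq le_mod_geq)
    then show ?thesis
      using M u v i False by simp
  qed
  finally show "(kron U M *\<^sub>v (u @\<^sub>v v)) $ i = ?r $ i" .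
qed (use U M in auto)

text \<open>The matrix \<open>mat_Zc\<close> is diagonal and its only entry -1 is the last one, so
  exactly the last quarter of the vector, the indices from \<open>3 * k\<close> on, changes
  sign.\<close>

lemma kron_Zc_mult_append_vec:
  assumes "t \<in> carrier_vec k" "u \<in> carrier_vec k" "v \<in> carrier_vec k" "w \<in> carrier_vec k"
  shows "kron mat_Zc (1\<^sub>m k) *\<^sub>v ((t @\<^sub>v u) @\<^sub>v (v @\<^sub>v w)) = (t @\<^sub>v u) @\<^sub>v (v @\<^sub>v ((- 1) \<cdot>\<^sub>v w))" (is "_ *\<^sub>v ?x = ?r")
proof (intro eq_vecI)
  fix i assume "i < dim_vec ?r"
  then have i: "i < 4 * k"
    using assms by simp
  then have k: "k > 0"
    by auto
  have x: "dim_vec ?x = 4 * k"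
    using assms by simp
  have Z: "mat_Zc $$ (a, b) = (if a = b then if a = 3 then - 1 else 1 else 0)" if "a < 4" "b < 4" for a b
  proof -
    have "a \<in> {0, 1, 2, 3}" "b \<in> {0, 1, 2, 3}"
      using that by auto
    then show ?thesis
      by (auto simp: mat_Zc_def mat_of_rows_list_def)
  qed
  have dims: "dim_row mat_Zc = 4" "dim_col mat_Zc = 4"
    by (simp_all add: mat_Zc_def mat_of_rows_list_def)
  have "(kron mat_Zc (1\<^sub>m k) *\<^sub>v ?x) $ i = (\<Sum>j<4 * k. kron mat_Zc (1\<^sub>m k) $$ (i, j) * ?x $ j)"
    using i x by (simp add: dims scalar_prod_def lessThan_atLeast0 del: index_append_vec)
  also have "\<dots> = (\<Sum>j<4 * k. if j = i then (if i div k = 3 then - 1 else 1) * ?x $ i else 0)"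
  proof (rule sum.cong[OF HOL.refl])
    fix j assume j: "j \<in> {..<4 * k}"
    have eq: "(i = j) = (i div k = j div k \<and> i mod k = j mod k)"
      by (metis div_mult_mod_eq)
    have "i div k < 4" "j div k < 4"
      using i j by (auto intro: div_less_product)
    then show "kron mat_Zc (1\<^sub>m k) $$ (i, j) * ?x $ j = (if j = i then (if i div k = 3 then - 1 else 1) * ?x $ i else 0)"
      using i j k eq by (auto simp: index_kron dims Z simp del: index_append_vec)
  qed
  also have "\<dots> = (if i div k = 3 then - 1 else 1) * ?x $ i"
    using i by simp
  also have "i div k = 3 \<longleftrightarrow> 3 * k \<le> i"
  proof -
    have "i div k < 4"
      using i by (auto intro: div_less_product)
    then show ?thesis
      using k less_eq_div_iff_mult_less_eq[of k 3 i] by auto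
  qed
  also have "(if 3 * k \<le> i then - 1 else 1) * ?x $ i = ?r $ i"
    using i assms by auto
  finally show "(kron mat_Zc (1\<^sub>m k) *\<^sub>v ?x) $ i = ?r $ i" .
qed (use assms in \<open>auto simp: mat_Zc_def mat_of_rows_list_def\<close>)

text \<open>\<open>H\<close> acts without its factor \<open>1 / \<surd>2\<close>, to stay in \<open>\<int>[\<omega>]\<close>.\<close>

fun act :: "gate \<Rightarrow> nat \<Rightarrow> state \<Rightarrow> state" where
  "act g (Suc (Suc q)) (Fork s t) = Fork (act g (Suc q) s) (act g (Suc q) t)"
| "act H (Suc 0) (Fork s t) = Fork (state_add s t) (state_add s (state_map cyc_neg t))"
| "act S (Suc 0) (Fork s t) = Fork s (state_map cyc_i t)"
| "act Zc (Suc 0) (Fork s (Fork t u)) = Fork s (Fork t (state_map cyc_neg u))"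
| "act Omega (Suc 0) s = state_map cyc_omega s"
| "act g q s = s"

definition act_scale :: "gate \<Rightarrow> complex" where
  "act_scale g = (if g = H then 1 / complex_of_real (sqrt 2) else 1)"

text \<open>Induction on the location: at location 1 the block formulas apply (a scalar multiplies
  the whole vector), and each further wire above contributes a factor \<open>1\<^sub>m 2\<close>,
  which runs the gate on both branches of the \<open>Fork\<close>.\<close>

lemma act_correct:
  assumes "g \<in> {Omega, H, S, Zc}" "fits n (g, q)" "is_state n s"
  shows "is_state n (act g q s) \<and>
    circuit_op (place n (g, q)) *\<^sub>v state_vec s = act_scale g \<cdot>\<^sub>v state_vec (act g q s)"
  using assms(2,3)
proof (induction q arbitrary: n s)
  case 0
  then show ?case
    by (simp add: fits_def)
next
  case (Suc q)
  show ?case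
  proof (cases q)
    case 0
    consider "g = Omega" | "g = H" | "g = S" | "g = Zc"
      using assms(1) by blast
    then show ?thesis
    proof cases
      case 1
      have v: "state_vec s \<in> carrier_vec (2 ^ n)"
        by (rule state_vec_carrier[OF Suc.prems(2)])
      have "kron mat_omega (1\<^sub>m (2 ^ n)) = omega \<cdot>\<^sub>m 1\<^sub>m (2 ^ n)"
        by (intro eq_matI) (auto simp: index_kron mat_omega_def omega_def mat_of_rows_list_def)
      moreover have "(omega \<cdot>\<^sub>m 1\<^sub>m (2 ^ n)) *\<^sub>v state_vec s = omega \<cdot>\<^sub>v state_vec s"
      proof (intro eq_vecI)
        fix i assume "i < dim_vec (omega \<cdot>\<^sub>v state_vec s)"
        then have i: "i < 2 ^ n"
          using v by simp
        have "row (omega \<cdot>\<^sub>m 1\<^sub>m (2 ^ n)) i = omega \<cdot>\<^sub>v unit_vec (2 ^ n) i"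
          using i by (intro eq_vecI) auto
        then show "((omega \<cdot>\<^sub>m 1\<^sub>m (2 ^ n)) *\<^sub>v state_vec s) $ i = (omega \<cdot>\<^sub>v state_vec s) $ i"
          using v i by simp
      qed (use v in simp)
      ultimately have "kron mat_omega (1\<^sub>m (2 ^ n)) *\<^sub>v state_vec s = omega \<cdot>\<^sub>v state_vec s"
        by simp
      then show ?thesis
        using Suc.prems 0 1
        by (simp add: place_def act_scale_def is_state_map one_smult_vec
            state_vec_map[of cyc_omega, OF cyc_val_simps(3)])
    next
      case 2
      obtain m where n: "n = Suc m"
        using Suc.prems 2 by (cases n) (auto simp: fits_def)
      obtain t u where s: "s = Fork t u" "is_state m t" "is_state m u"
        using Suc.prems n by auto
      have v: "state_vec t \<in> carrier_vec (2 ^ m)" "state_vec u \<in> carrier_vec (2 ^ m)"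
        using s state_vec_carrier by auto
      have U: "mat_H \<in> carrier_mat 2 2"
        using gate_op_carrier[of H] by simp
      define c where "c = 1 / complex_of_real (sqrt 2)"
      have "mat_H $$ (0, 0) = c" "mat_H $$ (0, Suc 0) = c"
        "mat_H $$ (Suc 0, 0) = c" "mat_H $$ (Suc 0, Suc 0) = - c"
        by (simp_all add: c_def mat_H_def mat_of_rows_list_def)
      then have "kron mat_H (1\<^sub>m (2 ^ m)) *\<^sub>v (state_vec t @\<^sub>v state_vec u)
          = c \<cdot>\<^sub>v ((state_vec t + state_vec u) @\<^sub>v (state_vec t + (- 1) \<cdot>\<^sub>v state_vec u))"
        using v by (subst kron_mult_append_vec[OF U one_carrier_mat v])
          (auto simp: smult_append_vec distrib_left right_diff_distrib intro!: eq_vecI)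
      then show ?thesis
        using s 0 2 n
        by (simp add: place_def act_scale_def c_def is_state_map is_state_add state_vec_add
            state_vec_map[of cyc_neg "- 1"] cyc_val_simps)
    next
      case 3
      obtain m where n: "n = Suc m"
        using Suc.prems 3 by (cases n) (auto simp: fits_def)
      obtain t u where s: "s = Fork t u" "is_state m t" "is_state m u"
        using Suc.prems n by auto
      have v: "state_vec t \<in> carrier_vec (2 ^ m)" "state_vec u \<in> carrier_vec (2 ^ m)"
        using s state_vec_carrier by auto
      have U: "mat_S \<in> carrier_mat 2 2"
        using gate_op_carrier[of S] by simp
      have "mat_S $$ (0, 0) = 1" "mat_S $$ (0, Suc 0) = 0"
        "mat_S $$ (Suc 0, 0) = 0" "mat_S $$ (Suc 0, Suc 0) = \<i>"
        by (simp_all add: mat_S_def mat_of_rows_list_def)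
      then have "kron mat_S (1\<^sub>m (2 ^ m)) *\<^sub>v (state_vec t @\<^sub>v state_vec u)
          = state_vec t @\<^sub>v (\<i> \<cdot>\<^sub>v state_vec u)"
        using v by (subst kron_mult_append_vec[OF U one_carrier_mat v])
          (auto intro!: eq_vecI)
      then show ?thesis
        using s 0 3 n
        by (simp add: place_def act_scale_def is_state_map one_smult_vec
            state_vec_map[of cyc_i "\<i>"] cyc_val_simps)
    next
      case 4
      obtain m where n: "n = Suc (Suc m)"
        using Suc.prems 4 by (cases n; cases "n - 1") (auto simp: fits_def)
      obtain a b c d where s: "s = Fork (Fork a b) (Fork c d)"
        "is_state m a" "is_state m b" "is_state m c" "is_state m d"
        using Suc.prems n by auto
      have v: "state_vec a \<in> carrier_vec (2 ^ m)" "state_vec b \<in> carrier_vec (2 ^ m)"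
        "state_vec c \<in> carrier_vec (2 ^ m)" "state_vec d \<in> carrier_vec (2 ^ m)"
        using s state_vec_carrier by auto
      show ?thesis
        using s 0 4 n kron_Zc_mult_append_vec[OF v]
        by (simp add: place_def act_scale_def is_state_map one_smult_vec
            state_vec_map[of cyc_neg "- 1"] cyc_val_simps)
    qed
  next
    case (Suc p)
    obtain m where n: "n = Suc m"
      using Suc.prems Suc by (cases n) (auto simp: fits_def)
    obtain t u where s: "s = Fork t u" "is_state m t" "is_state m u"
      using Suc.prems n by auto
    have fits: "fits m (g, q)"
      using Suc.prems Suc n by (auto simp: fits_def)
    let ?M = "circuit_op (place m (g, q))"
    have M: "?M \<in> carrier_mat (2 ^ m) (2 ^ m)"
      using circuit_op_carrier[OF well_typed_place, of m "(g, q)"] fits by (simp add: width_place)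
    have v: "state_vec t \<in> carrier_vec (2 ^ m)" "state_vec u \<in> carrier_vec (2 ^ m)"
      using s state_vec_carrier by auto
    have Mv: "?M *\<^sub>v state_vec t \<in> carrier_vec (2 ^ m)" "?M *\<^sub>v state_vec u \<in> carrier_vec (2 ^ m)"
      using M v by auto
    have "circuit_op (place n (g, Suc q)) = kron (1\<^sub>m 2) ?M"
      using kron_one[of 2 "2 ^ p"] by (simp add: place_def n Suc kron_assoc[symmetric])
    then have "circuit_op (place n (g, Suc q)) *\<^sub>v state_vec s
        = (?M *\<^sub>v state_vec t) @\<^sub>v (?M *\<^sub>v state_vec u)"
      using Mv by (simp add: s kron_mult_append_vec[OF one_carrier_mat M v])
        (auto intro!: eq_vecI simp: one_smult_vec)
    then show ?thesis
      using Suc.IH[OF fits s(2)] Suc.IH[OF fits s(3)] by (simp add: s n Suc smult_append_vec)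
  qed
qed

section \<open>Expansion of all gates into elementary ones\<close>

primrec expand :: "gate \<Rightarrow> located_gate list" where
  "expand Omega = [(Omega, 1)]"
| "expand H = [(H, 1)]"
| "expand S = [(S, 1)]"
| "expand Zc = [(Zc, 1)]"
| "expand X = [(H, 1), (S, 1), (S, 1), (H, 1)]"
| "expand A1 = []"
| "expand A2 = [(H, 1)]"
| "expand A3 = [(H, 1), (S, 1), (H, 1)]"
| "expand B1 = [(H, 2), (Zc, 1), (H, 1), (H, 2), (Zc, 1), (H, 1), (H, 2), (Zc, 1)]"
| "expand B2 = [(Zc, 1), (H, 1), (H, 2), (Zc, 1)]"
| "expand B3 = [(H, 1), (S, 1), (Zc, 1), (H, 1), (H, 2), (Zc, 1)]"
| "expand B4 = [(H, 1), (Zc, 1), (H, 1), (H, 2), (Zc, 1)]"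
| "expand C1 = []"
| "expand C2 = [(H, 1), (S, 1), (S, 1), (H, 1)]"
| "expand D1 = [(Zc, 1), (H, 1), (H, 2), (Zc, 1), (H, 1), (H, 2), (Zc, 1), (H, 2)]"
| "expand D2 = [(H, 1), (Zc, 1), (H, 1), (H, 2), (Zc, 1), (H, 2)]"
| "expand D3 = [(H, 1), (H, 2), (S, 2), (Zc, 1), (H, 1), (H, 2), (Zc, 1), (H, 2)]"
| "expand D4 = [(H, 1), (H, 2), (Zc, 1), (H, 1), (H, 2), (Zc, 1), (H, 2)]"
| "expand E1 = []"
| "expand E2 = [(S, 1)]"
| "expand E3 = [(S, 1), (S, 1)]"
| "expand E4 = [(S, 1), (S, 1), (S, 1)]"

lemma expand_fits: "\<forall>g'\<in>set (expand g). fits (arity g) g' \<and> fst g' \<in> {Omega, H, S, Zc}"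
  by (cases g) (simp_all add: fits_def)

lemma circuit_op_place_carrier: "fits n g \<Longrightarrow> circuit_op (place n g) \<in> carrier_mat (2 ^ n) (2 ^ n)"
  using circuit_op_carrier[OF well_typed_place] by (metis width_place)

lemma circuit_op_on_wires_carrier:
  "\<forall>g\<in>set w. fits n g \<Longrightarrow> circuit_op (on_wires n w) \<in> carrier_mat (2 ^ n) (2 ^ n)"
  using circuit_op_carrier[OF well_typed_on_wires] by (metis width_on_wires)

lemma foldl_circuit_op:
  assumes "\<forall>g\<in>set w. fits n g" "A \<in> carrier_mat (2 ^ n) (2 ^ n)"
  shows "foldl (\<lambda>M N. N * M) A (map (\<lambda>g. circuit_op (place n g)) w) = circuit_op (on_wires n w) * A"
  using assms
proof (induction w arbitrary: A)
  case Nil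
  then show ?case
    by (simp add: on_wires_Nil)
next
  case (Cons g w)
  have "foldl (\<lambda>M N. N * M) A (map (\<lambda>g. circuit_op (place n g)) (g # w))
      = circuit_op (on_wires n w) * (circuit_op (place n g) * A)"
    using Cons circuit_op_place_carrier[of n g] by (simp add: mult_carrier_mat[of _ "2 ^ n" "2 ^ n"])
  then show ?case
    using Cons.prems circuit_op_place_carrier[of n g] circuit_op_on_wires_carrier[of w n]
    by (simp add: on_wires_Cons assoc_mult_mat[of _ "2 ^ n" "2 ^ n" _ "2 ^ n"])
qed

lemma circuit_op_on_wires:
  "\<forall>g\<in>set w. fits n g \<Longrightarrow> circuit_op (on_wires n w) = in_order n (map (\<lambda>g. circuit_op (place n g)) w)"
  using foldl_circuit_op[of w n "1\<^sub>m (2 ^ n)"] circuit_op_on_wires_carrier[of w n]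
  by (simp add: in_order_def)

text \<open>The indexed matrices inside \<open>gate_op\<close>, such as
  \<open>kron mat_H (1\<^sub>m 2)\<close>, are the operators of \<open>place 2\<close>, so
  \<open>expand\<close> lists the factors of \<open>gate_op\<close> one by one; words of length 0
  and 1 account for the clauses without \<open>in_order\<close>.\<close>

lemma gate_op_expand: "circuit_op (on_wires (arity g) (expand g)) = gate_op g"
proof -
  have single: "in_order n [M] = M" if "M \<in> carrier_mat (2 ^ n) (2 ^ n)" for n M
    using that by (simp add: in_order_def)
  have empty: "in_order n [] = 1\<^sub>m (2 ^ n)" for n
    by (simp add: in_order_def)
  have "circuit_op (on_wires (arity g) (expand g)) = in_order (arity g) (map (\<lambda>x. circuit_op (place (arity g) x)) (expand g))"
    using expand_fits by (intro circuit_op_on_wires) blast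
  also have "\<dots> = gate_op g"
    using gate_op_carrier[of g] by (cases g; simp add: place_def single empty)
  finally show ?thesis .
qed

definition elementary :: "located_gate list \<Rightarrow> located_gate list" where
  "elementary w = concat (map (\<lambda>(g, q). map (shift (q - 1)) (expand g)) w)"

lemma elementary_simps: "elementary [] = []"
  "elementary ((g, q) # w) = map (shift (q - 1)) (expand g) @ elementary w"
  by (simp_all add: elementary_def)

lemma elementary_fits:
  assumes "\<forall>g\<in>set w. fits n g"
  shows "\<forall>g\<in>set (elementary w). fits n g \<and> fst g \<in> {Omega, H, S, Zc}"
proof -
  have "fits n (shift (q - 1) g') \<and> fst g' \<in> {Omega, H, S, Zc}" if "fits n (g, q)" "g' \<in> set (expand g)" for g q g'
  proof
    show "fits n (shift (q - 1) g')"
      using that expand_fits[of g] by (intro fits_shift[of "arity g"]) (auto simp: fits_def)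
    show "fst g' \<in> {Omega, H, S, Zc}"
      using that expand_fits[of g] by blast
  qed
  note single = this
  show ?thesis
  proof
    fix x assume "x \<in> set (elementary w)"
    then obtain g q g' where "(g, q) \<in> set w" "g' \<in> set (expand g)" "x = shift (q - 1) g'"
      by (auto simp: elementary_def)
    then show "fits n x \<and> fst x \<in> {Omega, H, S, Zc}"
      using assms single by (simp only: fst_shift) blast
  qed
qed

lemma circuit_op_elementary:
  "\<forall>g\<in>set w. fits n g \<Longrightarrow> circuit_op (on_wires n (elementary w)) = circuit_op (on_wires n w)"
proof (induction w)
  case Nil
  then show ?case
    by (simp add: elementary_simps)
next
  case (Cons x w)
  obtain g q where x: "x = (g, q)"
    by (cases x)
  define j where "j = n - (q - 1 + arity g)"
  have n: "n = q - 1 + arity g + j"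
    using Cons.prems by (auto simp: x j_def fits_def)
  let ?u = "map (shift (q - 1)) (expand g)"
  have fits: "\<forall>g\<in>set ?u. fits n g" "\<forall>g\<in>set (elementary w). fits n g"
    using elementary_fits[of "x # w" n] Cons.prems by (auto simp: x elementary_simps)
  have "circuit_op (on_wires n ?u) = circuit_op (framed (q - 1) (on_wires (arity g) (expand g)) j)"
    unfolding n using expand_fits[of g]
    by (intro spatial_circuit_op[symmetric] framed_on_wires) (auto simp: well_typed_on_wires)
  also have "\<dots> = circuit_op (place n x)"
    by (simp add: gate_op_expand place_def x j_def)
  finally have u: "circuit_op (on_wires n ?u) = circuit_op (place n x)" .
  have "circuit_op (on_wires n (?u @ elementary w)) = circuit_op (Seq (on_wires n ?u) (on_wires n (elementary w)))"
    using fits by (intro spatial_circuit_op on_wires_append well_typed_on_wires) auto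
  then show ?case
    using Cons u by (simp add: x elementary_simps on_wires_Cons)
qed

definition run :: "located_gate list \<Rightarrow> state \<Rightarrow> state" where
  "run w = fold (\<lambda>(g, q). act g q) w"

definition count_H :: "located_gate list \<Rightarrow> nat" where
  "count_H w = length (filter (\<lambda>g. fst g = H) w)"

text \<open>\<open>act\<close> leaves out one factor 1 / sqrt 2 per \<open>H\<close>, so the defect
  of a whole word is the power with exponent \<open>count_H w\<close>.\<close>

lemma run_correct:
  assumes "\<forall>g\<in>set w. fits n g \<and> fst g \<in> {Omega, H, S, Zc}" "is_state n s"
  shows "is_state n (run w s) \<and> circuit_op (on_wires n w) *\<^sub>v state_vec s
    = (1 / complex_of_real (sqrt 2)) ^ count_H w \<cdot>\<^sub>v state_vec (run w s)"
  using assms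
proof (induction w arbitrary: s)
  case Nil
  then show ?case
    using state_vec_carrier[of n s] by (simp add: run_def count_H_def on_wires_Nil)
next
  case (Cons x w)
  obtain g q where x: "x = (g, q)"
    by (cases x)
  let ?s = "act g q s" and ?c = "(1 / complex_of_real (sqrt 2)) ^ count_H w"
  have step: "is_state n ?s" "circuit_op (place n x) *\<^sub>v state_vec s = act_scale g \<cdot>\<^sub>v state_vec ?s"
    using act_correct[of g n q s] Cons.prems by (auto simp: x)
  have rest: "is_state n (run w ?s)" "circuit_op (on_wires n w) *\<^sub>v state_vec ?s = ?c \<cdot>\<^sub>v state_vec (run w ?s)"
    using Cons.IH[OF _ step(1)] Cons.prems by auto
  have M: "circuit_op (on_wires n w) \<in> carrier_mat (2 ^ n) (2 ^ n)"
    using Cons.prems by (intro circuit_op_on_wires_carrier) simp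
  have P: "circuit_op (place n x) \<in> carrier_mat (2 ^ n) (2 ^ n)"
    using Cons.prems by (intro circuit_op_place_carrier) simp
  have "circuit_op (on_wires n (x # w)) *\<^sub>v state_vec s
      = circuit_op (on_wires n w) *\<^sub>v (circuit_op (place n x) *\<^sub>v state_vec s)"
    using M P state_vec_carrier[OF Cons.prems(2)] by (simp add: on_wires_Cons assoc_mult_mat_vec)
  also have "\<dots> = act_scale g \<cdot>\<^sub>v (circuit_op (on_wires n w) *\<^sub>v state_vec ?s)"
    using M state_vec_carrier[OF step(1)] unfolding step(2) by (rule mult_mat_vec)
  also have "\<dots> = (act_scale g * ?c) \<cdot>\<^sub>v state_vec (run w ?s)"
    by (simp add: rest(2) smult_smult_assoc)
  also have "act_scale g * ?c = (1 / complex_of_real (sqrt 2)) ^ count_H (x # w)"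
    by (simp add: act_scale_def count_H_def x)
  finally show ?case
    using rest(1) by (simp add: run_def x)
qed

section \<open>Equality of operators tested on basis states\<close>

primrec zero_state :: "nat \<Rightarrow> state" where
  "zero_state 0 = Amp (Cyc 0 0 0 0)"
| "zero_state (Suc n) = Fork (zero_state n) (zero_state n)"

primrec basis :: "nat \<Rightarrow> state list" where
  "basis 0 = [Amp (Cyc 1 0 0 0)]"
| "basis (Suc n) = map (\<lambda>s. Fork s (zero_state n)) (basis n) @ map (Fork (zero_state n)) (basis n)"

lemma is_state_zero: "is_state n (zero_state n)"
  by (induction n) auto

lemma state_vec_zero: "state_vec (zero_state n) = 0\<^sub>v (2 ^ n)"
proof (induction n)
  case (Suc n)
  then show ?case
    by (intro eq_vecI) auto
qed (auto intro!: eq_vecI)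

lemma is_state_basis: "s \<in> set (basis n) \<Longrightarrow> is_state n s"
  by (induction n arbitrary: s) (auto simp: is_state_zero)

lemma unit_vec_basis: "i < 2 ^ n \<Longrightarrow> \<exists>s\<in>set (basis n). state_vec s = unit_vec (2 ^ n) i"
proof (induction n arbitrary: i)
  case 0
  then show ?case
    by (auto intro!: eq_vecI)
next
  case (Suc n)
  show ?case
  proof (cases "i < 2 ^ n")
    case True
    then obtain s where s: "s \<in> set (basis n)" "state_vec s = unit_vec (2 ^ n) i"
      using Suc.IH by blast
    have "state_vec (Fork s (zero_state n)) = unit_vec (2 ^ Suc n) i"
      using True by (intro eq_vecI) (auto simp: s(2) state_vec_zero)
    then show ?thesis
      using s(1) by (intro bexI[of _ "Fork s (zero_state n)"]) auto
  next
    case False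
    have "i - 2 ^ n < 2 ^ n"
      using False Suc.prems by simp
    then obtain s where s: "s \<in> set (basis n)" "state_vec s = unit_vec (2 ^ n) (i - 2 ^ n)"
      using Suc.IH by blast
    have "state_vec (Fork (zero_state n) s) = unit_vec (2 ^ Suc n) i"
      using False Suc.prems by (intro eq_vecI) (auto simp: s(2) state_vec_zero)
    then show ?thesis
      using s(1) by (intro bexI[of _ "Fork (zero_state n) s"]) auto
  qed
qed

text \<open>A matrix is determined by its columns, and \<open>unit_vec_basis\<close> finds every
  unit vector among the basis states.\<close>

lemma eq_mat_on_basis:
  assumes "M \<in> carrier_mat (2 ^ n) (2 ^ n)" "N \<in> carrier_mat (2 ^ n) (2 ^ n)"
    "\<And>s. s \<in> set (basis n) \<Longrightarrow> M *\<^sub>v state_vec s = N *\<^sub>v state_vec s"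
  shows "M = N"
proof (intro eq_matI)
  fix i j assume ij: "i < dim_row N" "j < dim_col N"
  have entry: "(A *\<^sub>v unit_vec (2 ^ n) j) $ i = A $$ (i, j)" if "A \<in> carrier_mat (2 ^ n) (2 ^ n)" for A :: "complex mat"
    using that ij assms(2) by (simp add: scalar_prod_right_unit)
  obtain s where "s \<in> set (basis n)" "state_vec s = unit_vec (2 ^ n) j"
    using unit_vec_basis[of j n] ij assms(2) by auto
  then show "M $$ (i, j) = N $$ (i, j)"
    using assms(3)[of s] entry[OF assms(1)] entry[OF assms(2)] by simp
qed (use assms in auto)

lemma state_vec_sqrt2: "state_vec (state_map (cyc_sqrt2 ^^ k) s) = complex_of_real (sqrt 2) ^ k \<cdot>\<^sub>v state_vec s"
proof (rule state_vec_map)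
  show "cyc_val ((cyc_sqrt2 ^^ k) a) = complex_of_real (sqrt 2) ^ k * cyc_val a" for a
    by (induction k) (simp_all add: cyc_val_simps)
qed

text \<open>One of the two truncated differences is 0; the other power of \<open>\<surd>2\<close> compensates the factors left out of \<open>act\<close>.\<close>

definition same_op :: "nat \<Rightarrow> located_gate list \<Rightarrow> located_gate list \<Rightarrow> bool" where
  "same_op n l r \<longleftrightarrow> (let l' = elementary l; r' = elementary r; a = count_H l'; b = count_H r' in
     list_all (\<lambda>s. state_map (cyc_sqrt2 ^^ (b - a)) (run l' s) = state_map (cyc_sqrt2 ^^ (a - b)) (run r' s)) (basis n))"

lemma same_op_sound:
  assumes "same_op n l r" "\<forall>g\<in>set l. fits n g" "\<forall>g\<in>set r. fits n g"
  shows "circuit_op (on_wires n l) = circuit_op (on_wires n r)"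
proof (rule eq_mat_on_basis)
  show "circuit_op (on_wires n l) \<in> carrier_mat (2 ^ n) (2 ^ n)"
    "circuit_op (on_wires n r) \<in> carrier_mat (2 ^ n) (2 ^ n)"
    using assms(2,3) by (simp_all add: circuit_op_on_wires_carrier)
  fix s assume s: "s \<in> set (basis n)"
  define a where "a = count_H (elementary l)"
  define b where "b = count_H (elementary r)"
  let ?q = "complex_of_real (sqrt 2)"
  let ?u = "state_vec (run (elementary l) s)" and ?v = "state_vec (run (elementary r) s)"
  have "?q ^ (b - a) \<cdot>\<^sub>v ?u = ?q ^ (a - b) \<cdot>\<^sub>v ?v"
    using assms(1) s state_vec_sqrt2 unfolding same_op_def Let_def list_all_iff a_def b_def by metis
  \<comment> \<open>Scaling by the larger of the two powers leaves on each side exactly the factor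
    that \<open>run_correct\<close> attaches to it.\<close>
  then have "(1 / ?q) ^ max a b \<cdot>\<^sub>v (?q ^ (b - a) \<cdot>\<^sub>v ?u) = (1 / ?q) ^ max a b \<cdot>\<^sub>v (?q ^ (a - b) \<cdot>\<^sub>v ?v)"
    by simp
  moreover have "(1 / ?q) ^ max a b * ?q ^ (b - a) = (1 / ?q) ^ a" "(1 / ?q) ^ max a b * ?q ^ (a - b) = (1 / ?q) ^ b"
  proof -
    have cancel: "(1 / ?q) ^ (k + m) * ?q ^ m = (1 / ?q) ^ k" for k m
      by (simp add: power_add flip: power_mult_distrib)
    have "max a b = a + (b - a)" "max a b = b + (a - b)"
      by auto
    then show "(1 / ?q) ^ max a b * ?q ^ (b - a) = (1 / ?q) ^ a" "(1 / ?q) ^ max a b * ?q ^ (a - b) = (1 / ?q) ^ b"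
      using cancel by metis+
  qed
  ultimately have "(1 / ?q) ^ a \<cdot>\<^sub>v ?u = (1 / ?q) ^ b \<cdot>\<^sub>v ?v"
    by (simp add: smult_smult_assoc)
  then show "circuit_op (on_wires n l) *\<^sub>v state_vec s = circuit_op (on_wires n r) *\<^sub>v state_vec s"
    using run_correct[OF elementary_fits[OF assms(2)] is_state_basis[OF s]]
      run_correct[OF elementary_fits[OF assms(3)] is_state_basis[OF s]]
    by (simp add: circuit_op_elementary assms(2,3) a_def b_def)
qed

section \<open>Rewriting of words\<close>

text \<open>The steps are oriented: every equation, (ACE) and (BCD) included, is applied from left
  to right, and only commutations go both ways. Fitting on \<open>n\<close> wires is an invariant of
  the steps (\<open>word_step_fits\<close>) rather than a premise.\<close>

inductive word_step :: "nat \<Rightarrow> located_gate list \<Rightarrow> located_gate list \<Rightarrow> bool" for n where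
  equation: "(k, l, r) \<in> equations \<Longrightarrow> i + k \<le> n \<Longrightarrow>
    word_step n (u @ map (shift i) l @ v) (u @ map (shift i) r @ v)"
| commute: "disjoint_gates g g' \<Longrightarrow> word_step n (u @ [g, g'] @ v) (u @ [g', g] @ v)"

abbreviation derives :: "nat \<Rightarrow> located_gate list \<Rightarrow> located_gate list \<Rightarrow> bool" where
  "derives n \<equiv> (word_step n)\<^sup>*\<^sup>*"

lemma word_step_context: "word_step n w w' \<Longrightarrow> word_step n (x @ w @ y) (x @ w' @ y)"
proof (induction rule: word_step.induct)
  case (equation k l r i u v)
  then show ?case
    using word_step.equation[of k l r i n "x @ u" "v @ y"] by simp
next
  case (commute g g' u v)
  then show ?case
    using word_step.commute[of g g' n "x @ u" "v @ y"] by simp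
qed

lemma derives_context: "derives n w w' \<Longrightarrow> derives n (x @ w @ y) (x @ w' @ y)"
  by (induction rule: rtranclp_induct) (auto dest: word_step_context rtranclp.rtrancl_into_rtrancl)

lemma derives_append_left: "derives n w w' \<Longrightarrow> derives n (x @ w) (x @ w')"
  using derives_context[of n w w' x "[]"] by simp

lemma derives_append_right: "derives n w w' \<Longrightarrow> derives n (w @ y) (w' @ y)"
  using derives_context[of n w w' "[]" y] by simp

text \<open>Wires added below change neither locations nor steps. This lets the induction on wires
  use a derivation on the first \<open>m\<close> wires inside a larger circuit.\<close>

lemma derives_mono: "derives m w w' \<Longrightarrow> m \<le> n \<Longrightarrow> derives n w w'"
proof (induction rule: rtranclp_induct)
  case (step x y)
  have "word_step n x y"
    using step(2)
  proof cases
    case (equation k l r i u v)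
    then show ?thesis
      using word_step.equation[of k l r i n u v] \<open>m \<le> n\<close> by simp
  next
    case (commute g g' u v)
    then show ?thesis
      using word_step.commute by blast
  qed
  then show ?case
    using step by auto
qed simp

lemma derives_equation:
  "(k, l, r) \<in> equations \<Longrightarrow> i + k \<le> n \<Longrightarrow> derives n (map (shift i) l) (map (shift i) r)"
  using word_step.equation[of k l r i n "[]" "[]"] by auto

lemma derives_commute: "disjoint_gates g g' \<Longrightarrow> derives n [g, g'] [g', g]"
  using word_step.commute[of g g' n "[]" "[]"] by auto

lemmas equation_sets_defs = R0_def R1_def R2_def R3_def R4_def R5_def R6_def R7_def R8_def R9_def
  R10_def R11_def R12_def R13_def R14_def R15_def R16_def R17_def R18_def R19_def ACE_def BCD_def

lemma equations_fit:
  assumes "(k, l, r) \<in> equations"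
  shows "\<forall>g\<in>set l \<union> set r. fits k g"
proof -
  have "\<forall>e\<in>equations. \<forall>g\<in>set (fst (snd e)) \<union> set (snd (snd e)). fits (fst e) g"
    unfolding equations_def ball_Un
    by (intro conjI) (auto simp: equation_sets_defs phase_def fits_def)
  then show ?thesis
    using assms by fastforce
qed

lemma fits_map_shift:
  "\<forall>g\<in>set l. fits k g \<Longrightarrow> i + k \<le> n \<Longrightarrow> \<forall>g\<in>set (map (shift i) l). fits n g"
  using fits_shift by auto

lemma word_step_fits: "word_step n w w' \<Longrightarrow> \<forall>g\<in>set w. fits n g \<Longrightarrow> \<forall>g\<in>set w'. fits n g"
proof (induction rule: word_step.induct)
  case (equation k l r i u v)
  then show ?case
    using equations_fit[of k l r] fits_map_shift[of r k i n] by auto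
qed auto

lemma derives_fits: "derives n w w' \<Longrightarrow> \<forall>g\<in>set w. fits n g \<Longrightarrow> \<forall>g\<in>set w'. fits n g"
  by (induction rule: rtranclp_induct) (auto dest: word_step_fits)

section \<open>From derivations of words to conversions of circuits\<close>

lemma convertible_spatial: "c \<simeq> d \<Longrightarrow> convertible c d"
  by (auto simp: convertible_def)

lemma convertible_trans: "convertible c d \<Longrightarrow> convertible d e \<Longrightarrow> convertible c e"
  by (simp add: convertible_def)

text \<open>An equation step is cut out as a framed subcircuit between the circuits of
  \<open>u\<close> and \<open>v\<close>, the shape required by \<open>rewrite_use\<close>; a
  commutation is an instance of \<simeq>.\<close>

lemma word_step_convertible:
  assumes "word_step n w w'" "\<forall>g\<in>set w. fits n g"
  shows "convertible (on_wires n w) (on_wires n w')"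
  using assms
proof (induction rule: word_step.induct)
  case (equation k l r i u v)
  obtain j where n: "n = i + k + j"
    using equation(2) le_Suc_ex by blast
  note lr = equations_fit[OF equation(1)]
  have fits: "\<forall>g\<in>set u. fits n g" "\<forall>g\<in>set v. fits n g"
    "\<forall>g\<in>set (map (shift i) l). fits n g" "\<forall>g\<in>set (map (shift i) r). fits n g"
    using equation lr fits_map_shift[of r k i n] by auto
  have split: "on_wires n (u @ map (shift i) x @ v)
      \<simeq> Seq (on_wires n u) (Seq (framed i (on_wires k x) j) (on_wires n v))"
    if "\<forall>g\<in>set x. fits k g" for x
  proof -
    have fits_x: "\<forall>g\<in>set (map (shift i) x). fits n g"
      by (rule fits_map_shift[OF that equation(2)])
    have "on_wires n (u @ map (shift i) x @ v) \<simeq> Seq (on_wires n u) (on_wires n (map (shift i) x @ v))"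
      using fits fits_x by (intro on_wires_append) auto
    also have "\<dots> \<simeq> Seq (on_wires n u) (Seq (on_wires n (map (shift i) x)) (on_wires n v))"
      using fits by (intro seq_cong_right on_wires_append)
    also have "\<dots> \<simeq> Seq (on_wires n u) (Seq (framed i (on_wires k x) j) (on_wires n v))"
      unfolding n using that by (intro seq_cong_right seq_cong_left spatial_eq.sym[OF framed_on_wires])
    finally show ?thesis .
  qed
  have "rewrite_use (Seq (on_wires n u) (Seq (framed i (on_wires k l) j) (on_wires n v)))
      (Seq (on_wires n u) (Seq (framed i (on_wires k r) j) (on_wires n v)))"
    using equation(1) fits is_circuit_on_wires n by (intro rewrite_use.intros) auto
  then have "convertible (Seq (on_wires n u) (Seq (framed i (on_wires k l) j) (on_wires n v)))
      (Seq (on_wires n u) (Seq (framed i (on_wires k r) j) (on_wires n v)))"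
    by (auto simp: convertible_def)
  then show ?case
    using lr by (meson split spatial_eq.sym convertible_spatial convertible_trans UnCI)
next
  case (commute g g' u v)
  have fits: "\<forall>x\<in>set v. fits n x" "fits n g" "fits n g'"
    using commute by auto
  have split: "on_wires n (u @ [a, b] @ v) \<simeq> Seq (on_wires n u) (Seq (Seq (place n a) (place n b)) (on_wires n v))"
    if "fits n a" "fits n b" for a b
  proof -
    have "on_wires n (u @ [a, b] @ v) \<simeq> Seq (on_wires n u) (on_wires n ([a, b] @ v))"
      using fits that by (intro on_wires_append) auto
    also have "\<dots> \<simeq> Seq (on_wires n u) (Seq (Seq (place n a) (place n b)) (on_wires n v))"
      by (simp add: on_wires_Cons seq_cong_right spatial_eq.sym[OF spatial_eq.seq_assoc])
    finally show ?thesis .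
  qed
  have "on_wires n (u @ [g, g'] @ v) \<simeq> Seq (on_wires n u) (Seq (Seq (place n g) (place n g')) (on_wires n v))"
    using fits by (intro split)
  also have "\<dots> \<simeq> Seq (on_wires n u) (Seq (Seq (place n g') (place n g)) (on_wires n v))"
    using fits commute by (intro seq_cong_left seq_cong_right place_commute)
  also have "\<dots> \<simeq> on_wires n (u @ [g', g] @ v)"
    using fits by (intro spatial_eq.sym[OF split])
  finally show ?case
    by (rule convertible_spatial)
qed

lemma derives_convertible:
  assumes "derives n w w'" "\<forall>g\<in>set w. fits n g"
  shows "convertible (on_wires n w) (on_wires n w')"
  using assms
proof (induction rule: rtranclp_induct)
  case base
  then show ?case
    by (simp add: convertible_def)
next
  case (step x y)
  then show ?case
    using word_step_convertible derives_fits convertible_trans by meson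
qed

text \<open>Lifts the absorption of one gate by the words of \<open>K\<close> to a word
  \<open>v\<close> of gates. The last gate is absorbed first; the remainder of an earlier gate comes
  out between the new word of \<open>K\<close> and the remainder collected so far, hence
  \<open>w' @ w\<close>.\<close>

lemma absorb_word:
  assumes "\<And>g k. g \<in> I \<Longrightarrow> fits n g \<Longrightarrow> k \<in> K \<Longrightarrow>
      \<exists>k'\<in>K. \<exists>w. set w \<subseteq> J \<and> derives n (g # k) (k' @ w)"
    and "\<And>k. k \<in> K \<Longrightarrow> \<forall>g\<in>set k. fits n g"
    and "set v \<subseteq> I" "\<forall>g\<in>set v. fits n g" "k \<in> K"
  shows "\<exists>k'\<in>K. \<exists>w. set w \<subseteq> J \<and> (\<forall>g\<in>set w. fits n g) \<and> derives n (v @ k) (k' @ w)"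
  using assms(3,4)
proof (induction v)
  case Nil
  then show ?case
    using assms(5) by (intro bexI[of _ k] exI[of _ "[]"]) auto
next
  case (Cons g v)
  then obtain k' w where k': "k' \<in> K" "set w \<subseteq> J" "\<forall>g\<in>set w. fits n g" "derives n (v @ k) (k' @ w)"
    by auto
  obtain k'' w' where k'': "k'' \<in> K" "set w' \<subseteq> J" "derives n (g # k') (k'' @ w')"
    using assms(1)[of g k'] Cons.prems k'(1) by auto
  have "\<forall>h\<in>set (k'' @ w'). fits n h"
    using derives_fits[OF k''(3)] Cons.prems assms(2)[OF k'(1)] by auto
  moreover have "derives n ((g # v) @ k) (k'' @ w' @ w)"
    using derives_append_left[OF k'(4), of "[g]"] derives_append_right[OF k''(3), of w] by simp
  ultimately show ?case
    using k' k'' by (intro bexI[of _ k''] exI[of _ "w' @ w"]) auto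
qed

text \<open>One equation replaces the head \<open>u\<close> by \<open>u'\<close> and leaves
  \<open>w\<close> between it and the tail \<open>k\<close>; \<open>w\<close> is then absorbed by
  \<open>k\<close>, and only what comes out behind the tail remains.\<close>

lemma absorb_compose:
  assumes "derives n u (u' @ w)" "\<forall>g\<in>set u. fits n g" "set w \<subseteq> I"
    and "\<And>v. set v \<subseteq> I \<Longrightarrow> \<forall>g\<in>set v. fits n g \<Longrightarrow> \<exists>k'\<in>K. \<exists>w. set w \<subseteq> J \<and> derives n (v @ k) (k' @ w)"
  shows "\<exists>k'\<in>K. \<exists>w. set w \<subseteq> J \<and> derives n (u @ k) (u' @ k' @ w)"
proof -
  have "\<forall>g\<in>set w. fits n g"
    using derives_fits[OF assms(1,2)] by auto
  then obtain k' w' where k': "k' \<in> K" "set w' \<subseteq> J" "derives n (w @ k) (k' @ w')"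
    using assms(3,4) by meson
  have "derives n (u @ k) (u' @ w @ k)"
    using derives_append_right[OF assms(1), of k] by simp
  also have "derives n (u' @ w @ k) (u' @ k' @ w')"
    by (rule derives_append_left[OF k'(3)])
  finally show ?thesis
    using k' by blast
qed

section \<open>Gate sets met in front of and behind normal words\<close>

definition gens :: "gate set" where "gens = {H, S, Zc}"

text \<open>These gates keep Z on wire \<open>q\<close> up to sign under conjugation:
  \<open>S\<close> and \<open>Zc\<close> keep it, \<open>X\<close> flips its sign, and the gates
  further down do not touch it. \<open>H\<close> on wire \<open>q\<close> would turn it into
  X.\<close>

definition front :: "nat \<Rightarrow> located_gate set" where
  "front q = {(Omega, 1), (S, q), (X, q), (Zc, q)} \<union> {(g, p). g \<in> gens \<and> q < p}"

definition behind :: "nat \<Rightarrow> located_gate set" where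
  "behind q = {(g, p). g \<in> gens \<and> p + arity g \<le> q}"

text \<open>This is \<open>front 1\<close> without \<open>X\<close>: by (R10) the final
  \<open>C\<close> swallows every \<open>X\<close>, and with it the sign.\<close>

definition past_Z :: "located_gate set" where
  "past_Z = {(Omega, 1), (S, 1), (Zc, 1)} \<union> {(g, p). g \<in> gens \<and> 1 < p}"

lemma shift_front: "g \<in> front 1 \<Longrightarrow> shift i g \<in> front (i + 1)"
  by (auto simp: front_def shift_def gens_def)

text \<open>The part of a \<open>Z\<close>-normal word behind its \<open>A\<close>. The first
  \<open>B\<close> is the lowest one, so the recursion that removes it moves up one wire.\<close>

primrec B_chains :: "nat \<Rightarrow> located_gate list set" where
  "B_chains 0 = {[(C1, 1)], [(C2, 1)]}"
| "B_chains (Suc q) = {(b, Suc q) # t | b t. b \<in> {B1, B2, B3, B4} \<and> t \<in> B_chains q}"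

lemma B_chains_fit: "t \<in> B_chains q \<Longrightarrow> q < n \<Longrightarrow> \<forall>g\<in>set t. fits n g"
proof (induction q arbitrary: t)
  case (Suc q)
  then obtain b t' where "t = (b, Suc q) # t'" "b \<in> {B1, B2, B3, B4}" "t' \<in> B_chains q"
    by auto
  moreover have "\<forall>g\<in>set t'. fits n g"
    using Suc calculation by simp
  moreover have "fits n (b, Suc q)"
    using Suc.prems calculation by (auto simp: fits_def)
  ultimately show ?case
    by simp
qed (auto simp: fits_def)

section \<open>Pushing gates through normal forms\<close>

lemma equations_1: "e \<in> R1 \<union> R2 \<union> R10 \<union> R11 \<union> R18 \<union> ACE \<Longrightarrow> (1, e) \<in> equations"
  and equations_2: "e \<in> R3 \<union> R4 \<union> R5 \<union> R6 \<union> R7 \<union> R8 \<union> R12 \<union> R14 \<union> R15 \<union> R16 \<union> R17 \<union> BCD \<Longrightarrow> (2, e) \<in> equations"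
  and equations_3: "e \<in> R9 \<union> R13 \<union> R19 \<Longrightarrow> (3, e) \<in> equations"
  by (simp_all add: equations_def)

text \<open>This lemma and the similar ones below are finite inspections of the listed equations:
  for each left-hand side the right-hand side is found in the set, and what follows its normal-form
  gates is checked to stay in the named set of gates.\<close>

lemma equation_C:
  assumes "g \<in> {(S, 1), (X, 1)}" "c \<in> {C1, C2}"
  shows "\<exists>c'\<in>{C1, C2}. \<exists>w. set w \<subseteq> past_Z \<and> ([g, (c, 1)], (c', 1) # w) \<in> R10 \<union> R11"
  using assms
  by (elim insertE; simp add: R10_def R11_def phase_def past_Z_def numeral_eq_Suc)

lemma equation_ZC:
  assumes "c \<in> {C1, C2}"
  shows "\<exists>c'\<in>{C1, C2}. \<exists>w. set w \<subseteq> past_Z \<and> ([(Zc, 1), (c, 1)], (c', 1) # w) \<in> R12"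
  using assms
  by (elim insertE; simp add: R12_def past_Z_def gens_def)

lemma equation_B:
  assumes "g \<in> {(S, 1), (H, 1), (S, 2), (X, 2)}" "b \<in> {B1, B2, B3, B4}"
  shows "\<exists>b'\<in>{B1, B2, B3, B4}. \<exists>w. set w \<subseteq> front 1 \<and>
    ([g, (b, 1)], (b', 1) # w) \<in> R5 \<union> R6 \<union> R7 \<union> R8"
  using assms
  by (elim insertE; simp add: R5_def R6_def R7_def R8_def front_def gens_def)

lemma equation_ZB:
  assumes "b \<in> {B1, B2, B3, B4}"
  shows "\<exists>b'\<in>{B1, B2, B3, B4}. \<exists>w. set w \<subseteq> front 1 \<and> ([(Zc, 2), (b, 1)], (b', 1) # w) \<in> R9"
  using assms
  by (elim insertE; simp add: R9_def front_def gens_def)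

lemma equation_BB:
  assumes "b \<in> {B1, B2, B3, B4}" "b' \<in> {B1, B2, B3, B4}"
  shows "\<exists>b1\<in>{B1, B2, B3, B4}. \<exists>b2\<in>{B1, B2, B3, B4}. \<exists>w. set w \<subseteq> front 1 \<and>
    ([(Zc, 1), (b, 2), (b', 1)], [(b1, 2), (b2, 1)] @ w) \<in> R13"
  using assms
  by (elim insertE; simp add: R13_def phase_def front_def gens_def)

lemma equation_A:
  assumes "g \<in> {(S, 1), (H, 1)}" "a \<in> {A1, A2, A3}"
  shows "\<exists>a'\<in>{A1, A2, A3}. \<exists>w. set w \<subseteq> front 1 \<and> ([g, (a, 1)], (a', 1) # w) \<in> R1 \<union> R2"
  using assms
  by (elim insertE; simp add: R1_def R2_def phase_def front_def gens_def)

text \<open>(R3) can move the \<open>A\<close> one wire down and create a \<open>B\<close> behind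
  it, because \<open>Zc\<close> can extend the support of the Pauli operator of the word to the next
  wire. The chain then grows by one.\<close>

lemma equation_ZA:
  assumes "a \<in> {A1, A2, A3}"
  shows "\<exists>a'\<in>{A1, A2, A3}. \<exists>w. set w \<subseteq> front 1 \<and>
    (([(Zc, 1), (a, 1)], (a', 1) # w) \<in> R3 \<or>
     (\<exists>b\<in>{B1, B2, B3, B4}. ([(Zc, 1), (a, 1)], [(a', 2), (b, 1)] @ w) \<in> R3))"
  using assms
  by (elim insertE; simp add: R3_def front_def gens_def)

text \<open>The converse effect: for \<open>A1\<close> with \<open>B2\<close> or \<open>B3\<close>,
  (R4) removes the \<open>B\<close>, since \<open>Zc\<close> makes the Pauli operator trivial on the
  lower wire.\<close>

lemma equation_ZAB:
  assumes "a \<in> {A1, A2, A3}" "b \<in> {B1, B2, B3, B4}"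
  shows "\<exists>a'\<in>{A1, A2, A3}. \<exists>w. set w \<subseteq> front 1 \<and>
    (([(Zc, 1), (a, 2), (b, 1)], (a', 1) # w) \<in> R4 \<or>
     (\<exists>b'\<in>{B1, B2, B3, B4}. ([(Zc, 1), (a, 2), (b, 1)], [(a', 2), (b', 1)] @ w) \<in> R4))"
  using assms
  by (elim insertE; simp add: R4_def phase_def front_def gens_def)

text \<open>The gates that may stand between \<open>D\<^sub>\<ell>\<close> on wires \<open>q - 1, q\<close> and the rest of an \<open>X\<close>-normal word:
  those in \<open>behind q\<close> act only on wires above \<open>q\<close> and leave the level.\<close>

definition past_D :: "nat \<Rightarrow> located_gate set" where
  "past_D q = {(Omega, 1), (S, q), (Zc, q)} \<union> {(g, p). g \<in> gens \<and> q < p} \<union> behind q"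

lemma shift_past_D: "g \<in> past_D q \<Longrightarrow> shift i g \<in> past_D (i + q)"
  by (auto simp: past_D_def behind_def shift_def gens_def)

text \<open>The left-hand sides cover the gates of \<open>past_D 1\<close> that lie inside the two
  wires of the \<open>D\<close>: on its upper wire only \<open>S\<close> and \<open>Zc\<close> can
  start, never \<open>H\<close>.\<close>

lemma equation_D:
  assumes "g \<in> {(S, 1), (Zc, 1), (S, 2), (H, 2)}" "d \<in> {D1, D2, D3, D4}"
  shows "\<exists>d'\<in>{D1, D2, D3, D4}. \<exists>w. set w \<subseteq> past_D 2 \<and>
    ([g, (d, 1)], (d', 1) # w) \<in> R14 \<union> R15 \<union> R16 \<union> R17"
  using assms
  by (elim insertE; simp add: R14_def R15_def R16_def R17_def past_D_def behind_def gens_def)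

text \<open>\<open>Zc\<close> on wires 2 and 3 overlaps the first \<open>D\<close> in wire 2 alone,
  so the second \<open>D\<close> has to take part.\<close>

lemma equation_DD:
  assumes "d \<in> {D1, D2, D3, D4}" "d' \<in> {D1, D2, D3, D4}"
  shows "\<exists>d1\<in>{D1, D2, D3, D4}. \<exists>d2\<in>{D1, D2, D3, D4}. \<exists>w. set w \<subseteq> past_D 3 \<and>
    ([(Zc, 2), (d, 1), (d', 2)], [(d1, 1), (d2, 2)] @ w) \<in> R19"
  using assms
  by (elim insertE; simp add: R19_def phase_def past_D_def behind_def gens_def)

lemma equation_E:
  assumes "e \<in> {E1, E2, E3, E4}"
  shows "\<exists>e'\<in>{E1, E2, E3, E4}. ([(S, 1), (e, 1)], [(e', 1)]) \<in> R18"
  using assms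
  by (elim insertE; simp add: R18_def)

text \<open>The gates that may stand in front of a chain of \<open>B\<close>s whose first gate has \<open>q\<close> as its lower wire.\<close>

definition chain_gates :: "nat \<Rightarrow> located_gate set" where
  "chain_gates q = front q \<union> behind q"

section \<open>Pushing gates through a Z-normal word\<close>

lemmas derives_equation_1 = derives_equation[OF equations_1]
  and derives_equation_2 = derives_equation[OF equations_2]
  and derives_equation_3 = derives_equation[OF equations_3]

lemma shift_gate: "a \<noteq> Omega \<Longrightarrow> shift i (a, p) = (a, p + i)"
  by (simp add: shift_def)

text \<open>Of the gates meeting the wires \<open>q + 1\<close>, \<open>q + 2\<close> of the
  \<open>B\<close>, neither \<open>H\<close> on the lower wire nor \<open>Zc\<close> on exactly
  these two belongs to \<open>chain_gates (q + 2)\<close>; for these, (R5) to (R9) have no left-hand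
  side. \<open>(Zc, q)\<close> is singled out because it reaches past this \<open>B\<close> to the
  next one.\<close>

lemma chain_gate_before_B:
  assumes "g \<in> chain_gates (q + 2)" "arity b = 2"
  shows "disjoint_gates g (b, Suc q) \<and> g \<in> chain_gates (Suc q)
    \<or> g \<in> {(S, Suc q), (H, Suc q), (S, q + 2), (X, q + 2)} \<or> g = (Zc, q + 2) \<or> g = (Zc, q)"
proof -
  consider "g = (Omega, 1)" | "g \<in> {(S, q + 2), (X, q + 2), (Zc, q + 2)}"
    | "fst g \<in> gens" "q + 2 < snd g" | "fst g \<in> gens" "snd g + arity (fst g) \<le> Suc q"
    | "fst g \<in> gens" "snd g + arity (fst g) = q + 2"
    using assms(1) unfolding chain_gates_def front_def behind_def by fastforce
  then show ?thesis
  proof cases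
    case 1
    then show ?thesis
      by (simp add: disjoint_gates_def chain_gates_def front_def)
  next
    case 2
    then show ?thesis
      by blast
  next
    case 3
    then show ?thesis
      by (cases g) (simp add: assms(2) disjoint_gates_def chain_gates_def front_def)
  next
    case 4
    then show ?thesis
      by (cases g) (simp add: disjoint_gates_def chain_gates_def behind_def)
  next
    case 5
    then show ?thesis
      by (cases g) (auto simp: gens_def)
  qed
qed

lemma B_absorb:
  assumes "g \<in> chain_gates (q + 2)" "g \<noteq> (Zc, q)" "fits n g" "b \<in> {B1, B2, B3, B4}" "q + 2 \<le> n"
  shows "\<exists>b'\<in>{B1, B2, B3, B4}. \<exists>w. set w \<subseteq> chain_gates (Suc q) \<and>
    derives n [g, (b, Suc q)] ([(b', Suc q)] @ w)"
proof -
  have b: "arity b = 2" "b \<noteq> Omega"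
    using assms(4) by auto
  consider (commute) "disjoint_gates g (b, Suc q)" "g \<in> chain_gates (Suc q)"
    | (two) g' where "g' \<in> {(S, 1), (H, 1), (S, 2), (X, 2)}" "g = shift q g'"
    | (three) "g = (Zc, q + 2)"
  proof -
    have "disjoint_gates g (b, Suc q) \<and> g \<in> chain_gates (Suc q)
        \<or> (\<exists>g'\<in>{(S, 1), (H, 1), (S, 2), (X, 2)}. g = shift q g') \<or> g = (Zc, q + 2)"
      using chain_gate_before_B[OF assms(1) b(1)] assms(2) by (auto simp: shift_gate)
    then show thesis
      using that by blast
  qed
  then show ?thesis
  proof cases
    case commute
    then show ?thesis
      using assms(4) by (intro bexI[of _ b] exI[of _ "[g]"]) (auto intro: derives_commute)
  next
    case two
    obtain b' w where b': "b' \<in> {B1, B2, B3, B4}" "set w \<subseteq> front 1"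
      "([g', (b, 1)], (b', 1) # w) \<in> R5 \<union> R6 \<union> R7 \<union> R8"
      using equation_B[OF two(1) assms(4)] by blast
    have "derives n (map (shift q) [g', (b, 1)]) (map (shift q) ((b', 1) # w))"
      using b'(3) assms(5) by (intro derives_equation_2) auto
    moreover have "set (map (shift q) w) \<subseteq> chain_gates (Suc q)"
      using b'(2) shift_front[of _ q] by (auto simp: chain_gates_def)
    ultimately show ?thesis
      using b' b two by (intro bexI[of _ b'] exI[of _ "map (shift q) w"]) (auto simp: shift_gate)
  next
    case three
    obtain b' w where b': "b' \<in> {B1, B2, B3, B4}" "set w \<subseteq> front 1"
      "([(Zc, 2), (b, 1)], (b', 1) # w) \<in> R9"
      using equation_ZB[OF assms(4)] by blast
    have "derives n (map (shift q) [(Zc, 2), (b, 1)]) (map (shift q) ((b', 1) # w))"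
      using b'(3) assms(3) three by (intro derives_equation_3) (auto simp: fits_def)
    moreover have "set (map (shift q) w) \<subseteq> chain_gates (Suc q)"
      using b'(2) shift_front[of _ q] by (auto simp: chain_gates_def)
    ultimately show ?thesis
      using b' b three by (intro bexI[of _ b'] exI[of _ "map (shift q) w"]) (auto simp: shift_gate)
  qed
qed

lemma BB_absorb:
  assumes "b \<in> {B1, B2, B3, B4}" "b' \<in> {B1, B2, B3, B4}" "q + 3 \<le> n"
  shows "\<exists>b1\<in>{B1, B2, B3, B4}. \<exists>b2\<in>{B1, B2, B3, B4}. \<exists>w. set w \<subseteq> chain_gates (Suc q) \<and>
    derives n [(Zc, Suc q), (b, Suc (Suc q)), (b', Suc q)] ([(b1, Suc (Suc q)), (b2, Suc q)] @ w)"
proof -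
  obtain b1 b2 w where w: "b1 \<in> {B1, B2, B3, B4}" "b2 \<in> {B1, B2, B3, B4}" "set w \<subseteq> front 1"
    "([(Zc, 1), (b, 2), (b', 1)], [(b1, 2), (b2, 1)] @ w) \<in> R13"
    using equation_BB[OF assms(1,2)] by blast
  have "derives n (map (shift q) [(Zc, 1), (b, 2), (b', 1)]) (map (shift q) ([(b1, 2), (b2, 1)] @ w))"
    using w(4) assms(3) by (intro derives_equation_3) auto
  moreover have "set (map (shift q) w) \<subseteq> chain_gates (Suc q)"
    using w(3) shift_front[of _ q] by (auto simp: chain_gates_def)
  moreover have "b1 \<noteq> Omega" "b2 \<noteq> Omega" "b \<noteq> Omega" "b' \<noteq> Omega"
    using w assms by auto
  ultimately show ?thesis
    using w by (intro bexI[of _ b1] bexI[of _ b2] exI[of _ "map (shift q) w"]) (auto simp: shift_gate)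
qed

lemma C_absorb:
  assumes "g \<in> chain_gates 1" "fits n g" "c \<in> {C1, C2}"
  shows "\<exists>c'\<in>{C1, C2}. \<exists>w. set w \<subseteq> past_Z \<and> derives n [g, (c, 1)] ((c', 1) # w)"
proof -
  \<comment> \<open>A gate of \<open>behind 1\<close> would have location 0, which
    \<open>fits\<close> excludes.\<close>
  consider (commute) "disjoint_gates g (c, 1)" "g \<in> past_Z"
    | (one) "g \<in> {(S, 1), (X, 1)}" | (two) "g = (Zc, 1)"
    using assms
    by (cases g) (auto simp: fits_def chain_gates_def front_def behind_def gens_def disjoint_gates_def past_Z_def split: if_splits)
  then show ?thesis
  proof cases
    case commute
    then show ?thesis
      using assms(3) by (intro bexI[of _ c] exI[of _ "[g]"]) (auto intro: derives_commute)
  next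
    case one
    obtain c' w where c': "c' \<in> {C1, C2}" "set w \<subseteq> past_Z" "([g, (c, 1)], (c', 1) # w) \<in> R10 \<union> R11"
      using equation_C[OF one assms(3)] by blast
    have "derives n (map (shift 0) [g, (c, 1)]) (map (shift 0) ((c', 1) # w))"
      using c'(3) assms(2) one by (intro derives_equation_1) (auto simp: fits_def)
    moreover have "map (shift 0) w = w"
      using c'(2) by (intro map_idI) (auto simp: shift_def past_Z_def gens_def)
    ultimately show ?thesis
      using c' one assms by (intro bexI[of _ c'] exI[of _ w]) (auto simp: shift_def)
  next
    case two
    obtain c' w where c': "c' \<in> {C1, C2}" "set w \<subseteq> past_Z" "([(Zc, 1), (c, 1)], (c', 1) # w) \<in> R12"
      using equation_ZC[OF assms(3)] by blast
    have "derives n (map (shift 0) [(Zc, 1), (c, 1)]) (map (shift 0) ((c', 1) # w))"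
      using c'(3) assms(2) two by (intro derives_equation_2) (auto simp: fits_def)
    moreover have "map (shift 0) w = w"
      using c'(2) by (intro map_idI) (auto simp: shift_def past_Z_def gens_def)
    ultimately show ?thesis
      using c' two assms by (intro bexI[of _ c'] exI[of _ w]) (auto simp: shift_def)
  qed
qed

text \<open>Strong induction on the length, because \<open>(Zc, p)\<close> engages two
  \<open>B\<close>s at once through (R13), and its remainder then meets a chain shorter by
  two.\<close>

lemma B_chains_absorb:
  assumes "t \<in> B_chains q" "q < n" "set v \<subseteq> chain_gates (Suc q)" "\<forall>g\<in>set v. fits n g"
  shows "\<exists>t'\<in>B_chains q. \<exists>w. set w \<subseteq> past_Z \<and> derives n (v @ t) (t' @ w)"
  using assms
proof (induction q arbitrary: t v rule: less_induct)
  case (less q)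
  have single: "\<exists>t'\<in>B_chains q. \<exists>w. set w \<subseteq> past_Z \<and> derives n (g # t) (t' @ w)"
    if g: "g \<in> chain_gates (Suc q)" "fits n g" and t: "t \<in> B_chains q" for g t
  proof (cases q)
    case 0
    then obtain c where c: "c \<in> {C1, C2}" "t = [(c, 1)]"
      using t by auto
    have "g \<in> chain_gates 1"
      using g 0 by simp
    then show ?thesis
      using C_absorb[of g n c] g(2) c 0 by auto
  next
    case (Suc p)
    then obtain b s where b: "b \<in> {B1, B2, B3, B4}" "t = (b, Suc p) # s" "s \<in> B_chains p"
      using t by auto
    have fits_t: "\<forall>g\<in>set t. fits n g"
      using B_chains_fit[OF t less.prems(2)] .
    show ?thesis
    proof (cases "g = (Zc, p)")
      case False
      obtain b' w where w: "b' \<in> {B1, B2, B3, B4}" "set w \<subseteq> chain_gates (Suc p)"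
        "derives n [g, (b, Suc p)] ([(b', Suc p)] @ w)"
        using B_absorb[of g p n b] g Suc False b less.prems(2) by auto
      have "\<exists>k'\<in>B_chains p. \<exists>w. set w \<subseteq> past_Z \<and> derives n ([g, (b, Suc p)] @ s) ([(b', Suc p)] @ k' @ w)"
      proof (rule absorb_compose[OF w(3) _ w(2)])
        show "\<forall>h\<in>set [g, (b, Suc p)]. fits n h"
          using g(2) fits_t b(2) by simp
        show "\<exists>k'\<in>B_chains p. \<exists>w. set w \<subseteq> past_Z \<and> derives n (v @ s) (k' @ w)"
          if "set v \<subseteq> chain_gates (Suc p)" "\<forall>h\<in>set v. fits n h" for v
          using less.IH[OF _ b(3) _ that] Suc less.prems(2) by simp
      qed
      then obtain k' w' where "k' \<in> B_chains p" "set w' \<subseteq> past_Z"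
          "derives n (g # t) (((b', Suc p) # k') @ w')"
        using b(2) by auto
      then show ?thesis
        using w(1) Suc by (intro bexI[of _ "(b', Suc p) # k'"]) auto
    next
      case True
      \<comment> \<open>Locations start at 1, so \<open>p\<close> is positive and the chain has a
        second \<open>B\<close>.\<close>
      then obtain p' where p': "p = Suc p'"
        using g(2) by (cases p) (auto simp: fits_def)
      then obtain b' s' where b': "b' \<in> {B1, B2, B3, B4}" "s = (b', Suc p') # s'" "s' \<in> B_chains p'"
        using b by auto
      obtain b1 b2 w where w: "b1 \<in> {B1, B2, B3, B4}" "b2 \<in> {B1, B2, B3, B4}" "set w \<subseteq> chain_gates (Suc p')"
        "derives n [(Zc, Suc p'), (b, Suc (Suc p')), (b', Suc p')] ([(b1, Suc (Suc p')), (b2, Suc p')] @ w)"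
        using BB_absorb[OF b(1) b'(1), of p' n] less.prems(2) Suc p' by auto
      have "\<exists>k'\<in>B_chains p'. \<exists>w. set w \<subseteq> past_Z \<and>
          derives n ([(Zc, Suc p'), (b, Suc (Suc p')), (b', Suc p')] @ s') ([(b1, Suc (Suc p')), (b2, Suc p')] @ k' @ w)"
      proof (rule absorb_compose[OF w(4) _ w(3)])
        show "\<forall>h\<in>set [(Zc, Suc p'), (b, Suc (Suc p')), (b', Suc p')]. fits n h"
          using g(2) fits_t b(2) b'(2) True p' by simp
        show "\<exists>k'\<in>B_chains p'. \<exists>w. set w \<subseteq> past_Z \<and> derives n (v @ s') (k' @ w)"
          if "set v \<subseteq> chain_gates (Suc p')" "\<forall>h\<in>set v. fits n h" for v
          using less.IH[OF _ b'(3) _ that] Suc p' less.prems(2) by simp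
      qed
      then obtain k' w' where "k' \<in> B_chains p'" "set w' \<subseteq> past_Z"
          "derives n (g # t) (((b1, Suc (Suc p')) # (b2, Suc p') # k') @ w')"
        using True p' b b' by auto
      then show ?thesis
        using w Suc p' by (intro bexI[of _ "(b1, Suc (Suc p')) # (b2, Suc p') # k'"]) auto
    qed
  qed
  show ?case
    using absorb_word[OF single B_chains_fit[OF _ less.prems(2)] less.prems(3,4,1)] by blast
qed

definition Z_words :: "nat \<Rightarrow> located_gate list set" where
  "Z_words r = {(a, Suc m) # t | a m t. a \<in> {A1, A2, A3} \<and> m < r \<and> t \<in> B_chains m}"

lemma Z_wordsI: "a \<in> {A1, A2, A3} \<Longrightarrow> m < r \<Longrightarrow> t \<in> B_chains m \<Longrightarrow> (a, Suc m) # t \<in> Z_words r"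
  by (auto simp: Z_words_def)

lemma Z_words_fit: "k \<in> Z_words r \<Longrightarrow> \<forall>g\<in>set k. fits r g"
proof -
  assume "k \<in> Z_words r"
  then obtain a m t where "k = (a, Suc m) # t" "a \<in> {A1, A2, A3}" "m < r" "t \<in> B_chains m"
    by (auto simp: Z_words_def)
  then show ?thesis
    using B_chains_fit[of t m r] by (auto simp: fits_def)
qed

definition generators :: "located_gate set" where
  "generators = insert (Omega, 1) {(g, p). g \<in> gens}"

text \<open>\<open>Zc\<close> can overlap the wire of the \<open>A\<close> in two ways: starting on
  it, where (R3) applies, or ending on it, where the first \<open>B\<close> takes part through
  (R4).\<close>

lemma generator_before_A:
  assumes "g \<in> generators" "arity a = 1"
  shows "disjoint_gates g (a, Suc m) \<and> g \<in> chain_gates (Suc m)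
    \<or> g = (S, Suc m) \<or> g = (H, Suc m) \<or> g = (Zc, Suc m) \<or> g = (Zc, m)"
proof (cases "g = (Omega, 1)")
  case True
  then show ?thesis
    by (simp add: disjoint_gates_def chain_gates_def front_def)
next
  case False
  then obtain b p where g: "g = (b, p)" "b \<in> gens"
    using assms(1) by (auto simp: generators_def)
  consider "Suc m < p" | "p = Suc m" | "p + arity b \<le> Suc m" | "p < Suc m" "Suc m < p + arity b"
    by linarith
  then show ?thesis
  proof cases
    case 1
    then show ?thesis
      using g by (simp add: assms(2) disjoint_gates_def chain_gates_def front_def)
  next
    case 2
    then show ?thesis
      using g by (auto simp: gens_def)
  next
    case 3
    then show ?thesis
      using g by (simp add: disjoint_gates_def chain_gates_def behind_def)
  next
    case 4
    then show ?thesis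
      using g by (auto simp: gens_def)
  qed
qed

lemma Z_words_absorb_gate:
  assumes g: "g \<in> generators" "fits r g" and k: "k \<in> Z_words r"
  shows "\<exists>k'\<in>Z_words r. \<exists>w. set w \<subseteq> past_Z \<and> derives r (g # k) (k' @ w)"
proof -
  obtain a m t where a: "a \<in> {A1, A2, A3}" and m: "m < r" and t: "t \<in> B_chains m" and k_eq: "k = (a, Suc m) # t"
    using k by (auto simp: Z_words_def)
  have fit_k: "\<forall>h\<in>set (g # k). fits r h"
    using Z_words_fit[OF k] g(2) by simp
  have a_arity: "arity a = 1" "a \<noteq> Omega"
    using a by auto
  \<comment> \<open>The prefix \<open>u\<close> of \<open>g # k\<close> is what an equation
    consumes, and \<open>u'\<close> replaces it. The rest \<open>s\<close> is a chain with its own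
    length \<open>i\<close>, since it has lost the first \<open>B\<close> whenever (R4) is
    used.\<close>
  have finish: "\<exists>k'\<in>Z_words r. \<exists>w. set w \<subseteq> past_Z \<and> derives r (g # k) (k' @ w)"
    if u: "derives r u (u' @ w)" "set w \<subseteq> chain_gates (Suc i)" "s \<in> B_chains i" "i < r" "g # k = u @ s"
      "\<And>s'. s' \<in> B_chains i \<Longrightarrow> u' @ s' \<in> Z_words r" for u u' w s i
  proof -
    have "\<exists>s'\<in>B_chains i. \<exists>w. set w \<subseteq> past_Z \<and> derives r (u @ s) (u' @ s' @ w)"
    proof (rule absorb_compose[OF u(1) _ u(2)])
      show "\<forall>h\<in>set u. fits r h"
        using fit_k[unfolded u(5)] by simp
      show "\<exists>k'\<in>B_chains i. \<exists>w. set w \<subseteq> past_Z \<and> derives r (v @ s) (k' @ w)"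
        if "set v \<subseteq> chain_gates (Suc i)" "\<forall>h\<in>set v. fits r h" for v
        using B_chains_absorb[OF u(3,4) that] .
    qed
    then obtain s' w' where s': "s' \<in> B_chains i" "set w' \<subseteq> past_Z" "derives r (u @ s) ((u' @ s') @ w')"
      by auto
    then show ?thesis
      using u(5) u(6)[OF s'(1)] by metis
  qed
  consider (commute) "disjoint_gates g (a, Suc m)" "g \<in> chain_gates (Suc m)"
    | (one) g' where "g' \<in> {(S, 1), (H, 1)}" "g = shift m g'"
    | (up) "g = (Zc, Suc m)" | (down) i where "g = (Zc, m)" "m = Suc i"
  proof -
    \<comment> \<open>For \<open>m = 0\<close> the last alternative of
      \<open>generator_before_A\<close> would put \<open>Zc\<close> at location 0; excluding it
      guarantees a \<open>B\<close> for (R4).\<close>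
    have "g \<noteq> (Zc, 0)"
      using g(2) by (auto simp: fits_def)
    then have "disjoint_gates g (a, Suc m) \<and> g \<in> chain_gates (Suc m)
        \<or> (\<exists>g'\<in>{(S, 1), (H, 1)}. g = shift m g') \<or> g = (Zc, Suc m) \<or> g = (Zc, m) \<and> m \<noteq> 0"
      using generator_before_A[OF g(1) a_arity(1), of m] by (auto simp: shift_gate)
    then show thesis
      using that by (meson not0_implies_Suc)
  qed
  then show ?thesis
  proof cases
    case commute
    show ?thesis
      using commute a m t k_eq
      by (intro finish[of "[g, (a, Suc m)]" "[(a, Suc m)]" "[g]" m t]) (auto intro: derives_commute Z_wordsI)
  next
    case one
    obtain a' w where w: "a' \<in> {A1, A2, A3}" "set w \<subseteq> front 1" "([g', (a, 1)], (a', 1) # w) \<in> R1 \<union> R2"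
      using equation_A[OF one(1) a] by blast
    have "derives r (map (shift m) [g', (a, 1)]) (map (shift m) ((a', 1) # w))"
      using w(3) m by (intro derives_equation_1) auto
    moreover have "a' \<noteq> Omega"
      using w(1) by auto
    ultimately have "derives r [g, (a, Suc m)] ([(a', Suc m)] @ map (shift m) w)"
      using one(2) a_arity by (auto simp: shift_gate)
    moreover have "set (map (shift m) w) \<subseteq> chain_gates (Suc m)"
      using w(2) shift_front[of _ m] by (auto simp: chain_gates_def)
    ultimately show ?thesis
      using t m k_eq w(1) by (elim finish) (auto intro: Z_wordsI)
  next
    case up
    have r: "m + 2 \<le> r"
      using g(2) up by (simp add: fits_def)
    obtain a' w where w: "a' \<in> {A1, A2, A3}" "set w \<subseteq> front 1"
      "([(Zc, 1), (a, 1)], (a', 1) # w) \<in> R3 \<or>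
       (\<exists>b\<in>{B1, B2, B3, B4}. ([(Zc, 1), (a, 1)], [(a', 2), (b, 1)] @ w) \<in> R3)"
      using equation_ZA[OF a] by blast
    have w': "set (map (shift m) w) \<subseteq> chain_gates (Suc m)"
      using w(2) shift_front[of _ m] by (auto simp: chain_gates_def)
    have a': "a' \<noteq> Omega"
      using w(1) by auto
    from w(3) show ?thesis
    proof (elim disjE bexE)
      assume "([(Zc, 1), (a, 1)], (a', 1) # w) \<in> R3"
      then have "derives r (map (shift m) [(Zc, 1), (a, 1)]) (map (shift m) ((a', 1) # w))"
        using r by (intro derives_equation_2) auto
      then have "derives r [g, (a, Suc m)] ([(a', Suc m)] @ map (shift m) w)"
        using up a' a_arity by (auto simp: shift_gate)
      then show ?thesis
        using w' t m k_eq w(1) by (elim finish) (auto intro: Z_wordsI)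
    next
      fix b assume b: "b \<in> {B1, B2, B3, B4}" and "([(Zc, 1), (a, 1)], [(a', 2), (b, 1)] @ w) \<in> R3"
      then have "derives r (map (shift m) [(Zc, 1), (a, 1)]) (map (shift m) ([(a', 2), (b, 1)] @ w))"
        using r by (intro derives_equation_2) auto
      moreover have "b \<noteq> Omega"
        using b by auto
      ultimately have "derives r [g, (a, Suc m)] ([(a', Suc (Suc m)), (b, Suc m)] @ map (shift m) w)"
        using up a' a_arity by (auto simp: shift_gate)
      moreover have "[(a', Suc (Suc m)), (b, Suc m)] @ s' \<in> Z_words r" if "s' \<in> B_chains m" for s'
        using that b r w(1) Z_wordsI[of a' "Suc m" r "(b, Suc m) # s'"] by auto
      ultimately show ?thesis
        using w' t m k_eq by (elim finish) auto
    qed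
  next
    case down
    obtain b s where b: "b \<in> {B1, B2, B3, B4}" and s: "s \<in> B_chains i" and t_eq: "t = (b, Suc i) # s"
      using t down by auto
    have r: "i + 2 \<le> r"
      using m down by simp
    obtain a' w where w: "a' \<in> {A1, A2, A3}" "set w \<subseteq> front 1"
      "([(Zc, 1), (a, 2), (b, 1)], (a', 1) # w) \<in> R4 \<or>
       (\<exists>b'\<in>{B1, B2, B3, B4}. ([(Zc, 1), (a, 2), (b, 1)], [(a', 2), (b', 1)] @ w) \<in> R4)"
      using equation_ZAB[OF a b] by blast
    have w': "set (map (shift i) w) \<subseteq> chain_gates (Suc i)"
      using w(2) shift_front[of _ i] by (auto simp: chain_gates_def)
    have neq: "a' \<noteq> Omega" "b \<noteq> Omega"
      using w(1) b by auto
    from w(3) show ?thesis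
    proof (elim disjE bexE)
      assume "([(Zc, 1), (a, 2), (b, 1)], (a', 1) # w) \<in> R4"
      then have "derives r (map (shift i) [(Zc, 1), (a, 2), (b, 1)]) (map (shift i) ((a', 1) # w))"
        using r by (intro derives_equation_2) auto
      then have "derives r [g, (a, Suc m), (b, Suc i)] ([(a', Suc i)] @ map (shift i) w)"
        using down neq a_arity by (auto simp: shift_gate)
      then show ?thesis
        using w' s r k_eq t_eq w(1) by (elim finish) (auto intro: Z_wordsI)
    next
      fix b' assume b': "b' \<in> {B1, B2, B3, B4}" and "([(Zc, 1), (a, 2), (b, 1)], [(a', 2), (b', 1)] @ w) \<in> R4"
      then have "derives r (map (shift i) [(Zc, 1), (a, 2), (b, 1)]) (map (shift i) ([(a', 2), (b', 1)] @ w))"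
        using r by (intro derives_equation_2) auto
      moreover have "b' \<noteq> Omega"
        using b' by auto
      ultimately have "derives r [g, (a, Suc m), (b, Suc i)] ([(a', Suc (Suc i)), (b', Suc i)] @ map (shift i) w)"
        using down neq a_arity by (auto simp: shift_gate)
      moreover have "[(a', Suc (Suc i)), (b', Suc i)] @ s' \<in> Z_words r" if "s' \<in> B_chains i" for s'
        using that b' r w(1) Z_wordsI[of a' "Suc i" r "(b', Suc i) # s'"] by auto
      ultimately show ?thesis
        using w' s r k_eq t_eq by (elim finish) auto
    qed
  qed
qed

lemma Z_words_absorb:
  assumes "set v \<subseteq> generators" "\<forall>g\<in>set v. fits r g" "k \<in> Z_words r"
  shows "\<exists>k'\<in>Z_words r. \<exists>w. set w \<subseteq> past_Z \<and> (\<forall>g\<in>set w. fits r g) \<and> derives r (v @ k) (k' @ w)"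
  by (rule absorb_word[OF _ _ assms]) (erule (2) Z_words_absorb_gate, erule Z_words_fit)

section \<open>Pushing gates through an X-normal word\<close>

definition past_X :: "nat \<Rightarrow> located_gate set" where
  "past_X r = insert (Omega, 1) (behind r)"

text \<open>An offset \<open>i\<close> is carried besides the number \<open>k\<close> of
  \<open>D\<close>s, because this chain runs downwards and its tail starts one wire lower.\<close>

primrec D_chains :: "nat \<Rightarrow> nat \<Rightarrow> located_gate list set" where
  "D_chains i 0 = {[(e, Suc i)] | e. e \<in> {E1, E2, E3, E4}}"
| "D_chains i (Suc k) = {(d, Suc i) # t | d t. d \<in> {D1, D2, D3, D4} \<and> t \<in> D_chains (Suc i) k}"

lemma D_chains_fit: "t \<in> D_chains i k \<Longrightarrow> i + k < n \<Longrightarrow> \<forall>g\<in>set t. fits n g"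
proof (induction k arbitrary: i t)
  case (Suc k)
  then obtain d s where d: "t = (d, Suc i) # s" "d \<in> {D1, D2, D3, D4}" "s \<in> D_chains (Suc i) k"
    by auto
  moreover have "\<forall>g\<in>set s. fits n g"
    using Suc.IH[OF d(3)] Suc.prems by simp
  moreover have "fits n (d, Suc i)"
    using Suc.prems d by (auto simp: fits_def)
  ultimately show ?case
    by simp
qed (auto simp: fits_def)

text \<open>On exactly \<open>Suc i\<close> wires, fitting leaves in \<open>past_D (Suc i)\<close>
  only the scalar, \<open>S\<close> on the last wire, and gates above that wire: \<open>Zc\<close>
  starting there would reach beyond it. The scalar and the gates above commute with the
  \<open>E\<close>, which absorbs the \<open>S\<close> without remainder.\<close>

lemma E_absorb:
  assumes "g \<in> past_D (Suc i)" "fits (Suc i) g" "e \<in> {E1, E2, E3, E4}"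
  shows "\<exists>e'\<in>{E1, E2, E3, E4}. \<exists>w. set w \<subseteq> past_X (Suc i) \<and>
    derives (Suc i) [g, (e, Suc i)] ([(e', Suc i)] @ w)"
proof -
  have e: "arity e = 1" "e \<noteq> Omega"
    using assms(3) by auto
  consider "g = (Omega, 1)" | "g = (S, Suc i)" | "g \<in> behind (Suc i)" "snd g + arity (fst g) \<le> Suc i"
    using assms(1,2) unfolding past_D_def behind_def fits_def gens_def by force
  then show ?thesis
  proof cases
    case 1
    then show ?thesis
      using assms(3) by (intro bexI[of _ e] exI[of _ "[g]"])
        (auto intro!: derives_commute simp: disjoint_gates_def past_X_def)
  next
    case 2
    obtain e' where e': "e' \<in> {E1, E2, E3, E4}" "([(S, 1), (e, 1)], [(e', 1)]) \<in> R18"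
      using equation_E[OF assms(3)] by blast
    have "derives (Suc i) (map (shift i) [(S, 1), (e, 1)]) (map (shift i) [(e', 1)])"
      using e'(2) by (intro derives_equation_1) auto
    moreover have "e' \<noteq> Omega"
      using e'(1) by auto
    ultimately show ?thesis
      using 2 e e'(1) by (intro bexI[of _ e'] exI[of _ "[]"]) (auto simp: shift_gate)
  next
    case 3
    then show ?thesis
      using assms(3) by (intro bexI[of _ e] exI[of _ "[g]"])
        (auto intro!: derives_commute simp: disjoint_gates_def past_X_def)
  qed
qed

text \<open>As for the \<open>B\<close>s, the gates without an equation are absent: \<open>H\<close>
  on the upper wire of the \<open>D\<close>, and a \<open>Zc\<close> ending on that wire from above,
  which \<open>behind (Suc i)\<close> excludes. \<open>(Zc, i + 2)\<close> reaches below the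
  \<open>D\<close> and is left to (R19).\<close>

lemma past_D_gate_before_D:
  assumes "g \<in> past_D (Suc i)" "arity d = 2"
  shows "disjoint_gates g (d, Suc i) \<and> g \<in> past_D (Suc (Suc i))
    \<or> g \<in> {(S, Suc i), (Zc, Suc i), (S, i + 2), (H, i + 2)} \<or> g = (Zc, i + 2)"
proof -
  consider "g = (Omega, 1)" | "g \<in> {(S, Suc i), (Zc, Suc i)}"
    | "fst g \<in> gens" "snd g = i + 2" | "fst g \<in> gens" "i + 2 < snd g" | "fst g \<in> gens" "snd g + arity (fst g) \<le> Suc i"
    using assms(1) unfolding past_D_def behind_def by fastforce
  then show ?thesis
  proof cases
    case 1
    then show ?thesis
      by (simp add: disjoint_gates_def past_D_def)
  next
    case 2
    then show ?thesis
      by blast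
  next
    case 3
    then show ?thesis
      by (cases g) (auto simp: gens_def)
  next
    case 4
    then show ?thesis
      by (cases g) (simp add: assms(2) disjoint_gates_def past_D_def)
  next
    case 5
    then show ?thesis
      by (cases g) (simp add: disjoint_gates_def past_D_def behind_def)
  qed
qed

lemma D_absorb:
  assumes "g \<in> past_D (Suc i)" "g \<noteq> (Zc, i + 2)" "d \<in> {D1, D2, D3, D4}" "i + 2 \<le> n"
  shows "\<exists>d'\<in>{D1, D2, D3, D4}. \<exists>w. set w \<subseteq> past_D (Suc (Suc i)) \<and>
    derives n [g, (d, Suc i)] ([(d', Suc i)] @ w)"
proof -
  have d: "arity d = 2" "d \<noteq> Omega"
    using assms(3) by auto
  consider (commute) "disjoint_gates g (d, Suc i)" "g \<in> past_D (Suc (Suc i))"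
    | (two) g' where "g' \<in> {(S, 1), (Zc, 1), (S, 2), (H, 2)}" "g = shift i g'"
  proof -
    have "disjoint_gates g (d, Suc i) \<and> g \<in> past_D (Suc (Suc i))
        \<or> (\<exists>g'\<in>{(S, 1), (Zc, 1), (S, 2), (H, 2)}. g = shift i g')"
      using past_D_gate_before_D[OF assms(1) d(1)] assms(2) by (auto simp: shift_gate)
    then show thesis
      using that by blast
  qed
  then show ?thesis
  proof cases
    case commute
    then show ?thesis
      using assms(3) by (intro bexI[of _ d] exI[of _ "[g]"]) (auto intro: derives_commute)
  next
    case two
    obtain d' w where d': "d' \<in> {D1, D2, D3, D4}" "set w \<subseteq> past_D 2"
      "([g', (d, 1)], (d', 1) # w) \<in> R14 \<union> R15 \<union> R16 \<union> R17"
      using equation_D[OF two(1) assms(3)] by blast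
    have "derives n (map (shift i) [g', (d, 1)]) (map (shift i) ((d', 1) # w))"
      using d'(3) assms(4) by (intro derives_equation_2) auto
    moreover have "set (map (shift i) w) \<subseteq> past_D (Suc (Suc i))"
      using d'(2) shift_past_D[of _ 2 i] by auto
    ultimately show ?thesis
      using d' d two by (intro bexI[of _ d'] exI[of _ "map (shift i) w"]) (auto simp: shift_gate)
  qed
qed

lemma DD_absorb:
  assumes "d \<in> {D1, D2, D3, D4}" "d' \<in> {D1, D2, D3, D4}" "i + 3 \<le> n"
  shows "\<exists>d1\<in>{D1, D2, D3, D4}. \<exists>d2\<in>{D1, D2, D3, D4}. \<exists>w. set w \<subseteq> past_D (Suc (Suc (Suc i))) \<and>
    derives n [(Zc, i + 2), (d, Suc i), (d', Suc (Suc i))] ([(d1, Suc i), (d2, Suc (Suc i))] @ w)"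
proof -
  obtain d1 d2 w where w: "d1 \<in> {D1, D2, D3, D4}" "d2 \<in> {D1, D2, D3, D4}" "set w \<subseteq> past_D 3"
    "([(Zc, 2), (d, 1), (d', 2)], [(d1, 1), (d2, 2)] @ w) \<in> R19"
    using equation_DD[OF assms(1,2)] by blast
  have "derives n (map (shift i) [(Zc, 2), (d, 1), (d', 2)]) (map (shift i) ([(d1, 1), (d2, 2)] @ w))"
    using w(4) assms(3) by (intro derives_equation_3) auto
  moreover have "set (map (shift i) w) \<subseteq> past_D (Suc (Suc (Suc i)))"
    using w(3) shift_past_D[of _ 3 i] by (auto simp: numeral_3_eq_3)
  moreover have "d1 \<noteq> Omega" "d2 \<noteq> Omega" "d \<noteq> Omega" "d' \<noteq> Omega"
    using w assms by auto
  ultimately show ?thesis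
    using w by (intro bexI[of _ d1] bexI[of _ d2] exI[of _ "map (shift i) w"]) (auto simp: shift_gate)
qed

text \<open>The condition \<open>n = Suc (i + k)\<close> puts the \<open>E\<close> on the last wire.
  The induction is strong because (R19) engages two \<open>D\<close>s at once.\<close>

lemma D_chains_absorb:
  assumes "t \<in> D_chains i k" "n = Suc (i + k)" "set v \<subseteq> past_D (Suc i)" "\<forall>g\<in>set v. fits n g"
  shows "\<exists>t'\<in>D_chains i k. \<exists>w. set w \<subseteq> past_X n \<and> (\<forall>g\<in>set w. fits n g) \<and> derives n (v @ t) (t' @ w)"
  using assms
proof (induction k arbitrary: i t v rule: less_induct)
  case (less k)
  have single: "\<exists>t'\<in>D_chains i k. \<exists>w. set w \<subseteq> past_X n \<and> derives n (g # t) (t' @ w)"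
    if g: "g \<in> past_D (Suc i)" "fits n g" and t: "t \<in> D_chains i k" for g t
  proof (cases k)
    case 0
    then obtain e where e: "e \<in> {E1, E2, E3, E4}" "t = [(e, Suc i)]"
      using t by auto
    have n: "n = Suc i"
      using less.prems(2) 0 by simp
    show ?thesis
    proof -
      obtain e' w where "e' \<in> {E1, E2, E3, E4}" "set w \<subseteq> past_X n" "derives n (g # t) ([(e', Suc i)] @ w)"
        using E_absorb[OF g(1) g(2)[unfolded n] e(1)] e(2) unfolding n by blast
      then show ?thesis
        using 0 by (intro bexI[of _ "[(e', Suc i)]"]) auto
    qed
  next
    case (Suc p)
    then obtain d s where d: "d \<in> {D1, D2, D3, D4}" "t = (d, Suc i) # s" "s \<in> D_chains (Suc i) p"
      using t by auto
    have fits_t: "\<forall>g\<in>set t. fits n g"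
      using D_chains_fit[OF t] less.prems(2) by simp
    show ?thesis
    proof (cases "g = (Zc, i + 2)")
      case False
      obtain d' w where w: "d' \<in> {D1, D2, D3, D4}" "set w \<subseteq> past_D (Suc (Suc i))"
        "derives n [g, (d, Suc i)] ([(d', Suc i)] @ w)"
        using D_absorb[OF g(1) False d(1), of n] Suc less.prems(2) by auto
      have "\<exists>k'\<in>D_chains (Suc i) p. \<exists>w. set w \<subseteq> past_X n \<and> derives n ([g, (d, Suc i)] @ s) ([(d', Suc i)] @ k' @ w)"
      proof (rule absorb_compose[OF w(3) _ w(2)])
        show "\<forall>h\<in>set [g, (d, Suc i)]. fits n h"
          using g(2) fits_t d(2) by simp
        show "\<exists>k'\<in>D_chains (Suc i) p. \<exists>w. set w \<subseteq> past_X n \<and> derives n (v @ s) (k' @ w)"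
          if "set v \<subseteq> past_D (Suc (Suc i))" "\<forall>h\<in>set v. fits n h" for v
          using less.IH[OF _ d(3) _ that] Suc less.prems(2) by auto
      qed
      then obtain k' w' where "k' \<in> D_chains (Suc i) p" "set w' \<subseteq> past_X n"
          "derives n (g # t) (((d', Suc i) # k') @ w')"
        using d(2) by auto
      then show ?thesis
        using w(1) Suc by (intro bexI[of _ "(d', Suc i) # k'"]) auto
    next
      case True
      then have "Suc (Suc (Suc i)) \<le> n"
        using g(2) by (simp add: fits_def)
      \<comment> \<open>This \<open>Zc\<close> occupies a wire below the first \<open>D\<close>, so
        the chain cannot end there and has a second \<open>D\<close>.\<close>
      then obtain p' where p': "p = Suc p'"
        using less.prems(2) Suc by (cases p) auto
      then obtain d' s' where d': "d' \<in> {D1, D2, D3, D4}" "s = (d', Suc (Suc i)) # s'" "s' \<in> D_chains (Suc (Suc i)) p'"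
        using d by auto
      obtain d1 d2 w where w: "d1 \<in> {D1, D2, D3, D4}" "d2 \<in> {D1, D2, D3, D4}" "set w \<subseteq> past_D (Suc (Suc (Suc i)))"
        "derives n [(Zc, i + 2), (d, Suc i), (d', Suc (Suc i))] ([(d1, Suc i), (d2, Suc (Suc i))] @ w)"
        using DD_absorb[OF d(1) d'(1), of i n] less.prems(2) Suc p' by auto
      have "\<exists>k'\<in>D_chains (Suc (Suc i)) p'. \<exists>w. set w \<subseteq> past_X n \<and>
          derives n ([(Zc, i + 2), (d, Suc i), (d', Suc (Suc i))] @ s') ([(d1, Suc i), (d2, Suc (Suc i))] @ k' @ w)"
      proof (rule absorb_compose[OF w(4) _ w(3)])
        show "\<forall>h\<in>set [(Zc, i + 2), (d, Suc i), (d', Suc (Suc i))]. fits n h"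
          using g(2) fits_t d(2) d'(2) True by simp
        show "\<exists>k'\<in>D_chains (Suc (Suc i)) p'. \<exists>w. set w \<subseteq> past_X n \<and> derives n (v @ s') (k' @ w)"
          if "set v \<subseteq> past_D (Suc (Suc (Suc i)))" "\<forall>h\<in>set v. fits n h" for v
          using less.IH[OF _ d'(3) _ that] Suc p' less.prems(2) by auto
      qed
      then obtain k' w' where "k' \<in> D_chains (Suc (Suc i)) p'" "set w' \<subseteq> past_X n"
          "derives n (g # t) (((d1, Suc i) # (d2, Suc (Suc i)) # k') @ w')"
        using True d d' by auto
      then show ?thesis
        using w Suc p' by (intro bexI[of _ "(d1, Suc i) # (d2, Suc (Suc i)) # k'"]) auto
    qed
  qed
  have fit: "\<forall>g\<in>set t. fits n g" if "t \<in> D_chains i k" for t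
    using D_chains_fit[OF that] less.prems(2) by simp
  show ?case
    using absorb_word[OF single fit less.prems(3,4,1)] by blast
qed

section \<open>Explicit form of the normal words\<close>

lemma B_chains_explicit:
  "t \<in> B_chains q \<Longrightarrow> \<exists>b c. range b \<subseteq> {B1, B2, B3, B4} \<and> c \<in> {C1, C2} \<and>
    t = map (\<lambda>r. (b r, Suc q - r)) [1..<Suc q] @ [(c, 1)]"
proof (induction q arbitrary: t)
  case 0
  then show ?case
    by (intro exI[of _ "\<lambda>_. B1"]) auto
next
  case (Suc q)
  then obtain b0 s where b0: "b0 \<in> {B1, B2, B3, B4}" "t = (b0, Suc q) # s" "s \<in> B_chains q"
    by auto
  obtain b c where b: "range b \<subseteq> {B1, B2, B3, B4}" "c \<in> {C1, C2}"
    "s = map (\<lambda>r. (b r, Suc q - r)) [1..<Suc q] @ [(c, 1)]"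
    using Suc.IH[OF b0(3)] by blast
  \<comment> \<open>Positions are counted from the start of the chain, so prepending a
    \<open>B\<close> moves the old choice function by one.\<close>
  define b' where "b' r = (if r = 1 then b0 else b (r - 1))" for r
  have "[1..<Suc (Suc q)] = 1 # map Suc [1..<Suc q]"
    by (simp add: upt_conv_Cons map_Suc_upt del: upt_Suc)
  then have "map (\<lambda>r. (b' r, Suc (Suc q) - r)) [1..<Suc (Suc q)] = (b0, Suc q) # map (\<lambda>r. (b r, Suc q - r)) [1..<Suc q]"
    by (simp add: b'_def del: upt_Suc)
  moreover have "range b' \<subseteq> {B1, B2, B3, B4}"
    using b(1) b0(1) by (auto simp: b'_def)
  ultimately show ?case
    using b b0 by (intro exI[of _ b'] exI[of _ c]) (simp del: upt_Suc)
qed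

lemma Z_words_normal: "k \<in> Z_words r \<Longrightarrow> k \<in> Z_normal r"
proof -
  assume "k \<in> Z_words r"
  then obtain a m t where a: "a \<in> {A1, A2, A3}" and m: "m < r" and t: "t \<in> B_chains m" and k: "k = (a, Suc m) # t"
    by (auto simp: Z_words_def)
  obtain b c where "range b \<subseteq> {B1, B2, B3, B4}" "c \<in> {C1, C2}"
    "t = map (\<lambda>r. (b r, Suc m - r)) [1..<Suc m] @ [(c, 1)]"
    using B_chains_explicit[OF t] by blast
  then show ?thesis
    unfolding Z_normal_def using a m k
    by (intro CollectI exI[of _ "Suc m"] exI[of _ a] exI[of _ b] exI[of _ c]) (simp del: upt_Suc)
qed

lemma D_chains_explicit:
  "D_chains i k = {map (\<lambda>r. (d r, r)) [Suc i..<Suc (i + k)] @ [(e, Suc (i + k))] | d e.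
     range d \<subseteq> {D1, D2, D3, D4} \<and> e \<in> {E1, E2, E3, E4}}"
proof (induction k arbitrary: i)
  case 0
  \<comment> \<open>Without any \<open>D\<close> the chain determines no choice function, but the
    set comprehension still asks for a total one.\<close>
  have "\<exists>d :: nat \<Rightarrow> gate. range d \<subseteq> {D1, D2, D3, D4}"
    by (intro exI[of _ "\<lambda>_. D1"]) auto
  then show ?case
    by auto
next
  case (Suc k)
  have upt: "[Suc i..<Suc (i + Suc k)] = Suc i # [Suc (Suc i)..<Suc (Suc i + k)]"
    by (simp add: upt_conv_Cons del: upt_Suc)
  show ?case
  proof (intro equalityI subsetI)
    fix t assume "t \<in> D_chains i (Suc k)"
    then obtain d0 d e where d0: "d0 \<in> {D1, D2, D3, D4}" and d: "range d \<subseteq> {D1, D2, D3, D4}" "e \<in> {E1, E2, E3, E4}"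
      and t: "t = (d0, Suc i) # map (\<lambda>r. (d r, r)) [Suc (Suc i)..<Suc (Suc i + k)] @ [(e, Suc (Suc i + k))]"
      by (auto simp: Suc.IH simp del: upt_Suc)
    have "t = map (\<lambda>r. ((d(Suc i := d0)) r, r)) [Suc i..<Suc (i + Suc k)] @ [(e, Suc (i + Suc k))]"
      unfolding upt t by (simp del: upt_Suc)
    moreover have "range (d(Suc i := d0)) \<subseteq> {D1, D2, D3, D4}"
      using d(1) d0 by auto
    ultimately show "t \<in> {map (\<lambda>r. (d r, r)) [Suc i..<Suc (i + Suc k)] @ [(e, Suc (i + Suc k))] | d e.
        range d \<subseteq> {D1, D2, D3, D4} \<and> e \<in> {E1, E2, E3, E4}}"
      using d(2) by blast
  next
    fix t assume "t \<in> {map (\<lambda>r. (d r, r)) [Suc i..<Suc (i + Suc k)] @ [(e, Suc (i + Suc k))] | d e.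
        range d \<subseteq> {D1, D2, D3, D4} \<and> e \<in> {E1, E2, E3, E4}}"
    then obtain d e where d: "range d \<subseteq> {D1, D2, D3, D4}" "e \<in> {E1, E2, E3, E4}"
      and t: "t = map (\<lambda>r. (d r, r)) [Suc i..<Suc (i + Suc k)] @ [(e, Suc (i + Suc k))]"
      by blast
    have "map (\<lambda>r. (d r, r)) [Suc (Suc i)..<Suc (Suc i + k)] @ [(e, Suc (Suc i + k))] \<in> D_chains (Suc i) k"
      unfolding Suc.IH using d by blast
    moreover have "d (Suc i) \<in> {D1, D2, D3, D4}"
      using d(1) by blast
    ultimately show "t \<in> D_chains i (Suc k)"
      unfolding t upt by (simp del: upt_Suc)
  qed
qed

lemma X_normal_eq_D_chains: "X_normal (Suc k) = D_chains 0 k"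
  by (simp add: X_normal_def D_chains_explicit del: upt_Suc)

text \<open>Each use of (BCD) turns \<open>C1\<close> into \<open>B1\<close>, a \<open>C1\<close>
  one wire higher, and \<open>D1\<close>. The \<open>B1\<close>s collect in front with descending
  locations and the \<open>D1\<close>s behind with ascending ones, the orders of the two normal
  forms.\<close>

lemma C1_expand:
  "Suc q \<le> n \<Longrightarrow> \<exists>t\<in>B_chains q. derives n [(C1, Suc q)] (t @ map (\<lambda>r. (D1, r)) [1..<Suc q])"
proof (induction q)
  case (Suc q)
  then obtain t where t: "t \<in> B_chains q" "derives n [(C1, Suc q)] (t @ map (\<lambda>r. (D1, r)) [1..<Suc q])"
    by auto
  have "derives n (map (shift q) [(C1, 2)]) (map (shift q) [(B1, 1), (C1, 1), (D1, 1)])"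
    using Suc.prems by (intro derives_equation_2) (auto simp: BCD_def)
  then have "derives n [(C1, Suc (Suc q))] [(B1, Suc q), (C1, Suc q), (D1, Suc q)]"
    by (simp add: shift_gate)
  also have "derives n [(B1, Suc q), (C1, Suc q), (D1, Suc q)]
      ([(B1, Suc q)] @ (t @ map (\<lambda>r. (D1, r)) [1..<Suc q]) @ [(D1, Suc q)])"
    using derives_context[OF t(2), of "[(B1, Suc q)]" "[(D1, Suc q)]"] by simp
  finally show ?case
    using t(1) by (intro bexI[of _ "(B1, Suc q) # t"]) simp_all
qed auto

text \<open>(ACE) is applied on the last wire, so that its \<open>E1\<close> already stands where
  the \<open>X\<close>-normal word has to end, and the \<open>D1\<close>s lead down to it.\<close>

lemma identity_expand: "\<exists>k\<in>Z_words (Suc r). \<exists>t\<in>D_chains 0 r. derives (Suc r) [] (k @ t)"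
proof -
  obtain t where t: "t \<in> B_chains r" "derives (Suc r) [(C1, Suc r)] (t @ map (\<lambda>r. (D1, r)) [1..<Suc r])"
    using C1_expand[of r "Suc r"] by auto
  have "derives (Suc r) (map (shift r) []) (map (shift r) [(A1, 1), (C1, 1), (E1, 1)])"
    by (intro derives_equation_1) (auto simp: ACE_def)
  then have "derives (Suc r) [] [(A1, Suc r), (C1, Suc r), (E1, Suc r)]"
    by (simp add: shift_gate)
  also have "derives (Suc r) [(A1, Suc r), (C1, Suc r), (E1, Suc r)]
      ([(A1, Suc r)] @ (t @ map (\<lambda>r. (D1, r)) [1..<Suc r]) @ [(E1, Suc r)])"
    using derives_context[OF t(2), of "[(A1, Suc r)]" "[(E1, Suc r)]"] by simp
  finally have "derives (Suc r) [] (((A1, Suc r) # t) @ (map (\<lambda>r. (D1, r)) [1..<Suc r] @ [(E1, Suc r)]))"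
    by simp
  moreover have "(A1, Suc r) # t \<in> Z_words (Suc r)"
    using t(1) by (auto intro: Z_wordsI)
  moreover have "map (\<lambda>r. (D1, r)) [1..<Suc r] @ [(E1, Suc r)] \<in> D_chains 0 r"
    unfolding D_chains_explicit by (auto intro!: exI[of _ "\<lambda>_. D1"] simp del: upt_Suc)
  ultimately show ?thesis
    by blast
qed

section \<open>Normalisation by induction on the number of wires\<close>

lemma past_Z_subset_past_D: "past_Z \<subseteq> past_D (Suc 0)"
  by (auto simp: past_Z_def past_D_def)

text \<open>A gate of \<open>behind (Suc r)\<close> ends on wire \<open>r\<close> at the latest, and
  \<open>X\<close> is not among these gates, so the remainder is a legitimate input for the
  induction hypothesis.\<close>

lemma past_X_fits: "g \<in> past_X (Suc r) \<Longrightarrow> fits (Suc r) g \<Longrightarrow> g \<in> generators \<and> fits r g"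
  by (auto simp: past_X_def behind_def generators_def fits_def)

text \<open>No level collects its scalars: they pass through as gates of the remainder. On 0 wires
  nothing but scalars fits, so all phases appear together at the end.\<close>

lemma normalise_word:
  assumes "set v \<subseteq> generators" "\<forall>g\<in>set v. fits n g"
  shows "\<exists>w\<in>ZX_normal n. \<exists>p. derives n v (w @ phase p)"
  using assms
proof (induction n arbitrary: v)
  case 0
  have "g = (Omega, 1)" if "g \<in> set v" for g
    using 0 that by (fastforce simp: generators_def gens_def fits_def)
  then have "v = phase (length v)"
    unfolding phase_def by (metis replicate_length_same)
  then show ?case
    by (metis ZX_normal.simps(1) append_Nil rtranclp.rtrancl_refl singletonI)
next
  case (Suc r)
  obtain k t where k: "k \<in> Z_words (Suc r)" and t: "t \<in> D_chains 0 r" and kt: "derives (Suc r) [] (k @ t)"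
    using identity_expand by blast
  obtain k' u where k': "k' \<in> Z_words (Suc r)" "set u \<subseteq> past_Z" "\<forall>g\<in>set u. fits (Suc r) g"
    "derives (Suc r) (v @ k) (k' @ u)"
    using Z_words_absorb[OF Suc.prems k] by blast
  obtain t' v' where t': "t' \<in> D_chains 0 r" "set v' \<subseteq> past_X (Suc r)" "\<forall>g\<in>set v'. fits (Suc r) g"
    "derives (Suc r) (u @ t) (t' @ v')"
    using D_chains_absorb[OF t, of "Suc r" u] subset_trans[OF k'(2) past_Z_subset_past_D] k'(3) by auto
  have v': "set v' \<subseteq> generators" "\<forall>g\<in>set v'. fits r g"
    using t'(2,3) past_X_fits by blast+
  obtain w p where w: "w \<in> ZX_normal r" "derives r v' (w @ phase p)"
    using Suc.IH[OF v'] by blast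
  \<comment> \<open>The normal form of the identity is inserted behind \<open>v\<close> and from
    here on absorbs it.\<close>
  have "derives (Suc r) v (v @ k @ t)"
    using derives_append_left[OF kt, of v] by simp
  also have "derives (Suc r) (v @ k @ t) (k' @ u @ t)"
    using derives_append_right[OF k'(4), of t] by simp
  also have "derives (Suc r) (k' @ u @ t) (k' @ t' @ v')"
    using derives_append_left[OF t'(4), of k'] by simp
  also have "derives (Suc r) (k' @ t' @ v') ((k' @ t' @ w) @ phase p)"
    using derives_append_left[OF derives_mono[OF w(2)], of "Suc r" "k' @ t'"] by simp
  finally have "derives (Suc r) v ((k' @ t' @ w) @ phase p)" .
  moreover have "k' @ t' @ w \<in> ZX_normal (Suc r)"
    using Z_words_normal[OF k'(1)] t'(1) w(1) by (auto simp: X_normal_eq_D_chains)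
  ultimately show ?case
    by blast
qed

lemma derives_phase_mod: "derives n (phase p) (phase (p mod 8))"
proof (induction p rule: less_induct)
  case (less p)
  show ?case
  proof (cases "p < 8")
    case False
    have "derives n (map (shift 0) (phase 8)) (map (shift 0) [])"
      by (rule derives_equation[of 0]) (simp_all add: equations_def R0_def)
    moreover have "map (shift 0) (phase 8) = phase 8"
      by (simp add: phase_def shift_def)
    ultimately have "derives n (phase 8) []"
      by simp
    moreover have "phase p = phase 8 @ phase (p - 8)"
      using False by (simp add: phase_def flip: replicate_add)
    ultimately have "derives n (phase p) (phase (p - 8))"
      using derives_append_right[of n "phase 8" "[]" "phase (p - 8)"] by simp
    also have "derives n (phase (p - 8)) (phase ((p - 8) mod 8))"
      using False by (intro less) simp
    also have "(p - 8) mod 8 = p mod 8"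
      using False by (simp add: le_mod_geq)
    finally show ?thesis .
  qed simp
qed

lemma convertible_to_normal:
  assumes "clifford_circuit n c"
  shows "\<exists>N. normal n N \<and> convertible c N"
proof -
  have c: "well_typed c" "width c = n" "gates c \<subseteq> {Omega, H, S, Zc}"
    using assms by (auto simp: clifford_circuit_def is_circuit_def)
  obtain u where u: "\<forall>g\<in>set u. fits n g \<and> fst g \<in> {Omega, H, S, Zc}" "c \<simeq> on_wires n u"
    using circuit_as_word[OF c(1,3)] c(2) by auto
  \<comment> \<open>A shift by 0 affects only the scalars: it moves them all to location 1, as
    \<open>generators\<close> demands, and the circuit stays the same up to \<simeq>.\<close>
  define v where "v = map (shift 0) u"
  have fits: "\<forall>g\<in>set v. fits n g"
    using fits_map_shift[of u n 0 n] u(1) by (auto simp: v_def)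
  have "set v \<subseteq> generators"
    using u(1) by (fastforce simp: v_def generators_def gens_def shift_def)
  then obtain w p where w: "w \<in> ZX_normal n" "derives n v (w @ phase p)"
    using normalise_word fits by blast
  have "derives n v (w @ phase (p mod 8))"
    using w(2) derives_append_left[OF derives_phase_mod, of n w p] by simp
  then have "convertible (on_wires n v) (on_wires n (w @ phase (p mod 8)))"
    using fits by (rule derives_convertible)
  moreover have "c \<simeq> on_wires n v"
  proof -
    have "on_wires n u \<simeq> framed 0 (on_wires n u) 0"
      by (meson spatial_eq.sym spatial_eq.trans spatial_eq.tensor_unit_left spatial_eq.tensor_unit_right)
    also have "\<dots> \<simeq> on_wires (0 + n + 0) (map (shift 0) u)"
      using u(1) by (intro framed_on_wires) auto
    finally show ?thesis
      using u(2) by (simp add: v_def) (rule spatial_eq.trans)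
  qed
  moreover have "p mod 8 \<le> 7"
    using mod_less_divisor[of 8 p] by linarith
  ultimately show ?thesis
    using w(1) unfolding normal_def
    by (intro exI[of _ "on_wires n (w @ phase (p mod 8))"] exI[of _ w] exI[of _ "p mod 8"] conjI)
      (auto intro: convertible_trans convertible_spatial)
qed

section \<open>Soundness of the equations\<close>

definition sound :: "nat \<Rightarrow> equation set \<Rightarrow> bool" where
  "sound n E \<longleftrightarrow> (\<forall>e\<in>E. same_op n (fst e) (snd e))"

lemma sound_empty: "sound n {} \<longleftrightarrow> True"
  and sound_insert: "sound n (insert (l, r) E) \<longleftrightarrow> same_op n l r \<and> sound n E"
  and sound_Un: "sound n (E \<union> F) \<longleftrightarrow> sound n E \<and> sound n F"
  and sound_Setcompr: "sound n {(L b, R b) | b. P b} \<longleftrightarrow> (\<forall>b. P b \<longrightarrow> same_op n (L b) (R b))"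
  by (auto simp: sound_def)

text \<open>Here and below, \<open>code_simp\<close> decides each equation by running both words on
  the \<open>2 ^ n\<close> basis states. The sets with a variable gate are split into their
  instances first.\<close>

lemma sound_R0: "sound 0 R0"
  unfolding R0_def sound_insert sound_empty by (intro conjI TrueI; code_simp)

lemma sound_R1: "sound 1 R1"
  unfolding R1_def sound_insert sound_empty by (intro conjI TrueI; code_simp)

lemma sound_R2: "sound 1 R2"
  unfolding R2_def sound_insert sound_empty by (intro conjI TrueI; code_simp)

lemma sound_R10: "sound 1 R10"
  unfolding R10_def sound_insert sound_empty by (intro conjI TrueI; code_simp)

lemma sound_R11: "sound 1 R11"
  unfolding R11_def sound_insert sound_empty by (intro conjI TrueI; code_simp)

lemma sound_R18: "sound 1 R18"
  unfolding R18_def sound_insert sound_empty by (intro conjI TrueI; code_simp)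

lemma sound_ACE: "sound 1 ACE"
  unfolding ACE_def sound_insert sound_empty by (intro conjI TrueI; code_simp)

lemma sound_R3: "sound 2 R3"
  unfolding R3_def sound_insert sound_empty by (intro conjI TrueI; code_simp)

lemma sound_R4: "sound 2 R4"
  unfolding R4_def sound_insert sound_empty by (intro conjI TrueI; code_simp)

lemma sound_R5: "sound 2 R5"
  unfolding R5_def sound_insert sound_empty by (intro conjI TrueI; code_simp)

lemma sound_R6: "sound 2 R6"
  unfolding R6_def sound_insert sound_empty by (intro conjI TrueI; code_simp)

lemma sound_R12: "sound 2 R12"
  unfolding R12_def sound_insert sound_empty by (intro conjI TrueI; code_simp)

lemma sound_R14: "sound 2 R14"
  unfolding R14_def sound_insert sound_empty by (intro conjI TrueI; code_simp)

lemma sound_R15: "sound 2 R15"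
  unfolding R15_def sound_insert sound_empty by (intro conjI TrueI; code_simp)

lemma sound_R17: "sound 2 R17"
  unfolding R17_def sound_insert sound_empty by (intro conjI TrueI; code_simp)

lemma sound_BCD: "sound 2 BCD"
  unfolding BCD_def sound_insert sound_empty by (intro conjI TrueI; code_simp)

lemma sound_R13: "sound 3 R13"
  unfolding R13_def sound_insert sound_empty by (intro conjI TrueI; code_simp)

lemma sound_R19: "sound 3 R19"
  unfolding R19_def sound_insert sound_empty by (intro conjI TrueI; code_simp)

lemma sound_R7: "sound 2 R7"
  unfolding R7_def sound_Un sound_insert sound_empty sound_Setcompr insert_iff empty_iff
  by (intro conjI TrueI allI impI; (elim disjE FalseE; hypsubst)?; code_simp)

lemma sound_R8: "sound 2 R8"
  unfolding R8_def sound_Un sound_insert sound_empty sound_Setcompr insert_iff empty_iff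
  by (intro conjI TrueI allI impI; (elim disjE FalseE; hypsubst)?; code_simp)

lemma sound_R9: "sound 3 R9"
  unfolding R9_def sound_Un sound_insert sound_empty sound_Setcompr insert_iff empty_iff
  by (intro conjI TrueI allI impI; (elim disjE FalseE; hypsubst)?; code_simp)

lemma sound_R16: "sound 2 R16"
  unfolding R16_def sound_Un sound_insert sound_empty sound_Setcompr insert_iff empty_iff
  by (intro conjI TrueI allI impI; (elim disjE FalseE; hypsubst)?; code_simp)


section \<open>Conversion keeps the operator\<close>

lemma equations_sound:
  assumes "(n, l, r) \<in> equations"
  shows "circuit_op (on_wires n l) = circuit_op (on_wires n r)"
proof -
  have mem: "same_op n l r" if "sound m E" "(n, l, r) \<in> {m} \<times> E" for m E
    using that by (auto simp: sound_def)
  have R: "sound 1 (R1 \<union> R2 \<union> R10 \<union> R11 \<union> R18 \<union> ACE)"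
    "sound 2 (R3 \<union> R4 \<union> R5 \<union> R6 \<union> R7 \<union> R8 \<union> R12 \<union> R14 \<union> R15 \<union> R16 \<union> R17 \<union> BCD)"
    "sound 3 (R9 \<union> R13 \<union> R19)"
    unfolding sound_Un
    by (intro conjI sound_R1 sound_R2 sound_R3 sound_R4 sound_R5 sound_R6 sound_R7 sound_R8 sound_R9
      sound_R10 sound_R11 sound_R12 sound_R13 sound_R14 sound_R15 sound_R16 sound_R17 sound_R18
      sound_R19 sound_ACE sound_BCD)+
  have "same_op n l r"
    using assms unfolding equations_def
    by (elim UnE) (rule mem[OF sound_R0] mem[OF R(1)] mem[OF R(2)] mem[OF R(3)], assumption)+
  then show ?thesis
    using equations_fit[OF assms] by (intro same_op_sound) auto
qed

text \<open>\<open>circuit_op\<close> is compositional, so an equation that is sound on its own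
  wires stays sound in a frame and between any two circuits. Well-typedness of the result is carried
  along for the next use of \<open>spatial_circuit_op\<close>.\<close>

lemma rewrite_use_sound:
  assumes "rewrite_use c d"
  shows "well_typed d \<and> circuit_op c = circuit_op d"
  using assms
proof cases
  case (1 n l r i j c' d')
  have "circuit_op (on_wires n l) = circuit_op (on_wires n r)" "\<forall>g\<in>set r. fits n g"
    using 1(3) equations_sound[of n l r] equations_sound[of n r l] equations_fit[of n l r] equations_fit[of n r l]
    by auto
  then show ?thesis
    using 1(4,5) unfolding 1(1,2) by (simp add: is_circuit_def width_on_wires well_typed_on_wires)
qed

lemma convertible_sound:
  assumes "convertible c d" "well_typed c"
  shows "circuit_op d = circuit_op c"
proof -
  have "well_typed d \<and> circuit_op d = circuit_op c"
    using assms(1) unfolding convertible_def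
  proof (induction rule: rtranclp_induct)
    case (step x y)
    then show ?case
      using spatial_well_typed[of x y] spatial_circuit_op[of x y] rewrite_use_sound[of x y] by auto
  qed (simp add: assms(2))
  then show ?thesis ..
qed

text \<open>The normal form is found by syntax alone; that it denotes the same operator follows from
  convertibility and soundness.\<close>

theorem proposition6p3:
  fixes n :: nat and c :: circuit
  assumes "clifford_circuit n c"
  shows "\<exists>N. normal n N \<and> circuit_op N = circuit_op c \<and> convertible c N"
proof -
  obtain N where "normal n N" "convertible c N"
    using convertible_to_normal[OF assms] by blast
  moreover have "well_typed c"
    using assms by (simp add: clifford_circuit_def is_circuit_def)
  ultimately show ?thesis
    using convertible_sound by blast
qed

end
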